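(* Let $\mathfrak D\subset\mathbb{R}^d$ be a regular domain, $\lambda:\partial\mathfrak D\to\mathbb{R}_+$ bounded and measurable, $\mu$ a finite measure on $\mathfrak D$, and let $\{\eta_t,\ t\ge 0\}$ be the boundary driven diffusion gas in $\mathfrak D$ with reservoir intensity $\lambda$ and a priori measure $\mu$, started from a finite point configuration $\eta$ on $\mathfrak D$. Let $n\in\mathbb{N}$. (a) For all $t\ge0$ and all bounded, measurable and permutation invariant $f:\mathfrak D^n\to\mathbb{R}$, $$\mathbb{E}^\lambda_\eta\left[\int_{\mathfrak D^n}f(\boldsymbol z)\,\eta_t^{(n)}(\mathrm{d}\boldsymbol z)\right]=\sum_{k=0}^n\binom nk\int_{\mathfrak D^n}f(\boldsymbol z)\,\lambda_t^{\otimes k}(\mathrm{d}\boldsymbol z_{[k]})\otimes(S_t^{\otimes(n-k)})^*\eta^{(n-k)}(\mathrm{d}\boldsymbol z_{[n]\setminus[k]}).$$ (b) Assume further that, for $t>0$, the transition probability of the absorbed diffusion $\{X_t\}$ satisfies $p_t(x,\mathrm{d}y)=\mathfrak p_t(x,y)\,m(\mathrm{d}y)$ on $\mathfrak D$, for a symmetric function $\mathfrak p_t(x,y)$ and a finite measure $m$ on $\mathfrak D$. Then, choosing $\mu=m$, for all $t>0$ the measure $\mathbb{E}^\lambda_\eta[\eta_t^{(n)}]$ has the density $$\frac{\mathrm{d}\mathbb{E}^\lambda_\eta[\eta_t^{(n)}]}{\mathrm{d}m^{\otimes n}}(\boldsymbol z)=\sum_{I\subset[n]}\mathbb{E}^{\mathrm{abs}}_{\boldsymbol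 z_I}\left[e^{\int_{\partial\mathfrak D}\log(\lambda)\,\mathrm{d}\xi_t}\mathbf 1_{\{\xi_t(\partial\mathfrak D)=|I|\}}\right]\int_{\mathfrak D^{n-|I|}}\mathfrak p_t^{(n-|I|)}(\boldsymbol z_{[n]\setminus I},\boldsymbol y)\,\eta^{(n-|I|)}(\mathrm{d}\boldsymbol y).$$
   Context: **Domain and diffusion.** A regular domain $\mathfrak D\subset\mathbb{R}^d$ is an open, simply connected, bounded set with Lipschitz boundary $\partial\mathfrak D$; $\bar{\mathfrak D}=\mathfrak D\cup\partial\mathfrak D$. $\{Y_t\}$ is the diffusion on $\mathbb{R}^d$ with generator $\mathcal L=\sum_{i,j}\partial_{x_i}(a_{i,j}(x)\partial_{x_j})+\sum_i b_i(x)\partial_{x_i}$, where $a=(a_{i,j})$ is symmetric, non-degenerate and positive definite, and $\partial^2a_{i,j}/\partial x_i\partial x_\ell$ and $\partial b_i/\partial x_j$ are locally uniformly Hölder continuous on $\bar{\mathfrak D}$. $\{X_t\}$ is the Markov process on $\bar{\mathfrak D}$ evolving as $Y$ in $\mathfrak D$ and absorbed upon hitting $\partial\mathfrak D$. Its semigroup is $S_t$, its transition probability $p_t$, and its law from $x$ is $\mathbb{P}^{\mathrm{abs}}_x$. With $\tau_{\partial\mathfrak D}$ the hitting time of $\partial\mathfrak D$, it is assumed that $\mathbb{P}^{\mathrm{abs}}_x(\tau_{\partial\mathfrak D}<\infty)=1$ for all $x\in\mathfrak D$. **Absorbed particle system.** For $\boldsymbol x=(x_1,\dots,x_k)\in\mathfrak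 D^k$, $\mathbb{E}^{\mathrm{abs}}_{\boldsymbol x}$ is the expectation for $\xi_t=\sum_{i=1}^k\delta_{X_t(i)}$ on $\bar{\mathfrak D}$, with $X(i)$ independent copies of $X$, $X_0(i)=x_i$. **Boundary driven diffusion gas.** Started from $\eta=\sum_{i=1}^{\mathbf N}\delta_{x_i}$, $x_i\in\mathfrak D$, it is $\eta_t=\xi_t|_{\mathfrak D}+\Theta_t$, viewed as a point configuration on $\mathfrak D$. Here $\xi_t$ is the absorbed particle system with $\xi_0=\eta$, $\xi_t|_{\mathfrak D}$ is its restriction to $\mathfrak D$, and $\Theta_t$, independent of $\xi_t$, is a Poisson point process on $\mathfrak D$ with intensity measure $$\lambda_t(\mathrm{d}x)=\left(\int_{\partial\mathfrak D}\lambda(y)\,\mathbb{P}^{\mathrm{abs}}_x(\tau_{\partial\mathfrak D}\le t,\ X_{\tau_{\partial\mathfrak D}}\in\mathrm{d}y)\right)\mu(\mathrm{d}x).$$ $\mathbb{E}^\lambda_\eta$ denotes expectation for this process. **Factorial measures.** For a finite configuration $\eta=\sum_{i=1}^{\mathbf N}\delta_{x_i}$, $\eta^{(n)}=\sum^{\neq}_{1\le i_1,\dots,i_n\le\mathbf N}\delta_{(x_{i_1},\dots,x_{i_n})}$ (sum over mutually distinct indices); $\eta_t^{(n)}$ is that of $\eta_t$. **Notation.** $S_t^{\otimes n}$ is the semigroup of $n$ independent copies of $X$. $(S_t^{\otimes n})^*$ acts on measures by $\int f\,\mathrm{d}(S_t^{\otimes n})^*\nu=\int S_t^{\otimes n}f\,\mathrm{d}\nu$.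 $\mathfrak p_t^{(n)}(\boldsymbol x,\boldsymbol y)=\prod_{i=1}^n\mathfrak p_t(x_i,y_i)$. $[n]=\{1,\dots,n\}$; for $I=\{i_1<\dots<i_k\}$, $\boldsymbol z_I=(z_{i_1},\dots,z_{i_k})$. Terms with no variables (i.e. $k=0$ or $k=n$, $I=\emptyset$ or $I=[n]$) have the corresponding factor equal to $1$. $e^{\int_{\partial\mathfrak D}\log(\lambda)\mathrm{d}\xi_t}$ means the product of $\lambda$ over the points of $\xi_t$ in $\partial\mathfrak D$ (so it is $0$ if $\lambda$ vanishes at such a point). *)

theory Defs
  imports "HOL-Probability.Probability" "HOL-Library.Multiset"
begin

section \<open>Regular domains and the coefficients\<close>

text \<open>Lipschitz boundary: near every boundary point the set is, in suitable orthonormal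
  coordinates (last axis \<open>e\<close>), the region strictly above the graph of a Lipschitz function of
  the component orthogonal to \<open>e\<close>.\<close>

definition lipschitz_boundary :: "(real^'d) set \<Rightarrow> bool" where
  "lipschitz_boundary D \<longleftrightarrow>
     (\<forall>p\<in>frontier D. \<exists>U e \<phi> L. open U \<and> p \<in> U \<and> norm e = 1 \<and> L-lipschitz_on UNIV (\<phi> :: real^'d \<Rightarrow> real) \<and>
        D \<inter> U = {x \<in> U. \<phi> (x - (x \<bullet> e) *\<^sub>R e) < x \<bullet> e})"

definition regular_domain :: "(real^'d) set \<Rightarrow> bool" where
  "regular_domain D \<longleftrightarrow> open D \<and> simply_connected D \<and> bounded D \<and> lipschitz_boundary D"

definition has_partial_on :: "'d \<Rightarrow> (real^'d \<Rightarrow> real) \<Rightarrow> (real^'d \<Rightarrow> real) \<Rightarrow> (real^'d) set \<Rightarrow> bool" where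
  "has_partial_on i f g S \<longleftrightarrow>
     (\<forall>x\<in>S. ((\<lambda>h. f (x + h *\<^sub>R axis i 1)) has_real_derivative g x) (at 0))"

definition partial :: "'d \<Rightarrow> (real^'d \<Rightarrow> real) \<Rightarrow> real^'d \<Rightarrow> real" where
  "partial i f x = deriv (\<lambda>h. f (x + h *\<^sub>R axis i 1)) 0"

definition locally_holder_on :: "(real^'d) set \<Rightarrow> (real^'d \<Rightarrow> real) \<Rightarrow> bool" where
  "locally_holder_on S g \<longleftrightarrow>
     (\<forall>K\<subseteq>S. compact K \<longrightarrow> (\<exists>\<alpha> C. 0 < \<alpha> \<and> \<alpha> \<le> 1 \<and>
        (\<forall>x\<in>K. \<forall>y\<in>K. \<bar>g x - g y\<bar> \<le> C * dist x y powr \<alpha>)))"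

text \<open>A derivative being Hoelder on the closure of \<open>D\<close> means, as usual for functions of class
  \<open>C\<^sup>k\<close> up to the boundary, that it exists in \<open>D\<close> and has a Hoelder extension to the closure.\<close>

definition admissible_coefficients ::
    "(real^'d) set \<Rightarrow> (real^'d \<Rightarrow> real^'d^'d) \<Rightarrow> (real^'d \<Rightarrow> real^'d) \<Rightarrow> bool" where
  "admissible_coefficients D a b \<longleftrightarrow>
     (\<forall>x. transpose (a x) = a x \<and> invertible (a x) \<and> (\<forall>v. v \<noteq> 0 \<longrightarrow> 0 < v \<bullet> (a x *v v))) \<and>
     (\<forall>i j l. \<exists>a' a''. has_partial_on l (\<lambda>x. a x $ i $ j) a' D \<and> has_partial_on i a' a'' D \<and>
        locally_holder_on (closure D) a'') \<and>
     (\<forall>i j. \<exists>b'. has_partial_on j (\<lambda>x. b x $ i) b' D \<and> locally_holder_on (closure D) b')"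


section \<open>Diffusions\<close>

definition generator_op ::
    "(real^'d \<Rightarrow> real^'d^'d) \<Rightarrow> (real^'d \<Rightarrow> real^'d) \<Rightarrow> (real^'d \<Rightarrow> real) \<Rightarrow> real^'d \<Rightarrow> real" where
  "generator_op a b f x =
     (\<Sum>i\<in>UNIV. \<Sum>j\<in>UNIV. partial i (\<lambda>y. a y $ i $ j * partial j f y) x)
     + (\<Sum>i\<in>UNIV. b x $ i * partial i f x)"

text \<open>Test functions: compactly supported \<open>C\<^sup>2\<close> functions to which the operator applies
  classically with a continuous result.  The last two conditions are automatic where \<open>a\<close> is
  continuously differentiable and \<open>b\<close> is continuous, but no regularity of \<open>a\<close>, \<open>b\<close> is
  assumed outside the domain.\<close>

definition test_function ::
    "(real^'d \<Rightarrow> real^'d^'d) \<Rightarrow> (real^'d \<Rightarrow> real^'d) \<Rightarrow> (real^'d \<Rightarrow> real) \<Rightarrow> bool" where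
  "test_function a b f \<longleftrightarrow>
     compact (closure {x. f x \<noteq> 0}) \<and> continuous_on UNIV f \<and>
     (\<forall>j. has_partial_on j f (partial j f) UNIV \<and> continuous_on UNIV (partial j f)) \<and>
     (\<forall>i j. has_partial_on i (partial j f) (partial i (partial j f)) UNIV \<and>
        continuous_on UNIV (partial i (partial j f))) \<and>
     (\<forall>i j. has_partial_on i (\<lambda>y. a y $ i $ j * partial j f y)
        (partial i (\<lambda>y. a y $ i $ j * partial j f y)) UNIV) \<and>
     continuous_on UNIV (generator_op a b f)"

definition natural_filtration :: "'w measure \<Rightarrow> (real \<Rightarrow> 'w \<Rightarrow> real^'d) \<Rightarrow> real \<Rightarrow> 'w measure" where
  "natural_filtration M Y t =
     sigma (space M) {Y s -` B \<inter> space M | s B. 0 \<le> s \<and> s \<le> t \<and> B \<in> sets borel}"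

text \<open>\<open>P x\<close> is the law under which \<open>Y\<close> starts from \<open>x\<close>.  A diffusion is a strong Markov
  process with continuous paths.  That its generator is the given operator is meant in Dynkin's
  sense: the difference quotients of the semigroup converge boundedly and pointwise.\<close>

definition diffusion ::
    "'w measure \<Rightarrow> (real^'d \<Rightarrow> 'w measure) \<Rightarrow> (real \<Rightarrow> 'w \<Rightarrow> real^'d) \<Rightarrow> bool" where
  "diffusion M P Y \<longleftrightarrow>
     P \<in> borel \<rightarrow>\<^sub>M prob_algebra M \<and>
     (\<forall>t\<ge>0. Y t \<in> M \<rightarrow>\<^sub>M borel) \<and>
     (\<forall>\<omega>\<in>space M. continuous_on {0..} (\<lambda>t. Y t \<omega>)) \<and>
     (\<forall>x. AE \<omega> in P x. Y 0 \<omega> = x) \<and>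
     (\<forall>x T. stopping_time (natural_filtration M Y) T \<and> (\<forall>\<omega>\<in>space M. 0 \<le> T \<omega>) \<longrightarrow>
        (\<forall>A\<in>sets (filtration.pre_sigma (space M) (natural_filtration M Y) T).
         \<forall>t\<ge>0. \<forall>B\<in>sets borel.
           emeasure (P x) {\<omega>\<in>A. Y (T \<omega> + t) \<omega> \<in> B} =
           (\<integral>\<^sup>+\<omega>\<in>A. emeasure (P (Y (T \<omega>) \<omega>)) {\<omega>'\<in>space M. Y t \<omega>' \<in> B} \<partial>P x)))"

definition has_generator ::
    "(real^'d \<Rightarrow> real^'d^'d) \<Rightarrow> (real^'d \<Rightarrow> real^'d) \<Rightarrow>
     (real^'d \<Rightarrow> 'w measure) \<Rightarrow> (real \<Rightarrow> 'w \<Rightarrow> real^'d) \<Rightarrow> bool" where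
  "has_generator a b P Y \<longleftrightarrow>
     (\<forall>f. test_function a b f \<longrightarrow>
        (\<forall>x. ((\<lambda>t. ((\<integral>\<omega>. f (Y t \<omega>) \<partial>P x) - f x) / t) \<longlongrightarrow> generator_op a b f x) (at_right 0)) \<and>
        (\<exists>C. \<forall>t>0. \<forall>x. \<bar>((\<integral>\<omega>. f (Y t \<omega>) \<partial>P x) - f x) / t\<bar> \<le> C))"


section \<open>The absorbed diffusion\<close>

definition hitting_time :: "(real^'d) set \<Rightarrow> (real \<Rightarrow> 'w \<Rightarrow> real^'d) \<Rightarrow> 'w \<Rightarrow> ereal" where
  "hitting_time D Y \<omega> = (INF t\<in>{t. 0 \<le> t \<and> Y t \<omega> \<in> frontier D}. ereal t)"

text \<open>\<open>X\<^sub>t\<close> is \<open>Y\<close> stopped at its hitting time of the boundary, which is also the hitting time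
  of the boundary by \<open>X\<close>.\<close>

definition absorbed :: "(real^'d) set \<Rightarrow> (real \<Rightarrow> 'w \<Rightarrow> real^'d) \<Rightarrow> real \<Rightarrow> 'w \<Rightarrow> real^'d" where
  "absorbed D Y t \<omega> = Y (real_of_ereal (min (ereal t) (hitting_time D Y \<omega>))) \<omega>"

definition transition_prob ::
    "(real^'d) set \<Rightarrow> (real^'d \<Rightarrow> 'w measure) \<Rightarrow> (real \<Rightarrow> 'w \<Rightarrow> real^'d) \<Rightarrow> real \<Rightarrow> real^'d \<Rightarrow> (real^'d) measure" where
  "transition_prob D P Y t x = distr (P x) borel (absorbed D Y t)"

text \<open>The measure \<open>P\<^sub>x(\<tau> \<le> t, X\<^sub>\<tau> \<in> dy)\<close> on the boundary.\<close>

definition exit_law ::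
    "(real^'d) set \<Rightarrow> (real^'d \<Rightarrow> 'w measure) \<Rightarrow> (real \<Rightarrow> 'w \<Rightarrow> real^'d) \<Rightarrow> real \<Rightarrow> real^'d \<Rightarrow> (real^'d) measure" where
  "exit_law D P Y t x =
     distr (restrict_space (P x) {\<omega>\<in>space (P x). hitting_time D Y \<omega> \<le> ereal t})
       (restrict_space borel (frontier D))
       (\<lambda>\<omega>. absorbed D Y (real_of_ereal (hitting_time D Y \<omega>)) \<omega>)"

definition reservoir_intensity ::
    "(real^'d) set \<Rightarrow> (real^'d \<Rightarrow> 'w measure) \<Rightarrow> (real \<Rightarrow> 'w \<Rightarrow> real^'d) \<Rightarrow>
     (real^'d \<Rightarrow> real) \<Rightarrow> (real^'d) measure \<Rightarrow> real \<Rightarrow> (real^'d) measure" where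
  "reservoir_intensity D P Y lam \<mu> t =
     density \<mu> (\<lambda>x. \<integral>\<^sup>+y. ennreal (lam y) \<partial>exit_law D P Y t x)"


section \<open>Point configurations and factorial measures\<close>

text \<open>A finite point configuration is a multiset; \<open>\<Sum>j\<in>J. {#x j#}\<close> is the sum of the Dirac
  measures at the \<open>x j\<close>.  Configurations carry the \<open>\<sigma>\<close>-algebra generated by the counts.\<close>

definition num_points :: "'a set \<Rightarrow> 'a multiset \<Rightarrow> nat" where
  "num_points A c = size (filter_mset (\<lambda>x. x \<in> A) c)"

definition config_space :: "'a::topological_space multiset measure" where
  "config_space = sigma UNIV {num_points A -` {k} | A k. A \<in> sets borel}"

text \<open>Tuples of points of \<open>S\<close> are indexed by an arbitrary finite set \<open>J\<close>.  The \<open>n\<close>-tuples are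
  those indexed by \<open>{1..n}\<close>, and the subtuple of \<open>z\<close> with indices in \<open>I\<close> is \<open>restrict z I\<close>,
  without renumbering.\<close>

definition tuple_space :: "'a::topological_space set \<Rightarrow> nat set \<Rightarrow> (nat \<Rightarrow> 'a) measure" where
  "tuple_space S J = PiM J (\<lambda>_. restrict_space borel S)"

text \<open>The points of \<open>c\<close> counted with multiplicity are labelled \<open>(y, l)\<close> with
  \<open>l < count c y\<close>; tuples of mutually distinct labels take the place of tuples of mutually distinct
  indices in an enumeration of \<open>c\<close>.\<close>

definition labelled_points :: "'a multiset \<Rightarrow> ('a \<times> nat) set" where
  "labelled_points c = {(y, l). l < count c y}"

definition factorial_measure ::
    "'a::topological_space set \<Rightarrow> nat set \<Rightarrow> 'a multiset \<Rightarrow> (nat \<Rightarrow> 'a) measure" where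
  "factorial_measure D J c =
     distr (count_space {i \<in> J \<rightarrow>\<^sub>E labelled_points c. inj_on i J}) (tuple_space D J)
       (\<lambda>i. \<lambda>j\<in>J. fst (i j))"

lemma labelled_points_enumeration:
  fixes N :: nat
  shows "\<exists>g. bij_betw g {1..N} (labelled_points (\<Sum>l=1..N. {#x l#})) \<and> (\<forall>l\<in>{1..N}. fst (g l) = x l)"
proof (induction N)
  case 0
  have "labelled_points (\<Sum>l=1..0. {#x l#}) = {}" by (simp add: labelled_points_def)
  then show ?case by (auto intro!: exI[of _ undefined] simp: bij_betw_def)
next
  case (Suc N)
  let ?c = "\<lambda>n. \<Sum>l=1..n. {#x l#}"
  obtain g where g: "bij_betw g {1..N} (labelled_points (?c N))" "\<forall>l\<in>{1..N}. fst (g l) = x l"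
    using Suc by blast
  let ?p = "(x (Suc N), count (?c N) (x (Suc N)))"
  let ?g = "g(Suc N := ?p)"
  have "labelled_points (?c (Suc N)) = insert ?p (labelled_points (?c N))"
    by (auto simp: labelled_points_def less_Suc_eq split: if_splits)
  moreover have "?p \<notin> labelled_points (?c N)"
    by (simp add: labelled_points_def)
  moreover have "bij_betw ?g {1..N} (labelled_points (?c N))"
    using g(1) by (subst bij_betw_cong[where g = g]) auto
  ultimately have "bij_betw ?g (insert (Suc N) {1..N}) (labelled_points (?c (Suc N)))"
    using bij_betw_combine[of ?g "{1..N}" "labelled_points (?c N)" "{Suc N}" "{?p}"]
    by (simp add: bij_betw_singletonI)
  moreover have "insert (Suc N) {1..N} = {1..Suc N}" by auto
  ultimately have "bij_betw ?g {1..Suc N} (labelled_points (?c (Suc N)))" by metis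
  moreover have "\<forall>l\<in>{1..Suc N}. fst (?g l) = x l" using g(2) by auto
  ultimately show ?case by blast
qed

lemma factorial_measure_enumeration:
  fixes x :: "nat \<Rightarrow> 'a::topological_space"
  assumes "\<And>l. l \<in> {1..N} \<Longrightarrow> x l \<in> D"
  shows "factorial_measure D J (\<Sum>l=1..N. {#x l#}) =
    distr (count_space {i \<in> J \<rightarrow>\<^sub>E {1..N}. inj_on i J}) (tuple_space D J) (\<lambda>i. \<lambda>j\<in>J. x (i j))"
proof -
  let ?L = "labelled_points (\<Sum>l=1..N. {#x l#})"
  let ?A = "{i \<in> J \<rightarrow>\<^sub>E {1..N}. inj_on i J}" and ?B = "{i \<in> J \<rightarrow>\<^sub>E ?L. inj_on i J}"
  obtain g where g: "bij_betw g {1..N} ?L" "\<forall>l\<in>{1..N}. fst (g l) = x l"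
    using labelled_points_enumeration by blast
  define h where "h = inv_into {1..N} g"
  have h: "h p \<in> {1..N}" "g (h p) = p" if "p \<in> ?L" for p
  proof -
    have p: "p \<in> g ` {1..N}" using g(1) that by (simp add: bij_betw_def)
    show "h p \<in> {1..N}" unfolding h_def by (rule inv_into_into[OF p])
    show "g (h p) = p" unfolding h_def by (rule f_inv_into_f[OF p])
  qed
  have hg: "h (g l) = l" if "l \<in> {1..N}" for l
    using g(1) that by (simp add: h_def bij_betw_def)
  have gL: "g l \<in> ?L" if "l \<in> {1..N}" for l
    using g(1) that by (auto simp: bij_betw_def)
  have inj_g: "inj_on (\<lambda>j. g (i j)) J" if "i \<in> ?A" for i
  proof (rule inj_onI)
    fix j k assume "j \<in> J" "k \<in> J" "g (i j) = g (i k)"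
    with that hg show "j = k"
      by (metis (mono_tags, lifting) PiE_mem inj_onD mem_Collect_eq)
  qed
  have inj_h: "inj_on (\<lambda>j. h (i j)) J" if "i \<in> ?B" for i
  proof (rule inj_onI)
    fix j k assume "j \<in> J" "k \<in> J" "h (i j) = h (i k)"
    with that h(2) show "j = k"
      by (metis (mono_tags, lifting) PiE_mem inj_onD mem_Collect_eq)
  qed
  have bij: "bij_betw (\<lambda>i. \<lambda>j\<in>J. g (i j)) ?A ?B"
  proof (rule bij_betw_byWitness[where f' = "\<lambda>i. \<lambda>j\<in>J. h (i j)"])
    show "\<forall>i\<in>?A. (\<lambda>j\<in>J. h ((\<lambda>j\<in>J. g (i j)) j)) = i"
    proof (intro ballI ext)
      fix i j assume "i \<in> ?A"
      then have i: "i \<in> J \<rightarrow>\<^sub>E {1..N}" by simp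
      show "(\<lambda>j\<in>J. h ((\<lambda>j\<in>J. g (i j)) j)) j = i j"
      proof (cases "j \<in> J")
        case True
        then show ?thesis using hg[of "i j"] PiE_mem[OF i] by simp
      next
        case False
        then show ?thesis using PiE_arb[OF i] by simp
      qed
    qed
    show "\<forall>i\<in>?B. (\<lambda>j\<in>J. g ((\<lambda>j\<in>J. h (i j)) j)) = i"
    proof (intro ballI ext)
      fix i j assume "i \<in> ?B"
      then have i: "i \<in> J \<rightarrow>\<^sub>E ?L" by simp
      show "(\<lambda>j\<in>J. g ((\<lambda>j\<in>J. h (i j)) j)) j = i j"
      proof (cases "j \<in> J")
        case True
        then show ?thesis using h(2)[of "i j"] PiE_mem[OF i] by simp
      next
        case False
        then show ?thesis using PiE_arb[OF i] by simp
      qed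
    qed
    show "(\<lambda>i. \<lambda>j\<in>J. g (i j)) ` ?A \<subseteq> ?B"
    proof (rule image_subsetI)
      fix i assume i: "i \<in> ?A"
      have "(\<lambda>j\<in>J. g (i j)) \<in> J \<rightarrow>\<^sub>E ?L"
        using i gL PiE_mem[of i J "\<lambda>_. {1..N}"] by (intro restrict_PiE_iff[THEN iffD2] ballI) simp
      then show "(\<lambda>j\<in>J. g (i j)) \<in> ?B"
        using inj_g[OF i] by (simp add: inj_on_def)
    qed
    show "(\<lambda>i. \<lambda>j\<in>J. h (i j)) ` ?B \<subseteq> ?A"
    proof (rule image_subsetI)
      fix i assume i: "i \<in> ?B"
      have "(\<lambda>j\<in>J. h (i j)) \<in> J \<rightarrow>\<^sub>E {1..N}"
        using i h(1) PiE_mem[of i J "\<lambda>_. ?L"] by (intro restrict_PiE_iff[THEN iffD2] ballI) simp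
      then show "(\<lambda>j\<in>J. h (i j)) \<in> ?A"
        using inj_h[OF i] by (simp add: inj_on_def)
    qed
  qed
  have fstD: "fst p \<in> D" if "p \<in> ?L" for p
    using h[OF that] g(2) assms by metis
  have "factorial_measure D J (\<Sum>l=1..N. {#x l#}) =
      distr (distr (count_space ?A) (count_space ?B) (\<lambda>i. \<lambda>j\<in>J. g (i j))) (tuple_space D J)
        (\<lambda>i. \<lambda>j\<in>J. fst (i j))"
    unfolding factorial_measure_def by (subst distr_bij_count_space[OF bij]) simp
  also have "\<dots> = distr (count_space ?A) (tuple_space D J)
      ((\<lambda>i. \<lambda>j\<in>J. fst (i j)) \<circ> (\<lambda>i. \<lambda>j\<in>J. g (i j)))"
  proof (rule distr_distr)
    show "(\<lambda>i. \<lambda>j\<in>J. fst (i j)) \<in> count_space ?B \<rightarrow>\<^sub>M tuple_space D J"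
    proof -
      have "(\<lambda>j\<in>J. fst (i j)) \<in> J \<rightarrow>\<^sub>E D" if "i \<in> ?B" for i
        using that fstD PiE_mem[of i J "\<lambda>_. ?L"]
        by (intro restrict_PiE_iff[THEN iffD2] ballI) simp
      then show ?thesis
        by (auto simp: tuple_space_def space_PiM space_restrict_space)
    qed
    show "(\<lambda>i. \<lambda>j\<in>J. g (i j)) \<in> count_space ?A \<rightarrow>\<^sub>M count_space ?B"
      using bij by (auto simp: bij_betw_def)
  qed
  also have "\<dots> = distr (count_space ?A) (tuple_space D J) (\<lambda>i. \<lambda>j\<in>J. x (i j))"
    using g(2) by (intro distr_cong) (auto simp: PiE_mem intro!: restrict_ext)
  finally show ?thesis .
qed

definition expected_factorial_measure ::
    "'v measure \<Rightarrow> 'a::topological_space set \<Rightarrow> nat set \<Rightarrow> ('v \<Rightarrow> 'a multiset) \<Rightarrow> (nat \<Rightarrow> 'a) measure" where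
  "expected_factorial_measure Q D J H =
     measure_of (space (tuple_space D J)) (sets (tuple_space D J))
       (\<lambda>A. \<integral>\<^sup>+\<omega>. emeasure (factorial_measure D J (H \<omega>)) A \<partial>Q)"


section \<open>Independent absorbed particles\<close>

definition particles ::
    "(real^'d) set \<Rightarrow> (real \<Rightarrow> 'w \<Rightarrow> real^'d) \<Rightarrow> nat set \<Rightarrow> real \<Rightarrow> (nat \<Rightarrow> 'w) \<Rightarrow> (real^'d) multiset" where
  "particles D Y J t \<omega> = (\<Sum>j\<in>J. {#absorbed D Y t (\<omega> j)#})"

definition tensor_semigroup ::
    "(real^'d) set \<Rightarrow> (real^'d \<Rightarrow> 'w measure) \<Rightarrow> (real \<Rightarrow> 'w \<Rightarrow> real^'d) \<Rightarrow> nat set \<Rightarrow> real \<Rightarrow>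
     ((nat \<Rightarrow> real^'d) \<Rightarrow> real) \<Rightarrow> (nat \<Rightarrow> real^'d) \<Rightarrow> real" where
  "tensor_semigroup D P Y J t f x =
     (\<integral>\<omega>. f (\<lambda>j\<in>J. absorbed D Y t (\<omega> j)) \<partial>PiM J (\<lambda>j. P (x j)))"

text \<open>The duality \<open>\<integral>f d(S\<^sup>*\<nu>) = \<integral>S f d\<nu>\<close>, applied to indicators \<open>f\<close>.\<close>

definition dual_semigroup ::
    "(real^'d) set \<Rightarrow> (real^'d \<Rightarrow> 'w measure) \<Rightarrow> (real \<Rightarrow> 'w \<Rightarrow> real^'d) \<Rightarrow> nat set \<Rightarrow> real \<Rightarrow>
     (nat \<Rightarrow> real^'d) measure \<Rightarrow> (nat \<Rightarrow> real^'d) measure" where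
  "dual_semigroup D P Y J t \<nu> =
     measure_of (space (tuple_space (closure D) J)) (sets (tuple_space (closure D) J))
       (\<lambda>A. \<integral>\<^sup>+x. ennreal (tensor_semigroup D P Y J t (indicator A) x) \<partial>\<nu>)"

text \<open>The product of \<open>lam\<close> over the particles on the boundary is the exponential of the integral
  of \<open>log lam\<close>, with value \<open>0\<close> where \<open>lam\<close> vanishes.\<close>

definition absorbed_functional ::
    "(real^'d) set \<Rightarrow> (real^'d \<Rightarrow> 'w measure) \<Rightarrow> (real \<Rightarrow> 'w \<Rightarrow> real^'d) \<Rightarrow> (real^'d \<Rightarrow> real) \<Rightarrow>
     nat set \<Rightarrow> real \<Rightarrow> (nat \<Rightarrow> real^'d) \<Rightarrow> real" where
  "absorbed_functional D P Y lam I t z =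
     (\<integral>\<omega>. (\<Prod>y\<in>#filter_mset (\<lambda>y. y \<in> frontier D) (particles D Y I t \<omega>). lam y) *
        of_bool (num_points (frontier D) (particles D Y I t \<omega>) = card I)
      \<partial>PiM I (\<lambda>j. P (z j)))"


section \<open>The boundary driven diffusion gas\<close>

definition poisson_point_process ::
    "'v measure \<Rightarrow> 'a::topological_space measure \<Rightarrow> ('v \<Rightarrow> 'a multiset) \<Rightarrow> bool" where
  "poisson_point_process Q \<nu> \<Theta> \<longleftrightarrow>
     \<Theta> \<in> Q \<rightarrow>\<^sub>M config_space \<and>
     (\<forall>\<omega>\<in>space Q. set_mset (\<Theta> \<omega>) \<subseteq> space \<nu>) \<and>
     (\<forall>A\<in>sets \<nu>. \<forall>k. measure Q {\<omega>\<in>space Q. num_points A (\<Theta> \<omega>) = k} =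
        measure \<nu> A ^ k / fact k * exp (- measure \<nu> A)) \<and>
     (\<forall>m::nat. \<forall>A. (\<forall>i<m. A i \<in> sets \<nu>) \<and> disjoint_family_on A {..<m} \<longrightarrow>
        prob_space.indep_vars Q (\<lambda>_. count_space UNIV) (\<lambda>i \<omega>. num_points (A i) (\<Theta> \<omega>)) {..<m})"

text \<open>\<open>H\<close>, defined on an arbitrary probability space \<open>Q\<close>, is the gas started from
  \<open>\<Sum>i=1..N. {#x i#}\<close>: here \<open>\<xi>\<close> is any process with the law of the absorbed particle system.\<close>

definition boundary_driven_gas ::
    "(real^'d) set \<Rightarrow> (real^'d \<Rightarrow> 'w measure) \<Rightarrow> (real \<Rightarrow> 'w \<Rightarrow> real^'d) \<Rightarrow>
     (real^'d \<Rightarrow> real) \<Rightarrow> (real^'d) measure \<Rightarrow> nat \<Rightarrow> (nat \<Rightarrow> real^'d) \<Rightarrow>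
     'v measure \<Rightarrow> (real \<Rightarrow> 'v \<Rightarrow> (real^'d) multiset) \<Rightarrow> bool" where
  "boundary_driven_gas D P Y lam \<mu> N x Q H \<longleftrightarrow>
     prob_space Q \<and>
     (\<exists>\<xi> \<Theta>.
        (\<forall>t\<ge>0. \<xi> t \<in> Q \<rightarrow>\<^sub>M config_space) \<and>
        distr Q (PiM {0..} (\<lambda>_. config_space)) (\<lambda>\<omega>. \<lambda>t\<in>{0..}. \<xi> t \<omega>) =
          distr (PiM {1..N} (\<lambda>i. P (x i))) (PiM {0..} (\<lambda>_. config_space))
            (\<lambda>\<omega>. \<lambda>t\<in>{0..}. particles D Y {1..N} t \<omega>) \<and>
        (\<forall>t\<ge>0. poisson_point_process Q (reservoir_intensity D P Y lam \<mu> t) (\<Theta> t) \<and>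
           prob_space.indep_var Q config_space (\<xi> t) config_space (\<Theta> t) \<and>
           (\<forall>\<omega>\<in>space Q. H t \<omega> = filter_mset (\<lambda>y. y \<in> D) (\<xi> t \<omega>) + \<Theta> t \<omega>)))"

definition symmetric_transition_density ::
    "(real^'d) set \<Rightarrow> (real^'d \<Rightarrow> 'w measure) \<Rightarrow> (real \<Rightarrow> 'w \<Rightarrow> real^'d) \<Rightarrow>
     (real^'d) measure \<Rightarrow> (real \<Rightarrow> real^'d \<Rightarrow> real^'d \<Rightarrow> real) \<Rightarrow> bool" where
  "symmetric_transition_density D P Y m \<pp> \<longleftrightarrow>
     finite_measure m \<and> sets m = sets (restrict_space borel D) \<and>
     (\<forall>t>0. \<forall>x\<in>D. (\<forall>y\<in>D. 0 \<le> \<pp> t x y \<and> \<pp> t x y = \<pp> t y x) \<and>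
        \<pp> t x \<in> borel_measurable m \<and>
        restrict_space (transition_prob D P Y t x) D = density m (\<lambda>y. ennreal (\<pp> t x y)))"

end

theory Submission
  imports Defs
begin

text \<open>
  On a rectangle whose sides are taken from a finite disjoint family of blocks, the factorial measure
  of a configuration is a product of falling factorials of block counts; every rectangle is a finite
  disjoint union of such ones.  Hence factorial measures depend measurably on the configuration, and
  the factorial measures of a Poisson process have the powers of its intensity as expectations,
  because block counts are independent Poisson variables.  Splitting the indices
  of a tuple into the set \<open>I\<close> of those that carry a point of the Poisson part and the rest, which
  carry distinct surviving particles, shows that the expected factorial measure of the gas is a finite
  sum of product measures, indexed by \<open>I\<close> and by the injection \<open>i\<close> that assigns to each remaining
  index the initial point of its particle.  For symmetric \<open>f\<close> only the size of \<open>I\<close>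
  matters, which gives the binomial formula (a).  In (b) every factor has a density, and by the
  symmetry of the transition density particles may be run backwards: the absorbed functional
  factorises over \<open>I\<close> into the densities of the reservoir intensity.
\<close>

section \<open>Mixtures of measures\<close>

text \<open>The definition of a Poisson process supplies only Poisson counts and independence over
  disjoint sets, while a rectangle in D^n may have overlapping sides, whose counts are dependent.
  This is why rectangles are cut along the atoms of the algebra generated by their sides before any
  expectation is taken. Three further obstacles shape the proof. The gas lives on an arbitrary
  probability space and its particle part is known only in law, so quantities are expressed as
  measurable functions of a configuration before that law is replaced by the one of independent
  stopped diffusions. Configurations may have points outside \<open>D\<close>, hence measurability
  is proved for factorial measures on \<open>UNIV\<close> and carried back to \<open>D\<close>. The
  number of tuples in a configuration is unbounded, so integrability in (a) does not follow from
  boundedness of \<open>f\<close> alone; it comes from the finite total mass of the expected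
  factorial measure. Both this expectation and the finite sum over pairs \<open>(I, i)\<close>
  average measures over an index space, which is why both are written as a \<open>mixture\<close>
  and share one integration theorem.\<close>

definition mixture :: "'w measure \<Rightarrow> 'a measure \<Rightarrow> ('w \<Rightarrow> 'a measure) \<Rightarrow> 'a measure" where
  "mixture Q T K = measure_of (space T) (sets T) (\<lambda>A. \<integral>\<^sup>+\<omega>. emeasure (K \<omega>) A \<partial>Q)"

lemma sets_mixture [simp, measurable_cong]: "sets (mixture Q T K) = sets T"
  by (simp add: mixture_def)

lemma space_mixture [simp]: "space (mixture Q T K) = space T"
  by (simp add: mixture_def)

text \<open>\<open>measure_of\<close> yields the null measure whenever its set function is not
  countably additive, so the formula has to be earned: sum and integral are exchanged by monotone
  convergence, which is what measurability in \<open>\<omega>\<close> for each fixed set is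
  for.\<close>

lemma emeasure_mixture:
  assumes "\<And>\<omega>. \<omega> \<in> space Q \<Longrightarrow> sets (K \<omega>) = sets T"
    and "\<And>A. A \<in> sets T \<Longrightarrow> (\<lambda>\<omega>. emeasure (K \<omega>) A) \<in> borel_measurable Q"
    and "A \<in> sets T"
  shows "emeasure (mixture Q T K) A = (\<integral>\<^sup>+\<omega>. emeasure (K \<omega>) A \<partial>Q)"
proof (rule emeasure_measure_of[OF mixture_def])
  show "countably_additive (sets (mixture Q T K)) (\<lambda>A. \<integral>\<^sup>+\<omega>. emeasure (K \<omega>) A \<partial>Q)"
  proof (rule countably_additiveI)
    fix F :: "nat \<Rightarrow> _" assume F: "range F \<subseteq> sets (mixture Q T K)" "disjoint_family F"
    then have F': "\<And>i. F i \<in> sets T" by auto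
    have "(\<Sum>i. \<integral>\<^sup>+\<omega>. emeasure (K \<omega>) (F i) \<partial>Q) = (\<integral>\<^sup>+\<omega>. (\<Sum>i. emeasure (K \<omega>) (F i)) \<partial>Q)"
      using assms(2)[OF F'] by (rule nn_integral_suminf[symmetric])
    also have "\<dots> = (\<integral>\<^sup>+\<omega>. emeasure (K \<omega>) (\<Union>i. F i) \<partial>Q)"
      using F F' assms(1) by (intro nn_integral_cong suminf_emeasure) auto
    finally show "(\<Sum>i. \<integral>\<^sup>+\<omega>. emeasure (K \<omega>) (F i) \<partial>Q) = (\<integral>\<^sup>+\<omega>. emeasure (K \<omega>) (\<Union>i. F i) \<partial>Q)" .
  qed
qed (use assms(3) sets.space_closed in \<open>auto simp: positive_def\<close>)

text \<open>Measurability of the inner integral and the integral formula go through one induction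
  over nonnegative functions, because each exchange in the second claim needs the first claim for
  the simpler function.\<close>

lemma
  assumes K: "\<And>\<omega>. \<omega> \<in> space Q \<Longrightarrow> sets (K \<omega>) = sets T"
    and meas: "\<And>A. A \<in> sets T \<Longrightarrow> (\<lambda>\<omega>. emeasure (K \<omega>) A) \<in> borel_measurable Q"
    and f: "f \<in> borel_measurable T"
  shows measurable_nn_integral_mixture: "(\<lambda>\<omega>. \<integral>\<^sup>+z. f z \<partial>K \<omega>) \<in> borel_measurable Q"
    and nn_integral_mixture: "(\<integral>\<^sup>+z. f z \<partial>mixture Q T K) = (\<integral>\<^sup>+\<omega>. \<integral>\<^sup>+z. f z \<partial>K \<omega> \<partial>Q)"
proof -
  have sp: "space (K \<omega>) = space T" if "\<omega> \<in> space Q" for \<omega>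
    using K[OF that] by (rule sets_eq_imp_space_eq)
  have mf: "g \<in> borel_measurable (K \<omega>)" if "g \<in> borel_measurable T" "\<omega> \<in> space Q"
    for \<omega> and g :: "_ \<Rightarrow> ennreal"
    using that(1) by (subst measurable_cong_sets[OF K[OF that(2)] refl])
  have "(\<lambda>\<omega>. \<integral>\<^sup>+z. f z \<partial>K \<omega>) \<in> borel_measurable Q \<and>
      (\<integral>\<^sup>+z. f z \<partial>mixture Q T K) = (\<integral>\<^sup>+\<omega>. \<integral>\<^sup>+z. f z \<partial>K \<omega> \<partial>Q)"
    using f
  proof (induction rule: borel_measurable_induct)
    case (cong f g)
    have 1: "(\<integral>\<^sup>+z. f z \<partial>K \<omega>) = (\<integral>\<^sup>+z. g z \<partial>K \<omega>)" if "\<omega> \<in> space Q" for \<omega>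
      using cong(3) sp[OF that] by (intro nn_integral_cong) simp
    have 2: "(\<integral>\<^sup>+z. f z \<partial>mixture Q T K) = (\<integral>\<^sup>+z. g z \<partial>mixture Q T K)"
      using cong(3) by (intro nn_integral_cong) simp
    show ?case
      using cong(4) by (simp add: 1 2 cong: measurable_cong nn_integral_cong)
  next
    case (set A)
    have 1: "(\<integral>\<^sup>+z. indicator A z \<partial>K \<omega>) = emeasure (K \<omega>) A" if "\<omega> \<in> space Q" for \<omega>
      using set K[OF that] by simp
    show ?case
      using meas[OF set] set by (simp add: 1 emeasure_mixture[OF K meas] cong: measurable_cong nn_integral_cong)
  next
    case (mult u c)
    have 1: "(\<integral>\<^sup>+z. c * u z \<partial>K \<omega>) = c * (\<integral>\<^sup>+z. u z \<partial>K \<omega>)" if "\<omega> \<in> space Q" for \<omega>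
      using mf[OF mult(2) that] by (rule nn_integral_cmult)
    show ?case
      using mult borel_measurable_times_ennreal[of "\<lambda>_. c" Q "\<lambda>\<omega>. integral\<^sup>N (K \<omega>) u"]
      by (simp add: 1 nn_integral_cmult cong: measurable_cong nn_integral_cong)
  next
    case (add u v)
    have 1: "(\<integral>\<^sup>+z. v z + u z \<partial>K \<omega>) = (\<integral>\<^sup>+z. v z \<partial>K \<omega>) + (\<integral>\<^sup>+z. u z \<partial>K \<omega>)" if "\<omega> \<in> space Q" for \<omega>
      using mf[OF add(1) that] mf[OF add(3) that] by (simp add: nn_integral_add)
    show ?case
      using add borel_measurable_add[of "\<lambda>\<omega>. integral\<^sup>N (K \<omega>) v" Q "\<lambda>\<omega>. integral\<^sup>N (K \<omega>) u"]
      by (simp add: 1 nn_integral_add cong: measurable_cong nn_integral_cong)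
  next
    \<comment> \<open>Monotone convergence acts three times: inside each \<open>K \<omega>\<close>,
      inside the mixture, and over \<open>Q\<close>.\<close>
    case (seq U)
    have 1: "(\<integral>\<^sup>+z. (SUP i. U i) z \<partial>K \<omega>) = (SUP i. \<integral>\<^sup>+z. U i z \<partial>K \<omega>)" if "\<omega> \<in> space Q" for \<omega>
      using mf[OF seq(1) that] nn_integral_monotone_convergence_SUP[OF seq(3)] by (simp add: image_comp)
    have 2: "(\<integral>\<^sup>+z. (SUP i. U i) z \<partial>mixture Q T K) = (SUP i. \<integral>\<^sup>+z. U i z \<partial>mixture Q T K)"
      using seq(1) nn_integral_monotone_convergence_SUP[OF seq(3)] by (simp add: image_comp)
    have 3: "incseq (\<lambda>i \<omega>. \<integral>\<^sup>+z. U i z \<partial>K \<omega>)"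
      using seq(3) by (auto simp: incseq_def le_fun_def intro!: nn_integral_mono)
    have IH: "(\<lambda>\<omega>. \<integral>\<^sup>+z. U i z \<partial>K \<omega>) \<in> borel_measurable Q"
        "(\<integral>\<^sup>+z. U i z \<partial>mixture Q T K) = (\<integral>\<^sup>+\<omega>. \<integral>\<^sup>+z. U i z \<partial>K \<omega> \<partial>Q)" for i
      using seq.IH by auto
    have "(\<lambda>\<omega>. SUP i. \<integral>\<^sup>+z. U i z \<partial>K \<omega>) \<in> borel_measurable Q"
      using IH(1) by (intro borel_measurable_SUP) auto
    then have m: "(\<lambda>\<omega>. \<integral>\<^sup>+z. (SUP i. U i) z \<partial>K \<omega>) \<in> borel_measurable Q"
      by (subst measurable_cong[OF 1])
    have "(\<integral>\<^sup>+\<omega>. \<integral>\<^sup>+z. (SUP i. U i) z \<partial>K \<omega> \<partial>Q) = (\<integral>\<^sup>+\<omega>. (SUP i. \<integral>\<^sup>+z. U i z \<partial>K \<omega>) \<partial>Q)"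
      by (rule nn_integral_cong[OF 1])
    also have "\<dots> = (SUP i. \<integral>\<^sup>+\<omega>. \<integral>\<^sup>+z. U i z \<partial>K \<omega> \<partial>Q)"
      using IH(1) by (rule nn_integral_monotone_convergence_SUP[OF 3])
    also have "\<dots> = (\<integral>\<^sup>+z. (SUP i. U i) z \<partial>mixture Q T K)"
      unfolding 2 IH(2) ..
    finally show ?case using m by (rule conjI[rotated, OF sym])
  qed
  then show "(\<lambda>\<omega>. \<integral>\<^sup>+z. f z \<partial>K \<omega>) \<in> borel_measurable Q"
      "(\<integral>\<^sup>+z. f z \<partial>mixture Q T K) = (\<integral>\<^sup>+\<omega>. \<integral>\<^sup>+z. f z \<partial>K \<omega> \<partial>Q)"
    by auto
qed

text \<open>A bound on \<open>f\<close> does not bound its integral against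
  \<open>K \<omega>\<close>, whose mass may grow with \<open>\<omega>\<close>; finiteness of the
  mixture controls the average instead. A signed \<open>f\<close> is split into its bounded positive
  and negative parts, so no infinities are subtracted.\<close>

lemma
  fixes f :: "'a \<Rightarrow> real"
  assumes K: "\<And>\<omega>. \<omega> \<in> space Q \<Longrightarrow> sets (K \<omega>) = sets T"
    and meas: "\<And>A. A \<in> sets T \<Longrightarrow> (\<lambda>\<omega>. emeasure (K \<omega>) A) \<in> borel_measurable Q"
    and fin: "\<And>\<omega>. \<omega> \<in> space Q \<Longrightarrow> finite_measure (K \<omega>)" "finite_measure (mixture Q T K)"
    and f: "f \<in> borel_measurable T" "\<And>z. z \<in> space T \<Longrightarrow> \<bar>f z\<bar> \<le> C"
  shows integrable_mixture: "integrable Q (\<lambda>\<omega>. \<integral>z. f z \<partial>K \<omega>)"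
    and integral_mixture: "(\<integral>z. f z \<partial>mixture Q T K) = (\<integral>\<omega>. \<integral>z. f z \<partial>K \<omega> \<partial>Q)"
proof -
  have sp: "space (K \<omega>) = space T" if "\<omega> \<in> space Q" for \<omega>
    using K[OF that] by (rule sets_eq_imp_space_eq)
  have mf: "g \<in> borel_measurable (K \<omega>)" if "g \<in> borel_measurable T" "\<omega> \<in> space Q"
    for \<omega> and g :: "_ \<Rightarrow> real"
    using that(1) by (subst measurable_cong_sets[OF K[OF that(2)] refl])
  have intK: "integrable (K \<omega>) g" if "g \<in> borel_measurable T" "\<And>z. z \<in> space T \<Longrightarrow> \<bar>g z\<bar> \<le> B" "\<omega> \<in> space Q"
    for \<omega> and g :: "_ \<Rightarrow> real" and B
    using fin(1)[OF that(3)] mf[OF that(1,3)] that(2) sp[OF that(3)]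
    by (intro finite_measure.integrable_const_bound[where B = B]) auto
  have intM: "integrable (mixture Q T K) g" if "g \<in> borel_measurable T" "\<And>z. z \<in> space T \<Longrightarrow> \<bar>g z\<bar> \<le> B"
    for g :: "_ \<Rightarrow> real" and B
    using that by (intro finite_measure.integrable_const_bound[OF fin(2), where B = B]) auto
  have nonneg: "integrable Q (\<lambda>\<omega>. \<integral>z. g z \<partial>K \<omega>) \<and> (\<integral>z. g z \<partial>mixture Q T K) = (\<integral>\<omega>. \<integral>z. g z \<partial>K \<omega> \<partial>Q)"
    if g: "g \<in> borel_measurable T" "\<And>z. z \<in> space T \<Longrightarrow> \<bar>g z\<bar> \<le> B" "\<And>z. z \<in> space T \<Longrightarrow> 0 \<le> g z"
    for g :: "_ \<Rightarrow> real" and B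
  proof -
    have 1: "ennreal (\<integral>z. g z \<partial>K \<omega>) = (\<integral>\<^sup>+z. g z \<partial>K \<omega>)" if "\<omega> \<in> space Q" for \<omega>
      using intK[OF g(1,2) that] g(3) sp[OF that] by (subst nn_integral_eq_integral) auto
    have 2: "ennreal (\<integral>z. g z \<partial>mixture Q T K) = (\<integral>\<^sup>+z. g z \<partial>mixture Q T K)"
      using intM[OF g(1,2)] g(3) by (subst nn_integral_eq_integral) auto
    have g': "(\<lambda>z. ennreal (g z)) \<in> borel_measurable T" using g(1) by simp
    have nn: "0 \<le> (\<integral>z. g z \<partial>K \<omega>)" if "\<omega> \<in> space Q" for \<omega>
      using g(3) sp[OF that] by (intro integral_nonneg_AE) auto
    have eq: "(\<integral>\<^sup>+\<omega>. ennreal (\<integral>z. g z \<partial>K \<omega>) \<partial>Q) = ennreal (\<integral>z. g z \<partial>mixture Q T K)"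
      using nn_integral_mixture[OF K meas g'] by (simp add: 1 2 cong: nn_integral_cong)
    \<comment> \<open>The Bochner integral inherits measurability from the extended one through
      \<open>enn2real\<close>, since the two agree when finite.\<close>
    have m: "(\<lambda>\<omega>. \<integral>z. g z \<partial>K \<omega>) \<in> borel_measurable Q"
    proof -
      have "(\<lambda>\<omega>. enn2real (\<integral>\<^sup>+z. g z \<partial>K \<omega>)) \<in> borel_measurable Q"
        using measurable_nn_integral_mixture[OF K meas g'] by simp
      moreover have "enn2real (\<integral>\<^sup>+z. g z \<partial>K \<omega>) = (\<integral>z. g z \<partial>K \<omega>)" if "\<omega> \<in> space Q" for \<omega>
        using nn[OF that] by (simp flip: 1[OF that])
      ultimately show ?thesis by (simp cong: measurable_cong)
    qed
    have "has_bochner_integral Q (\<lambda>\<omega>. \<integral>z. g z \<partial>K \<omega>) (\<integral>z. g z \<partial>mixture Q T K)"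
      using m nn g(3) by (intro has_bochner_integral_nn_integral eq integral_nonneg_AE) auto
    then show ?thesis by (auto simp: has_bochner_integral_iff)
  qed
  let ?p = "\<lambda>z. max 0 (f z)" and ?n = "\<lambda>z. max 0 (- f z)"
  have p: "?p \<in> borel_measurable T" "\<And>z. z \<in> space T \<Longrightarrow> \<bar>?p z\<bar> \<le> C"
    and n: "?n \<in> borel_measurable T" "\<And>z. z \<in> space T \<Longrightarrow> \<bar>?n z\<bar> \<le> C"
    using f by force+
  have split: "f = (\<lambda>z. ?p z - ?n z)" by auto
  have K_split: "(\<integral>z. f z \<partial>K \<omega>) = (\<integral>z. ?p z \<partial>K \<omega>) - (\<integral>z. ?n z \<partial>K \<omega>)" if "\<omega> \<in> space Q" for \<omega>
    by (subst split) (rule Bochner_Integration.integral_diff[OF intK[OF p that] intK[OF n that]])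
  have M_split: "(\<integral>z. f z \<partial>mixture Q T K) = (\<integral>z. ?p z \<partial>mixture Q T K) - (\<integral>z. ?n z \<partial>mixture Q T K)"
    by (subst split) (rule Bochner_Integration.integral_diff[OF intM[OF p] intM[OF n]])
  show "integrable Q (\<lambda>\<omega>. \<integral>z. f z \<partial>K \<omega>)"
    using nonneg[OF p] nonneg[OF n] by (subst Bochner_Integration.integrable_cong[OF refl K_split]) auto
  show "(\<integral>z. f z \<partial>mixture Q T K) = (\<integral>\<omega>. \<integral>z. f z \<partial>K \<omega> \<partial>Q)"
    using nonneg[OF p] nonneg[OF n]
    by (subst Bochner_Integration.integral_cong[OF refl K_split]) (auto simp: M_split)
qed

section \<open>Product measures on tuples\<close>

text \<open>The rectangles with blocks from a disjoint family are not stable under intersection, so they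
  are no generator to which the usual uniqueness and measurability rules apply.\<close>

lemma Pi\<^sub>E_disjoint_blocks_induct [consumes 2, case_names block empty compl union]:
  assumes "finite J" and A: "A \<in> sets (PiM J (\<lambda>_. K))"
    and block: "\<And>m B s. (\<And>b. b < m \<Longrightarrow> B b \<in> sets K) \<Longrightarrow> disjoint_family_on B {..<m} \<Longrightarrow>
        s \<in> J \<rightarrow> {..<m::nat} \<Longrightarrow> Pr (\<Pi>\<^sub>E j\<in>J. B (s j))"
    and empty: "Pr {}"
    and compl: "\<And>A. A \<in> sets (PiM J (\<lambda>_. K)) \<Longrightarrow> Pr A \<Longrightarrow> Pr (space (PiM J (\<lambda>_. K)) - A)"
    and union: "\<And>A::nat \<Rightarrow> _. disjoint_family A \<Longrightarrow> range A \<subseteq> sets (PiM J (\<lambda>_. K)) \<Longrightarrow>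
        (\<And>i. Pr (A i)) \<Longrightarrow> Pr (\<Union>i. A i)"
  shows "Pr A"
proof -
  have rect: "Pr (Pi\<^sub>E J E)" if E: "\<And>j. j \<in> J \<Longrightarrow> E j \<in> sets K" for E
  proof -
    obtain g where g: "bij_betw g {..<card (Pow J)} (Pow J)"
      using ex_bij_betw_nat_finite[of "Pow J"] \<open>finite J\<close> by (auto simp: atLeast0LessThan)
    \<comment> \<open>The blocks are the atoms of the algebra generated by the sides: the subset
      \<open>g b\<close> of \<open>J\<close> records which sides the points of \<open>B b\<close>
      belong to, so distinct subsets give disjoint atoms. \<open>S\<close> lists the ways to choose,
      for each \<open>j\<close>, an atom inside \<open>E j\<close>.\<close>
    define m where "m = card (Pow J)"
    define B where "B b = {z \<in> space K. \<forall>j\<in>J. j \<in> g b \<longleftrightarrow> z \<in> E j}" for b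
    define S where "S = (\<Pi>\<^sub>E j\<in>J. {b\<in>{..<m}. j \<in> g b})"
    have "{z \<in> space K. j \<in> g b \<longleftrightarrow> z \<in> E j} \<in> sets K" if "j \<in> J" for j b
    proof -
      have "{z \<in> space K. j \<in> g b \<longleftrightarrow> z \<in> E j} = (if j \<in> g b then space K \<inter> E j else space K - E j)"
        by auto
      then show ?thesis using E[OF that] by simp
    qed
    then have B: "B b \<in> sets K" for b
      unfolding B_def using \<open>finite J\<close> by (rule sets.sets_Collect_finite_All)
    have disj: "disjoint_family_on B {..<m}"
    unfolding disjoint_family_on_def
    proof (intro ballI impI)
      fix b c assume bc: "b \<in> {..<m}" "c \<in> {..<m}" "b \<noteq> c"
      then have "g b \<noteq> g c" "g b \<subseteq> J" "g c \<subseteq> J" using g by (auto simp: m_def bij_betw_def inj_on_def)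
      then obtain j where "j \<in> J" "(j \<in> g b) \<noteq> (j \<in> g c)" by blast
      then show "B b \<inter> B c = {}" by (auto simp: B_def)
    qed
    have in_B: "\<exists>b<m. z \<in> B b \<and> g b = {j\<in>J. z \<in> E j}" if "z \<in> space K" for z
    proof -
      have "{j\<in>J. z \<in> E j} \<in> g ` {..<m}" using g by (auto simp: bij_betw_def m_def)
      then show ?thesis using that by (auto simp: B_def image_iff)
    qed
    have fin_S: "finite S" using \<open>finite J\<close> by (auto simp: S_def intro!: finite_PiE)
    then obtain h where h: "bij_betw h {..<card S} S"
      using ex_bij_betw_nat_finite[of S] by (auto simp: atLeast0LessThan)
    define F where "F k = (if k < card S then (\<Pi>\<^sub>E j\<in>J. B (h k j)) else {})" for k
    have hS: "h k \<in> J \<rightarrow> {..<m}" if "k < card S" for k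
    proof -
      have "h k \<in> S" using h that by (metis bij_betwE lessThan_iff)
      then show ?thesis unfolding S_def by (auto simp: PiE_iff)
    qed
    have "Pi\<^sub>E J E = (\<Union>k. F k)"
    proof (intro equalityI subsetI)
      fix z assume z: "z \<in> Pi\<^sub>E J E"
      have "\<exists>b. b < m \<and> z j \<in> B b \<and> j \<in> g b" if "j \<in> J" for j
        using in_B[of "z j"] that z E[OF that] sets.sets_into_space by (auto simp: PiE_iff) blast
      then obtain b where b: "\<And>j. j \<in> J \<Longrightarrow> b j < m \<and> z j \<in> B (b j) \<and> j \<in> g (b j)" by metis
      have "restrict b J \<in> S" using b by (auto simp: S_def)
      then have "restrict b J \<in> h ` {..<card S}" using h by (simp add: bij_betw_def)
      then obtain k where "k < card S" "h k = restrict b J" by (metis imageE lessThan_iff)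
      then have "z \<in> F k" using b z by (auto simp: F_def PiE_iff)
      then show "z \<in> (\<Union>k. F k)" by blast
    next
      fix z assume "z \<in> (\<Union>k. F k)"
      then obtain k where k: "k < card S" "z \<in> (\<Pi>\<^sub>E j\<in>J. B (h k j))" by (auto simp: F_def split: if_splits)
      then have "h k \<in> S" using h by (auto simp: bij_betw_def)
      then show "z \<in> Pi\<^sub>E J E" using k by (auto simp: S_def B_def PiE_iff)
    qed
    moreover have "disjoint_family F"
    unfolding disjoint_family_on_def
    proof (intro ballI impI)
      fix k l :: nat assume kl: "k \<noteq> l"
      show "F k \<inter> F l = {}"
      proof (rule ccontr)
        assume "F k \<inter> F l \<noteq> {}"
        then obtain z where z: "z \<in> F k" "z \<in> F l" by blast
        then have k: "k < card S" "l < card S" by (auto simp: F_def split: if_splits)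
        then have "h k \<in> S" "h l \<in> S" "h k \<noteq> h l" using h kl by (auto simp: bij_betw_def inj_on_def)
        then obtain j where j: "j \<in> J" "h k j \<noteq> h l j"
          using PiE_ext[of "h k" J "\<lambda>j. {b\<in>{..<m}. j \<in> g b}" "h l"] unfolding S_def by blast
        have "z j \<in> B (h k j)" "z j \<in> B (h l j)" using z k j by (auto simp: F_def)
        moreover have "B (h k j) \<inter> B (h l j) = {}"
          using disj j hS[OF k(1)] hS[OF k(2)] by (intro disjoint_family_onD) auto
        ultimately show False by blast
      qed
    qed
    moreover have "Pr (F k)" for k
    proof (cases "k < card S")
      case True
      then show ?thesis using block[of m B "h k"] B disj hS by (simp add: F_def)
    qed (simp add: F_def empty)
    moreover have "range F \<subseteq> sets (PiM J (\<lambda>_. K))"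
      using B \<open>finite J\<close> by (auto simp: F_def intro!: sets_PiM_I_finite)
    ultimately show ?thesis using union by metis
  qed
  have sets: "sets (PiM J (\<lambda>_. K)) = sigma_sets (space (PiM J (\<lambda>_. K))) (prod_algebra J (\<lambda>_. K))"
    by (simp add: sets_PiM space_PiM)
  have "A \<in> sigma_sets (space (PiM J (\<lambda>_. K))) (prod_algebra J (\<lambda>_. K))"
    using A sets by simp
  \<comment> \<open>Arbitrary rectangles, unlike those with sides from a common disjoint family,
    form an intersection-stable generator, so a Dynkin argument can start from
    \<open>rect\<close>.\<close>
  then show ?thesis
  proof (rule sigma_sets_induct_disjoint[OF Int_stable_prod_algebra, rotated 1])
    show "prod_algebra J (\<lambda>_. K) \<subseteq> Pow (space (PiM J (\<lambda>_. K)))"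
      using prod_algebra_sets_into_space[of J "\<lambda>_. K"] by (simp add: space_PiM)
    show "Pr A" if A: "A \<in> prod_algebra J (\<lambda>_. K)" for A
    proof -
      obtain X where X: "A = Pi\<^sub>E J X" "X \<in> J \<rightarrow> sets K"
        using A unfolding prod_algebra_eq_finite[OF \<open>finite J\<close>] by blast
      have "X j \<in> sets K" if "j \<in> J" for j using X(2) that by (simp add: Pi_iff)
      then show ?thesis unfolding X(1) by (rule rect)
    qed
    show "Pr (space (PiM J (\<lambda>_. K)) - A)"
      if "A \<in> sigma_sets (space (PiM J (\<lambda>_. K))) (prod_algebra J (\<lambda>_. K))" "Pr A" for A
      using that(1) by (intro compl that(2)) (simp only: sets)
    show "Pr (\<Union>i. A i)" if "disjoint_family A"
      "range A \<subseteq> sigma_sets (space (PiM J (\<lambda>_. K))) (prod_algebra J (\<lambda>_. K))" "\<And>i. Pr (A i)"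
      for A :: "nat \<Rightarrow> _"
      using that(2) by (intro union that(1,3)) (simp only: sets)
  qed (rule empty)
qed

section \<open>Tuple spaces over a domain and over a larger set\<close>

lemma space_tuple_space [simp]: "space (tuple_space S J) = J \<rightarrow>\<^sub>E S"
  by (simp add: tuple_space_def space_PiM space_restrict_space)

lemma tuple_space_UNIV: "tuple_space UNIV J = PiM J (\<lambda>_. borel)"
proof -
  have "restrict_space borel (UNIV :: 'a set) = borel"
    by (rule measure_eqI) (auto simp: sets_restrict_space emeasure_restrict_space)
  then show ?thesis by (simp add: tuple_space_def)
qed

lemma sets_PiM_restrict_borel:
  assumes "\<And>j. j \<in> J \<Longrightarrow> sets (M j) = sets (restrict_space borel S)"
  shows "sets (PiM J M) = sets (tuple_space S J)"
  unfolding tuple_space_def using assms by (intro sets_PiM_cong) auto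

lemma measurable_id_tuple_space:
  assumes "D \<subseteq> C"
  shows "(\<lambda>z. z) \<in> tuple_space D J \<rightarrow>\<^sub>M tuple_space C J"
  unfolding tuple_space_def
proof (rule measurable_PiM_single')
  fix j assume "j \<in> J"
  then have "(\<lambda>z. z j) \<in> PiM J (\<lambda>_. restrict_space borel D) \<rightarrow>\<^sub>M restrict_space borel D"
    by (rule measurable_component_singleton)
  then show "(\<lambda>z. z j) \<in> PiM J (\<lambda>_. restrict_space borel D) \<rightarrow>\<^sub>M restrict_space borel C"
    using assms by (auto simp: measurable_restrict_space2_iff)
qed (use assms in \<open>auto simp: space_PiM space_restrict_space PiE_iff\<close>)

text \<open>The identity is measurable in both directions, and the preimage under it of a set of
  tuples in \<open>D\<close> is the set itself. One sigma-algebra arises from restricting measures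
  on tuples in the closure, the other carries the factorial measures.\<close>

lemma sets_restrict_space_tuple_space:
  assumes "D \<subseteq> C"
  shows "sets (restrict_space (tuple_space C J) (J \<rightarrow>\<^sub>E D)) = sets (tuple_space D J)"
proof -
  have DC: "(J \<rightarrow>\<^sub>E D) \<subseteq> (J \<rightarrow>\<^sub>E C)" using assms by (rule PiE_mono)
  have 1: "(\<lambda>z. z) \<in> tuple_space D J \<rightarrow>\<^sub>M restrict_space (tuple_space C J) (J \<rightarrow>\<^sub>E D)"
    by (rule measurable_restrict_space2[OF _ measurable_id_tuple_space[OF assms]]) simp
  have 2: "(\<lambda>z. z) \<in> restrict_space (tuple_space C J) (J \<rightarrow>\<^sub>E D) \<rightarrow>\<^sub>M tuple_space D J"
    unfolding tuple_space_def[of D]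
  proof (rule measurable_PiM_single')
    fix j assume j: "j \<in> J"
    have "(\<lambda>z. z j) \<in> tuple_space C J \<rightarrow>\<^sub>M borel"
      using measurable_component_singleton[OF j, of "\<lambda>_. restrict_space borel C"]
      by (simp add: tuple_space_def measurable_restrict_space2_iff)
    then show "(\<lambda>z. z j) \<in> restrict_space (tuple_space C J) (J \<rightarrow>\<^sub>E D) \<rightarrow>\<^sub>M restrict_space borel D"
      using j by (intro measurable_restrict_space2 measurable_restrict_space1)
        (auto simp: space_restrict_space)
  qed (auto simp: space_restrict_space)
  have sp: "space (restrict_space (tuple_space C J) (J \<rightarrow>\<^sub>E D)) = J \<rightarrow>\<^sub>E D"
    using DC by (auto simp: space_restrict_space)
  show ?thesis
  proof (intro equalityI subsetI)
    fix A assume A: "A \<in> sets (restrict_space (tuple_space C J) (J \<rightarrow>\<^sub>E D))"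
    then have "A \<subseteq> J \<rightarrow>\<^sub>E D" using sets.sets_into_space sp by blast
    then show "A \<in> sets (tuple_space D J)" using measurable_sets[OF 1 A] by (simp add: Int_absorb2)
  next
    fix A assume A: "A \<in> sets (tuple_space D J)"
    then have "A \<subseteq> J \<rightarrow>\<^sub>E D" using sets.sets_into_space by fastforce
    then show "A \<in> sets (restrict_space (tuple_space C J) (J \<rightarrow>\<^sub>E D))"
      using measurable_sets[OF 2 A] sp by (simp add: Int_absorb2)
  qed
qed

lemma PiE_in_sets_tuple_space:
  assumes "finite J" "\<And>j. j \<in> J \<Longrightarrow> A j \<in> sets borel" "\<And>j. j \<in> J \<Longrightarrow> A j \<subseteq> S"
  shows "Pi\<^sub>E J A \<in> sets (tuple_space S J)"
  unfolding tuple_space_def using assms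
  by (intro sets_PiM_I_finite) (auto simp: sets_restrict_space intro!: image_eqI[where x = "A _"])

text \<open>Lets the same set be measured by a factorial measure on \<open>D\<close> and by one on a
  larger domain; since \<open>D\<close> is Borel, the tuples in \<open>D\<close> form a measurable
  subset of the larger tuple space.\<close>

lemma sets_tuple_space_mono:
  assumes "finite J" "D \<in> sets borel" "D \<subseteq> C" and A: "A \<in> sets (tuple_space D J)"
  shows "A \<in> sets (tuple_space C J)"
proof -
  have "(J \<rightarrow>\<^sub>E D) \<in> sets (tuple_space C J)"
    using assms by (intro PiE_in_sets_tuple_space) auto
  then show ?thesis
    using A sets_restrict_space_iff[of "J \<rightarrow>\<^sub>E D" "tuple_space C J" A] sets.sets_into_space[of "J \<rightarrow>\<^sub>E D" "tuple_space C J"]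
    by (simp add: sets_restrict_space_tuple_space[OF \<open>D \<subseteq> C\<close>] Int_absorb2)
qed

section \<open>Relabelling, densities and kernels for finite products\<close>

lemma finite_measure_PiM:
  assumes "finite J" "\<And>j. finite_measure (M j)"
  shows "finite_measure (PiM J M)"
proof -
  interpret product_sigma_finite M
    using assms by (simp add: product_sigma_finite_def finite_measure.sigma_finite_measure)
  show ?thesis
    using assms(1) emeasure_PiM[of J "\<lambda>j. space (M j)"] finite_measure.emeasure_finite[OF assms(2)]
    by (intro finite_measureI) (simp add: space_PiM ennreal_prod_eq_top)
qed

text \<open>Compared on rectangles: the preimage of a rectangle under the relabelling has side
  \<open>A (inv \<pi> j)\<close> at \<open>j\<close>, and the product of the side masses does not
  depend on the order of its factors.\<close>

lemma distr_PiM_permutes: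
  assumes "finite J" "\<pi> permutes J" "\<And>j. sigma_finite_measure (M j)"
  shows "distr (PiM J M) (PiM J (\<lambda>j. M (\<pi> j))) (\<lambda>z. z \<circ> \<pi>) = PiM J (\<lambda>j. M (\<pi> j))"
proof -
  interpret M: product_sigma_finite M using assms by (simp add: product_sigma_finite_def)
  interpret M': product_sigma_finite "\<lambda>j. M (\<pi> j)" using assms by (simp add: product_sigma_finite_def)
  have \<pi>: "\<pi> j \<in> J \<longleftrightarrow> j \<in> J" "j \<notin> J \<Longrightarrow> \<pi> j = j" for j
    using assms(2) by (auto simp: permutes_in_image permutes_not_in)
  have meas: "(\<lambda>z. z \<circ> \<pi>) \<in> PiM J M \<rightarrow>\<^sub>M PiM J (\<lambda>j. M (\<pi> j))"
    by (rule measurable_PiM_single') (auto simp: \<pi> space_PiM PiE_iff extensional_def)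
  show ?thesis
  proof (rule M'.PiM_eqI)
    fix A assume A: "\<And>j. j \<in> J \<Longrightarrow> A j \<in> sets (M (\<pi> j))"
    have inv: "inv \<pi> j \<in> J" "\<pi> (inv \<pi> j) = j" if "j \<in> J" for j
      using assms(2) that by (auto simp: permutes_inverses permutes_in_image[OF permutes_inv])
    have A': "A (inv \<pi> j) \<in> sets (M j)" if "j \<in> J" for j
      using A[OF inv(1)[OF that]] inv(2)[OF that] by simp
    have "(\<lambda>z. z \<circ> \<pi>) -` Pi\<^sub>E J A \<inter> space (PiM J M) = Pi\<^sub>E J (\<lambda>j. A (inv \<pi> j))" (is "?L = ?R")
    proof (intro equalityI subsetI)
      fix z assume z: "z \<in> ?L"
      have "z j \<in> A (inv \<pi> j)" if "j \<in> J" for j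
        using z inv[OF that] by (auto simp: PiE_iff dest!: bspec[where x = "inv \<pi> j"])
      then show "z \<in> ?R" using z by (auto simp: space_PiM PiE_iff)
    next
      fix z assume z: "z \<in> ?R"
      then have "z (\<pi> j) \<in> A j" if "j \<in> J" for j
        using that assms(2) by (auto simp: PiE_iff \<pi> permutes_inverses dest!: bspec[where x = "\<pi> j"])
      moreover have "z j \<in> space (M j)" if "j \<in> J" for j
        using z that A'[OF that] sets.sets_into_space by (auto simp: PiE_iff)
      ultimately show "z \<in> ?L" using z by (auto simp: space_PiM PiE_iff extensional_def \<pi>)
    qed
    then have "emeasure (distr (PiM J M) (PiM J (\<lambda>j. M (\<pi> j))) (\<lambda>z. z \<circ> \<pi>)) (Pi\<^sub>E J A) =
        (\<Prod>j\<in>J. emeasure (M j) (A (inv \<pi> j)))"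
      using assms A A' meas by (subst emeasure_distr) (auto intro!: sets_PiM_I_finite M.emeasure_PiM)
    also have "\<dots> = (\<Prod>j\<in>J. emeasure (M (\<pi> j)) (A j))"
      using assms(2) by (subst prod.permute[OF assms(2)]) (simp add: permutes_inverses comp_def)
    finally show "emeasure (distr (PiM J M) (PiM J (\<lambda>j. M (\<pi> j))) (\<lambda>z. z \<circ> \<pi>)) (Pi\<^sub>E J A) =
        (\<Prod>j\<in>J. emeasure (M (\<pi> j)) (A j))" .
  qed (use assms in auto)
qed

text \<open>The indicator of a rectangle factorises over the coordinates, so the integral of the
  product density splits by Fubini into side masses. Sigma-finiteness of the factors lets rectangles
  determine the product measure.\<close>

lemma PiM_density:
  assumes "finite J" "sigma_finite_measure N"
    and h: "\<And>j. h j \<in> borel_measurable N" "\<And>j. sigma_finite_measure (density N (h j))"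
  shows "PiM J (\<lambda>j. density N (h j)) = density (PiM J (\<lambda>_. N)) (\<lambda>z. \<Prod>j\<in>J. h j (z j))"
proof -
  interpret M: product_sigma_finite "\<lambda>j. density N (h j)" using assms by (simp add: product_sigma_finite_def)
  interpret N: product_sigma_finite "\<lambda>_. N" using assms by (simp add: product_sigma_finite_def)
  have meas: "(\<lambda>z. \<Prod>j\<in>J. h j (z j)) \<in> borel_measurable (PiM J (\<lambda>_. N))"
    using h(1) by (intro borel_measurable_prod_ennreal measurable_compose[OF measurable_component_singleton])
  show ?thesis
  proof (rule M.PiM_eqI[symmetric])
    fix A assume A: "\<And>j. j \<in> J \<Longrightarrow> A j \<in> sets (density N (h j))"
    then have "emeasure (density (PiM J (\<lambda>_. N)) (\<lambda>z. \<Prod>j\<in>J. h j (z j))) (Pi\<^sub>E J A) =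
        (\<integral>\<^sup>+z. (\<Prod>j\<in>J. h j (z j)) * indicator (Pi\<^sub>E J A) z \<partial>PiM J (\<lambda>_. N))"
      using meas assms(1) by (intro emeasure_density) (auto intro!: sets_PiM_I_finite)
    also have "\<dots> = (\<integral>\<^sup>+z. (\<Prod>j\<in>J. h j (z j) * indicator (A j) (z j)) \<partial>PiM J (\<lambda>_. N))"
    proof (intro nn_integral_cong)
      fix z assume z: "z \<in> space (PiM J (\<lambda>_. N))"
      have "indicator (Pi\<^sub>E J A) z = (\<Prod>j\<in>J. indicator (A j) (z j) :: ennreal)"
      proof (cases "\<forall>j\<in>J. z j \<in> A j")
        case True then show ?thesis using z by (auto simp: indicator_def space_PiM PiE_iff)
      next
        case False then show ?thesis using assms(1) by (auto simp: indicator_def PiE_iff prod_zero_iff)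
      qed
      then show "(\<Prod>j\<in>J. h j (z j)) * indicator (Pi\<^sub>E J A) z = (\<Prod>j\<in>J. h j (z j) * indicator (A j) (z j))"
        by (simp add: prod.distrib)
    qed
    also have "\<dots> = (\<Prod>j\<in>J. \<integral>\<^sup>+z. h j z * indicator (A j) z \<partial>N)"
      using assms A by (intro N.product_nn_integral_prod) auto
    also have "\<dots> = (\<Prod>j\<in>J. emeasure (density N (h j)) (A j))"
      using A h by (intro prod.cong) (auto simp: emeasure_density)
    finally show "emeasure (density (PiM J (\<lambda>_. N)) (\<lambda>z. \<Prod>j\<in>J. h j (z j))) (Pi\<^sub>E J A) =
        (\<Prod>j\<in>J. emeasure (density N (h j)) (A j))" .
  qed (use assms in \<open>auto intro!: sets_PiM_cong\<close>)
qed

text \<open>Kernels tensorise: on a rectangle the product mass is a finite product of measurable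
  functions of single coordinates, and rectangles form an intersection-stable generator. This gives
  the measurability in the starting points that the dual semigroup needs.\<close>

lemma measurable_PiM_prob_algebra:
  assumes "finite J" and P: "P \<in> L \<rightarrow>\<^sub>M prob_algebra M"
  shows "(\<lambda>z. PiM J (\<lambda>j. P (z j))) \<in> PiM J (\<lambda>_. L) \<rightarrow>\<^sub>M prob_algebra (PiM J (\<lambda>_. M))"
proof -
  have Pz: "prob_space (P (z j))" "sets (P (z j)) = sets M" if "z \<in> space (PiM J (\<lambda>_. L))" "j \<in> J" for z j
  proof -
    have "z j \<in> space L" using that by (auto simp: space_PiM)
    then have "P (z j) \<in> space (prob_algebra M)" using P by (rule measurable_space[rotated])
    then show "prob_space (P (z j))" "sets (P (z j)) = sets M" by (auto simp: space_prob_algebra)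
  qed
  show ?thesis
  proof (rule measurable_prob_algebra_generated[OF sets_PiM Int_stable_prod_algebra prod_algebra_sets_into_space])
    fix A assume "A \<in> prod_algebra J (\<lambda>_. M)"
    then obtain X where A: "A = Pi\<^sub>E J X" "\<And>j. j \<in> J \<Longrightarrow> X j \<in> sets M"
      by (auto simp: prod_algebra_eq_finite[OF assms(1)])
    have "emeasure (PiM J (\<lambda>j. P (z j))) A = (\<Prod>j\<in>J. emeasure (P (z j)) (X j))"
      if z: "z \<in> space (PiM J (\<lambda>_. L))" for z
    proof -
      have X: "X j \<in> sets (P (z j))" if "j \<in> J" for j using Pz(2)[OF z that] A(2)[OF that] by simp
      then show ?thesis
        using emeasure_PiM_emb[of J "\<lambda>j. P (z j)" J X] Pz[OF z] assms(1)
          prod_emb_PiE_same_index[of J X "\<lambda>j. P (z j)", OF sets.sets_into_space]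
        unfolding A(1) by simp
    qed
    moreover have "(\<lambda>z. \<Prod>j\<in>J. emeasure (P (z j)) (X j)) \<in> borel_measurable (PiM J (\<lambda>_. L))"
    proof (intro borel_measurable_prod_ennreal)
      fix j assume j: "j \<in> J"
      have "(\<lambda>z. P (z j)) \<in> PiM J (\<lambda>_. L) \<rightarrow>\<^sub>M prob_algebra M"
        by (rule measurable_compose[OF measurable_component_singleton[OF j] P])
      then have "(\<lambda>z. P (z j)) \<in> PiM J (\<lambda>_. L) \<rightarrow>\<^sub>M subprob_algebra M"
        by (rule measurable_prob_algebraD)
      then show "(\<lambda>z. emeasure (P (z j)) (X j)) \<in> borel_measurable (PiM J (\<lambda>_. L))"
        using A(2)[OF j] by (rule measurable_compose[OF _ measurable_emeasure_subprob_algebra])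
    qed
    ultimately show "(\<lambda>z. emeasure (PiM J (\<lambda>j. P (z j))) A) \<in> borel_measurable (PiM J (\<lambda>_. L))"
      by (simp cong: measurable_cong)
  next
    fix z assume z: "z \<in> space (PiM J (\<lambda>_. L))"
    show "prob_space (PiM J (\<lambda>j. P (z j)))" using Pz[OF z] by (intro prob_space_PiM) auto
    show "sets (PiM J (\<lambda>j. P (z j))) = sets (PiM J (\<lambda>_. M))" using Pz[OF z] by (intro sets_PiM_cong) auto
  qed
qed

text \<open>The total space is itself a rectangle, so one finite mass is enough and a constant
  sequence exhausts the space.\<close>

lemma measure_eqI_tuple_space:
  assumes "finite J" "sets P = sets (tuple_space D J)" "sets P' = sets (tuple_space D J)"
    and eq: "\<And>A. (\<And>j. j \<in> J \<Longrightarrow> A j \<in> sets (restrict_space borel D)) \<Longrightarrow>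
        emeasure P (Pi\<^sub>E J A) = emeasure P' (Pi\<^sub>E J A)"
    and fin: "emeasure P (J \<rightarrow>\<^sub>E D) \<noteq> \<infinity>"
  shows "P = P'"
proof (rule measure_eqI_PiM_finite)
  show "range (\<lambda>_::nat. J \<rightarrow>\<^sub>E D) \<subseteq> prod_algebra J (\<lambda>_. restrict_space borel D)"
    using \<open>finite J\<close> sets.top[of "restrict_space borel D"]
    by (auto simp: space_restrict_space intro!: prod_algebraI_finite)
  show "(\<Union>i::nat. J \<rightarrow>\<^sub>E D) = space (PiM J (\<lambda>_. restrict_space borel D))"
    by (simp add: space_PiM space_restrict_space)
qed (use assms in \<open>auto simp: tuple_space_def\<close>)

section \<open>Factorial measures of rectangles\<close>

text \<open>Labels are chosen for one index after another. A new index of block \<open>b\<close> has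
  to avoid only labels already used in that block, because the sets \<open>L b\<close> are disjoint,
  so it contributes the next factor of a falling factorial. Truncated subtraction makes the product
  0 as soon as a block has too few labels.\<close>

lemma card_inj_on_PiE_blocks:
  assumes "finite J" "finite T" "s \<in> J \<rightarrow> T"
    and L: "\<And>b. b \<in> T \<Longrightarrow> finite (L b)" "disjoint_family_on L T"
  shows "card {i \<in> (\<Pi>\<^sub>E j\<in>J. L (s j)). inj_on i J} = (\<Prod>b\<in>T. \<Prod>r<card {j\<in>J. s j = b}. card (L b) - r)"
  using assms(1,3)
proof (induction J)
  case empty
  then show ?case by simp
next
  case (insert j J)
  let ?X = "\<lambda>J. {i \<in> (\<Pi>\<^sub>E j\<in>J. L (s j)). inj_on i J}"
  let ?m = "\<lambda>J b. card {k\<in>J. s k = b}"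
  have sj: "s j \<in> T" and sJ: "\<And>k. k \<in> J \<Longrightarrow> s k \<in> T" using insert.prems by auto
  have fin: "finite (?X J)"
    using insert.hyps L(1) sJ by (intro finite_subset[OF _ finite_PiE[of J "\<lambda>j. L (s j)"]]) auto
  have "bij_betw (\<lambda>(i, y). i(j := y)) (SIGMA i:?X J. L (s j) - i ` J) (?X (insert j J))"
  proof (rule bij_betw_byWitness[where f' = "\<lambda>i. (i(j := undefined), i j)"])
    show "(\<lambda>(i, y). i(j := y)) ` (SIGMA i:?X J. L (s j) - i ` J) \<subseteq> ?X (insert j J)"
    proof (rule image_subsetI)
      fix p assume "p \<in> (SIGMA i:?X J. L (s j) - i ` J)"
      then obtain i y where p: "p = (i, y)"
        and i: "i \<in> (\<Pi>\<^sub>E j\<in>J. L (s j))" "inj_on i J" "y \<in> L (s j)" "y \<notin> i ` J"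
        by blast
      have "i(j := y) \<in> (\<Pi>\<^sub>E j\<in>insert j J. L (s j))" using i by (intro PiE_fun_upd)
      moreover have "inj_on (i(j := y)) (insert j J)"
        using i insert.hyps(2) by (auto simp: inj_on_def)
      ultimately show "(case p of (i, y) \<Rightarrow> i(j := y)) \<in> ?X (insert j J)" by (simp add: p)
    qed
    show "(\<lambda>i. (i(j := undefined), i j)) ` ?X (insert j J) \<subseteq> (SIGMA i:?X J. L (s j) - i ` J)"
      using insert.hyps(2) by (fastforce simp: PiE_iff extensional_def inj_on_def)
  qed (use insert.hyps(2) in \<open>auto simp: PiE_iff extensional_def\<close>)
  then have "card (?X (insert j J)) = card (SIGMA i:?X J. L (s j) - i ` J)"
    by (rule bij_betw_same_card[symmetric])
  also have "\<dots> = (\<Sum>i\<in>?X J. card (L (s j) - i ` J))"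
    using fin sj L(1) by (intro card_SigmaI) auto
  also have "\<dots> = (\<Sum>i\<in>?X J. card (L (s j)) - ?m J (s j))"
  proof (intro sum.cong refl)
    fix i assume i: "i \<in> ?X J"
    \<comment> \<open>Labels of indices from other blocks lie outside \<open>L (s j)\<close>, so the
      number of free labels is the same for every \<open>i\<close>.\<close>
    have "L (s j) - i ` J = L (s j) - i ` {k\<in>J. s k = s j}"
    proof -
      have "s k = s j" if k: "k \<in> J" "i k \<in> L (s j)" for k
        using i k disjoint_family_onD[OF L(2) sJ[OF k(1)] sj] by (auto simp: PiE_iff)
      then show ?thesis by auto
    qed
    moreover have "i ` {k\<in>J. s k = s j} \<subseteq> L (s j)" using i by (auto simp: PiE_iff)
    moreover have "inj_on i {k\<in>J. s k = s j}" using i by (auto simp: inj_on_def)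
    ultimately show "card (L (s j) - i ` J) = card (L (s j)) - ?m J (s j)"
      using insert.hyps(1) by (simp add: card_Diff_subset card_image)
  qed
  also have "\<dots> = (\<Prod>b\<in>T. \<Prod>r<?m J b. card (L b) - r) * (card (L (s j)) - ?m J (s j))"
    using insert.IH sJ by (simp add: Pi_iff)
  also have "\<dots> = (\<Prod>b\<in>T. \<Prod>r<?m (insert j J) b. card (L b) - r)"
  proof -
    have m: "?m (insert j J) b = (if b = s j then Suc (?m J b) else ?m J b)" for b
    proof (cases "b = s j")
      case True
      then have "{k\<in>insert j J. s k = b} = insert j {k\<in>J. s k = b}" by auto
      then show ?thesis using True insert.hyps by simp
    next
      case False
      then have "{k\<in>insert j J. s k = b} = {k\<in>J. s k = b}" by auto
      then show ?thesis using False by simp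
    qed
    show ?thesis
    proof -
      have "(\<Prod>b\<in>T - {s j}. \<Prod>r<(if b = s j then Suc (?m J b) else ?m J b). card (L b) - r) =
          (\<Prod>b\<in>T - {s j}. \<Prod>r<?m J b. card (L b) - r)"
        by (intro prod.cong) auto
      then show ?thesis
        unfolding m prod.remove[OF \<open>finite T\<close> sj] by (simp only: if_True refl prod.lessThan_Suc mult_ac)
    qed
  qed
  finally show ?case .
qed

text \<open>An injection into the union determines \<open>I\<close> as the set of indices labelled
  from \<open>L2\<close>. Labels of the two kinds never coincide, so injectivity on \<open>J\<close>
  amounts to injectivity on \<open>I\<close> and on \<open>J - I\<close> separately, and
  \<open>merge\<close> glues the parts.\<close>

lemma card_inj_on_PiE_Un:
  assumes "finite J"
    and L: "\<And>j. j \<in> J \<Longrightarrow> finite (L1 j)" "\<And>j. j \<in> J \<Longrightarrow> finite (L2 j)"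
    and disj: "\<And>j k. j \<in> J \<Longrightarrow> k \<in> J \<Longrightarrow> L1 j \<inter> L2 k = {}"
  shows "card {i \<in> (\<Pi>\<^sub>E j\<in>J. L1 j \<union> L2 j). inj_on i J} =
    (\<Sum>I\<in>Pow J. card {i \<in> Pi\<^sub>E I L2. inj_on i I} * card {i \<in> Pi\<^sub>E (J - I) L1. inj_on i (J - I)})"
proof -
  let ?X = "\<lambda>L I. {i \<in> Pi\<^sub>E I L. inj_on i I}"
  let ?B = "{i \<in> (\<Pi>\<^sub>E j\<in>J. L1 j \<union> L2 j). inj_on i J}"
  let ?I = "\<lambda>i. {j\<in>J. i j \<in> L2 j}"
  have fin: "finite (?X L I)" if "I \<subseteq> J" "\<And>j. j \<in> J \<Longrightarrow> finite (L j)" for L :: "'a \<Rightarrow> 'b set" and I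
    using that \<open>finite J\<close>
    by (intro finite_subset[OF _ finite_PiE[of I L]]) (auto intro: finite_subset)
  have "bij_betw (\<lambda>(I, g). merge I (J - I) g) (SIGMA I:Pow J. ?X L2 I \<times> ?X L1 (J - I)) ?B"
  proof (rule bij_betw_byWitness[where f' = "\<lambda>i. (?I i, restrict i (?I i), restrict i (J - ?I i))"])
    show "\<forall>a\<in>SIGMA I:Pow J. ?X L2 I \<times> ?X L1 (J - I). (\<lambda>i. (?I i, restrict i (?I i), restrict i (J - ?I i)))
        (case a of (I, g) \<Rightarrow> merge I (J - I) g) = a"
    proof clarsimp
      fix I g h assume *: "I \<subseteq> J" "g \<in> Pi\<^sub>E I L2" "h \<in> Pi\<^sub>E (J - I) L1"
      \<comment> \<open>Disjointness of the label sets is what allows \<open>I\<close> to be read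
        off from the glued map.\<close>
      have I: "?I (merge I (J - I) (g, h)) = I"
      proof (intro equalityI subsetI)
        fix j assume j: "j \<in> ?I (merge I (J - I) (g, h))"
        show "j \<in> I"
        proof (rule ccontr)
          assume "j \<notin> I"
          then have "h j \<in> L1 j" "h j \<in> L2 j" using j *(3) by (auto simp: merge_def PiE_iff)
          then show False using disj j by auto
        qed
      qed (use * in \<open>auto simp: merge_def PiE_iff\<close>)
      show "?I (merge I (J - I) (g, h)) = I \<and>
          restrict (merge I (J - I) (g, h)) (?I (merge I (J - I) (g, h))) = g \<and>
          restrict (merge I (J - I) (g, h)) (J - ?I (merge I (J - I) (g, h))) = h"
        unfolding I using * by (auto simp: merge_def PiE_iff extensional_def restrict_def)
    qed
    show "\<forall>i\<in>?B. (case (?I i, restrict i (?I i), restrict i (J - ?I i)) of (I, g) \<Rightarrow> merge I (J - I) g) = i"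
      by (auto simp: merge_def PiE_iff extensional_def)
    show "(\<lambda>(I, g). merge I (J - I) g) ` (SIGMA I:Pow J. ?X L2 I \<times> ?X L1 (J - I)) \<subseteq> ?B"
    proof clarsimp
      fix I g h assume *: "I \<subseteq> J" "g \<in> Pi\<^sub>E I L2" "h \<in> Pi\<^sub>E (J - I) L1" "inj_on g I" "inj_on h (J - I)"
      have "inj_on (merge I (J - I) (g, h)) J"
      proof (rule inj_onI)
        fix j k assume jk: "j \<in> J" "k \<in> J" "merge I (J - I) (g, h) j = merge I (J - I) (g, h) k"
        have g: "g j \<in> L2 j" if "j \<in> I" for j using * that by (auto simp: PiE_iff)
        have h: "h j \<in> L1 j" if "j \<in> J - I" for j using * that by (auto simp: PiE_iff)
        show "j = k"
        proof (cases "j \<in> I"; cases "k \<in> I")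
          assume "j \<in> I" "k \<in> I"
          then show ?thesis using jk inj_onD[OF *(4), of j k] by (simp add: merge_def)
        next
          assume "j \<notin> I" "k \<notin> I"
          then show ?thesis using jk inj_onD[OF *(5), of j k] by (simp add: merge_def)
        next
          assume "j \<in> I" "k \<notin> I"
          then show ?thesis using jk g[of j] h[of k] disj[of k j] by (auto simp: merge_def)
        next
          assume "j \<notin> I" "k \<in> I"
          then show ?thesis using jk g[of k] h[of j] disj[of j k] by (auto simp: merge_def)
        qed
      qed
      then show "merge I (J - I) (g, h) \<in> (\<Pi>\<^sub>E j\<in>J. L1 j \<union> L2 j) \<and> inj_on (merge I (J - I) (g, h)) J"
        using * by (auto simp: merge_def PiE_iff extensional_def)
    qed
    show "(\<lambda>i. (?I i, restrict i (?I i), restrict i (J - ?I i))) ` ?B \<subseteq> (SIGMA I:Pow J. ?X L2 I \<times> ?X L1 (J - I))"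
    proof (rule image_subsetI)
      fix i assume i: "i \<in> ?B"
      then have "inj_on i J" by simp
      then have "inj_on i (?I i)" "inj_on i (J - ?I i)" by (rule inj_on_subset, blast)+
      moreover have "restrict i (?I i) \<in> Pi\<^sub>E (?I i) L2" by auto
      moreover have "restrict i (J - ?I i) \<in> Pi\<^sub>E (J - ?I i) L1" using i by (auto simp: PiE_iff)
      moreover have "?I i \<in> Pow J" by blast
      ultimately show "(?I i, restrict i (?I i), restrict i (J - ?I i)) \<in> (SIGMA I:Pow J. ?X L2 I \<times> ?X L1 (J - I))"
        by simp
    qed
  qed
  then have "card ?B = card (SIGMA I:Pow J. ?X L2 I \<times> ?X L1 (J - I))"
    by (rule bij_betw_same_card[symmetric])
  also have "\<dots> = (\<Sum>I\<in>Pow J. card (?X L2 I \<times> ?X L1 (J - I)))"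
    using \<open>finite J\<close> fin L by (intro card_SigmaI) auto
  finally show ?thesis by (simp add: card_cartesian_product)
qed

lemma card_inj_on_PiE_image:
  assumes "inj \<phi>"
  shows "card {i \<in> (\<Pi>\<^sub>E j\<in>J. \<phi> ` L j). inj_on i J} = card {i \<in> Pi\<^sub>E J L. inj_on i J}"
proof -
  have [simp]: "inv \<phi> (\<phi> p) = p" for p using assms by simp
  have "bij_betw (\<lambda>i. \<lambda>j\<in>J. \<phi> (i j)) {i \<in> Pi\<^sub>E J L. inj_on i J} {i \<in> (\<Pi>\<^sub>E j\<in>J. \<phi> ` L j). inj_on i J}"
  proof (rule bij_betw_byWitness[where f' = "\<lambda>i. \<lambda>j\<in>J. inv \<phi> (i j)"])
    show "\<forall>i\<in>{i \<in> Pi\<^sub>E J L. inj_on i J}. (\<lambda>j\<in>J. inv \<phi> ((\<lambda>j\<in>J. \<phi> (i j)) j)) = i"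
      by (auto simp: PiE_iff extensional_def)
    show "\<forall>i\<in>{i \<in> (\<Pi>\<^sub>E j\<in>J. \<phi> ` L j). inj_on i J}. (\<lambda>j\<in>J. \<phi> ((\<lambda>j\<in>J. inv \<phi> (i j)) j)) = i"
      by (auto simp: PiE_iff extensional_def fun_eq_iff f_inv_into_f[where f = \<phi>])
    show "(\<lambda>i. \<lambda>j\<in>J. \<phi> (i j)) ` {i \<in> Pi\<^sub>E J L. inj_on i J} \<subseteq> {i \<in> (\<Pi>\<^sub>E j\<in>J. \<phi> ` L j). inj_on i J}"
      using assms by (auto simp: PiE_iff inj_on_def)
    show "(\<lambda>i. \<lambda>j\<in>J. inv \<phi> (i j)) ` {i \<in> (\<Pi>\<^sub>E j\<in>J. \<phi> ` L j). inj_on i J} \<subseteq> {i \<in> Pi\<^sub>E J L. inj_on i J}"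
      by (auto simp: PiE_iff) (auto simp: inj_on_def, (metis \<open>\<And>p. inv \<phi> (\<phi> p) = p\<close> imageE)+)
  qed
  then show ?thesis by (rule bij_betw_same_card[symmetric])
qed

text \<open>The mass that a factorial measure gives to a rectangle, kept as a natural number and
  free of a reference domain, so that it can be handled by pure counting.\<close>

definition rect_count :: "nat set \<Rightarrow> (nat \<Rightarrow> 'a set) \<Rightarrow> 'a multiset \<Rightarrow> nat" where
  "rect_count J A c = card {i \<in> (\<Pi>\<^sub>E j\<in>J. {p \<in> labelled_points c. fst p \<in> A j}). inj_on i J}"

lemma labelled_points_Sigma: "labelled_points c = (SIGMA y:set_mset c. {..<count c y})"
  by (auto simp: labelled_points_def simp flip: count_greater_zero_iff)

lemma finite_labelled_points [simp]: "finite (labelled_points c)"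
  by (simp add: labelled_points_Sigma)

lemma card_labelled_points: "card {p \<in> labelled_points c. fst p \<in> B} = num_points B c"
proof -
  have "{p \<in> labelled_points c. fst p \<in> B} = (SIGMA y:set_mset (filter_mset (\<lambda>y. y \<in> B) c). {..<count c y})"
    by (auto simp: labelled_points_Sigma)
  then have "card {p \<in> labelled_points c. fst p \<in> B} = (\<Sum>y\<in>set_mset (filter_mset (\<lambda>y. y \<in> B) c). count c y)"
    by simp
  also have "\<dots> = num_points B c"
    unfolding num_points_def size_multiset_overloaded_eq by (intro sum.cong) auto
  finally show ?thesis .
qed

text \<open>In this form the count depends only on the numbers of points in disjoint sets, which are
  the data that the sigma-algebra on configurations makes measurable and that the Poisson property
  describes.\<close>

lemma rect_count_blocks:
  assumes "finite J" "finite T" "s \<in> J \<rightarrow> T" "disjoint_family_on B T"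
  shows "rect_count J (\<lambda>j. B (s j)) c = (\<Prod>b\<in>T. \<Prod>r<card {j\<in>J. s j = b}. num_points (B b) c - r)"
  unfolding rect_count_def card_labelled_points[symmetric] using assms
  by (intro card_inj_on_PiE_blocks[where L = "\<lambda>b. {p \<in> labelled_points c. fst p \<in> B b}"])
    (auto simp: disjoint_family_on_def)

text \<open>At a point \<open>y\<close> of the sum the labels below \<open>count c1 y\<close> belong
  to \<open>c1\<close>, and the others are the labels of \<open>c2\<close> shifted up by
  \<open>count c1 y\<close>. \<open>I\<close> collects the indices that use points of
  \<open>c2\<close>.\<close>

lemma rect_count_add:
  assumes "finite J"
  shows "rect_count J A (c1 + c2) = (\<Sum>I\<in>Pow J. rect_count I A c2 * rect_count (J - I) A c1)"
proof -
  let ?\<phi> = "\<lambda>(y, l). (y, count c1 y + l)"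
  let ?L = "\<lambda>c j. {p \<in> labelled_points c. fst p \<in> A j}"
  have "?L (c1 + c2) j = ?L c1 j \<union> ?\<phi> ` ?L c2 j" for j
  proof (intro equalityI subsetI)
    fix p assume p: "p \<in> ?L (c1 + c2) j"
    obtain y l where yl: "p = (y, l)" by force
    show "p \<in> ?L c1 j \<union> ?\<phi> ` ?L c2 j"
    proof (cases "l < count c1 y")
      case True
      then show ?thesis using p yl by (simp add: labelled_points_def)
    next
      case False
      then have "p = ?\<phi> (y, l - count c1 y)" "(y, l - count c1 y) \<in> ?L c2 j"
        using p yl by (auto simp: labelled_points_def)
      then show ?thesis by blast
    qed
  qed (auto simp: labelled_points_def)
  moreover have "?L c1 j \<inter> ?\<phi> ` ?L c2 k = {}" for j k by (auto simp: labelled_points_def)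
  moreover have "finite (?L c j)" for c j by simp
  moreover have "inj ?\<phi>" by (auto simp: inj_on_def)
  ultimately show ?thesis
    unfolding rect_count_def
    by (simp only:) (subst card_inj_on_PiE_Un[OF assms], auto simp: card_inj_on_PiE_image)
qed

text \<open>Serves to drop the restriction of the particle system to \<open>D\<close>: absorbed
  particles are never counted by sides contained in \<open>D\<close>.\<close>

lemma rect_count_filter:
  assumes "\<And>j. j \<in> J \<Longrightarrow> A j \<subseteq> D"
  shows "rect_count J A (filter_mset (\<lambda>y. y \<in> D) c) = rect_count J A c"
proof -
  have "(\<Pi>\<^sub>E j\<in>J. {p \<in> labelled_points (filter_mset (\<lambda>y. y \<in> D) c). fst p \<in> A j}) =
      (\<Pi>\<^sub>E j\<in>J. {p \<in> labelled_points c. fst p \<in> A j})"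
  proof (rule PiE_cong)
    fix j assume "j \<in> J"
    then show "{p \<in> labelled_points (filter_mset (\<lambda>y. y \<in> D) c). fst p \<in> A j} = {p \<in> labelled_points c. fst p \<in> A j}"
      using assms[of j] by (auto simp: labelled_points_def split: if_splits)
  qed
  then show ?thesis by (simp add: rect_count_def)
qed

section \<open>Factorial measures on measurable sets of tuples\<close>

lemma fst_labelled_points: "fst p \<in> set_mset c" if "p \<in> labelled_points c"
  using that by (auto simp: labelled_points_Sigma)

lemma sets_factorial_measure [simp]: "sets (factorial_measure D J c) = sets (tuple_space D J)"
  by (simp add: factorial_measure_def)

lemma space_factorial_measure [simp]: "space (factorial_measure D J c) = J \<rightarrow>\<^sub>E D"
  by (simp add: factorial_measure_def)

lemma finite_inj_on_PiE: "finite J \<Longrightarrow> finite S \<Longrightarrow> finite {i \<in> J \<rightarrow>\<^sub>E S. inj_on i J}"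
  by (rule finite_subset[OF _ finite_PiE[of J "\<lambda>_. S"]]) auto

text \<open>A configuration in \<open>D\<close> makes the labelling map land in the tuple space, so
  \<open>distr\<close> is a genuine push-forward of counting measure.\<close>

lemma emeasure_factorial_measure:
  assumes "finite J" "set_mset c \<subseteq> D" "A \<in> sets (tuple_space D J)"
  shows "emeasure (factorial_measure D J c) A =
    card {i \<in> J \<rightarrow>\<^sub>E labelled_points c. inj_on i J \<and> (\<lambda>j\<in>J. fst (i j)) \<in> A}"
proof -
  let ?X = "{i \<in> J \<rightarrow>\<^sub>E labelled_points c. inj_on i J}"
  let ?f = "\<lambda>i. \<lambda>j\<in>J. fst (i j :: 'a \<times> nat)"
  have "?f \<in> count_space ?X \<rightarrow>\<^sub>M tuple_space D J"
  proof (rule measurable_count_space_eq1[THEN iffD2], rule funcsetI)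
    fix i assume i: "i \<in> ?X"
    have "fst (i j) \<in> D" if "j \<in> J" for j
      using i fst_labelled_points[of "i j" c] assms(2) PiE_mem[of i J _ j] that by auto
    then show "?f i \<in> space (tuple_space D J)" by auto
  qed
  then have "emeasure (factorial_measure D J c) A = emeasure (count_space ?X) (?f -` A \<inter> ?X)"
    using assms(3) by (simp add: factorial_measure_def emeasure_distr)
  also have "\<dots> = card (?f -` A \<inter> ?X)"
    using assms(1) by (intro emeasure_count_space_finite) (auto simp: finite_inj_on_PiE)
  also have "?f -` A \<inter> ?X = {i \<in> J \<rightarrow>\<^sub>E labelled_points c. inj_on i J \<and> ?f i \<in> A}" by auto
  finally show ?thesis .
qed

lemma finite_measure_factorial_measure:
  assumes "finite J" "set_mset c \<subseteq> D"
  shows "finite_measure (factorial_measure D J c)"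
  using emeasure_factorial_measure[OF assms sets.top] by (intro finite_measureI) simp

lemma emeasure_factorial_measure_PiE:
  assumes "finite J" "set_mset c \<subseteq> D" "\<And>j. j \<in> J \<Longrightarrow> A j \<in> sets (restrict_space borel D)"
  shows "emeasure (factorial_measure D J c) (Pi\<^sub>E J A) = rect_count J A c"
proof -
  have "Pi\<^sub>E J A \<in> sets (tuple_space D J)"
    using assms by (auto simp: tuple_space_def intro!: sets_PiM_I_finite)
  moreover have "{i \<in> J \<rightarrow>\<^sub>E labelled_points c. inj_on i J \<and> (\<lambda>j\<in>J. fst (i j)) \<in> Pi\<^sub>E J A} =
      {i \<in> (\<Pi>\<^sub>E j\<in>J. {p \<in> labelled_points c. fst p \<in> A j}). inj_on i J}"
    by (auto simp: PiE_iff)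
  ultimately show ?thesis using assms by (simp add: emeasure_factorial_measure rect_count_def)
qed

text \<open>Statements about all configurations have to use \<open>UNIV\<close>; for a configuration
  in \<open>D\<close> and a set of tuples in \<open>D\<close> both versions count the same
  labellings.\<close>

lemma emeasure_factorial_measure_UNIV:
  assumes "finite J" "D \<in> sets borel" "set_mset c \<subseteq> D" "A \<in> sets (tuple_space D J)"
  shows "emeasure (factorial_measure UNIV J c) A = emeasure (factorial_measure D J c) A"
  using assms sets_tuple_space_mono[of J D UNIV A] by (simp add: emeasure_factorial_measure)

text \<open>Replaces labels by indices of the enumeration. Both sides are the mass of one factorial
  measure on \<open>UNIV\<close> under its two descriptions, so no second bijection has to be
  built.\<close>

lemma rect_count_enumeration:
  fixes x :: "nat \<Rightarrow> 'a::topological_space"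
  assumes "finite J" "\<And>j. j \<in> J \<Longrightarrow> A j \<in> sets borel"
  shows "rect_count J A (\<Sum>l=1..N. {#x l#}) = card {i \<in> J \<rightarrow>\<^sub>E {1..N}. inj_on i J \<and> (\<forall>j\<in>J. x (i j) \<in> A j)}"
proof -
  let ?X = "{i \<in> J \<rightarrow>\<^sub>E {1..N}. inj_on i J}"
  let ?f = "\<lambda>i. \<lambda>j\<in>J. x (i j)"
  have A: "Pi\<^sub>E J A \<in> sets (tuple_space UNIV J)" using assms by (intro PiE_in_sets_tuple_space) auto
  have "ennreal (rect_count J A (\<Sum>l=1..N. {#x l#})) = emeasure (factorial_measure UNIV J (\<Sum>l=1..N. {#x l#})) (Pi\<^sub>E J A)"
    using assms by (subst emeasure_factorial_measure_PiE) (auto simp: sets_restrict_space ennreal_of_nat_eq_real_of_nat)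
  also have "\<dots> = emeasure (count_space ?X) (?f -` Pi\<^sub>E J A \<inter> ?X)"
    using A by (subst factorial_measure_enumeration) (auto simp: emeasure_distr)
  also have "\<dots> = card (?f -` Pi\<^sub>E J A \<inter> ?X)"
    using assms(1) by (intro emeasure_count_space_finite) (auto simp: finite_inj_on_PiE)
  also have "?f -` Pi\<^sub>E J A \<inter> ?X = {i \<in> J \<rightarrow>\<^sub>E {1..N}. inj_on i J \<and> (\<forall>j\<in>J. x (i j) \<in> A j)}"
    by (auto simp: PiE_iff)
  finally show ?thesis by (simp add: ennreal_of_nat_eq_real_of_nat)
qed

section \<open>Measurability in the configuration\<close>

lemma measurable_num_points [measurable]:
  assumes "A \<in> sets borel"
  shows "num_points A \<in> config_space \<rightarrow>\<^sub>M count_space UNIV"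
proof (rule measurable_count_space_eq2_countable[THEN iffD2, OF conjI])
  show "\<forall>k\<in>UNIV. num_points A -` {k} \<inter> space config_space \<in> sets config_space"
    using assms by (auto simp: config_space_def)
qed auto

lemma measurable_config_spaceI:
  fixes X :: "'w \<Rightarrow> 'a::topological_space multiset"
  assumes "\<And>A. A \<in> sets borel \<Longrightarrow> (\<lambda>\<omega>. num_points A (X \<omega>)) \<in> M \<rightarrow>\<^sub>M count_space UNIV"
  shows "X \<in> M \<rightarrow>\<^sub>M config_space"
  unfolding config_space_def
proof (rule measurable_measure_of)
  fix B :: "'a multiset set" assume "B \<in> {num_points A -` {k} | A k. A \<in> sets borel}"
  then obtain A k where "B = num_points A -` {k}" "A \<in> sets borel" by blast
  then show "X -` B \<inter> space M \<in> sets M"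
    using measurable_sets[OF assms[of A], of "{k}"] by (simp add: vimage_comp comp_def vimage_def)
qed auto

lemma measurable_rect_count_blocks:
  assumes "finite J" "\<And>b. b < m \<Longrightarrow> B b \<in> sets borel" "disjoint_family_on B {..<m}" "s \<in> J \<rightarrow> {..<m::nat}"
  shows "(\<lambda>c. of_nat (rect_count J (\<lambda>j. B (s j)) c) :: ennreal) \<in> borel_measurable config_space"
  unfolding rect_count_blocks[OF assms(1) finite_lessThan assms(4,3)] of_nat_prod
proof (intro borel_measurable_prod_ennreal)
  fix b r assume "b \<in> {..<m}"
  then have "num_points (B b) \<in> config_space \<rightarrow>\<^sub>M count_space UNIV" using assms(2) by simp
  then show "(\<lambda>c. of_nat (num_points (B b) c - r) :: ennreal) \<in> borel_measurable config_space"
    by (rule measurable_compose) simp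
qed

text \<open>For disjoint blocks the mass is a product of falling factorials of measurable counts.
  Complements are handled by subtraction, legitimate since a finite configuration has finite
  factorial mass, and disjoint unions by summing a series.\<close>

lemma measurable_factorial_measure:
  assumes "finite J" "A \<in> sets (tuple_space UNIV J)"
  shows "(\<lambda>c. emeasure (factorial_measure UNIV J c) A) \<in> borel_measurable config_space"
  using assms unfolding tuple_space_def
proof (induction rule: Pi\<^sub>E_disjoint_blocks_induct)
  case (block m B s)
  have "B b \<in> sets borel" if "b < m" for b
    using block(1)[OF that] by (simp add: sets_restrict_space)
  then show ?case
    using block assms(1) measurable_rect_count_blocks[of J m B s]
    by (subst emeasure_factorial_measure_PiE) (auto simp: Pi_iff)
next
  case (compl A)
  let ?S = "J \<rightarrow>\<^sub>E (UNIV :: 'a set)"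
  \<comment> \<open>The total mass is the case of a single block, the whole space.\<close>
  have "(\<lambda>c. of_nat (rect_count J (\<lambda>_. UNIV :: 'a set) c) :: ennreal) \<in> borel_measurable config_space"
    using measurable_rect_count_blocks[of J 1 "\<lambda>_. UNIV" "\<lambda>_. 0"] assms(1) by (simp add: disjoint_family_on_def)
  then have S: "(\<lambda>c. emeasure (factorial_measure UNIV J c) ?S) \<in> borel_measurable config_space"
    using assms(1) by (subst emeasure_factorial_measure_PiE) (auto simp: sets_restrict_space)
  have "emeasure (factorial_measure UNIV J c) (?S - A) =
      emeasure (factorial_measure UNIV J c) ?S - emeasure (factorial_measure UNIV J c) A" for c
    using compl(1) finite_measure.emeasure_finite[OF finite_measure_factorial_measure[of J c UNIV], of A] assms(1)
      emeasure_compl[of A "factorial_measure UNIV J c"]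
    by (simp add: tuple_space_def)
  then show ?case
    using S compl(2) by (simp add: space_PiM space_restrict_space)
next
  case (union A)
  have "emeasure (factorial_measure UNIV J c) (\<Union>i. A i) = (\<Sum>i. emeasure (factorial_measure UNIV J c) (A i))" for c
    using union(1,2) by (intro suminf_emeasure[symmetric]) (auto simp: tuple_space_def)
  then show ?case using union(3) by simp
qed simp

lemma integral_factorial_measure_point_sum:
  fixes x :: "nat \<Rightarrow> 'a::topological_space" and f :: "(nat \<Rightarrow> 'a) \<Rightarrow> real" and N :: nat
  assumes J: "finite J" and x: "\<And>l. l \<in> {1..N} \<Longrightarrow> x l \<in> D" and f: "f \<in> borel_measurable (tuple_space D J)"
  shows "(\<integral>y. f y \<partial>factorial_measure D J (\<Sum>l=1..N. {#x l#})) =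
    (\<Sum>i | i \<in> J \<rightarrow>\<^sub>E {1..N} \<and> inj_on i J. f (\<lambda>j\<in>J. x (i j)))"
proof -
  let ?I = "{i \<in> J \<rightarrow>\<^sub>E {1..N}. inj_on i J}"
  have meas: "(\<lambda>i. \<lambda>j\<in>J. x (i j)) \<in> count_space ?I \<rightarrow>\<^sub>M tuple_space D J"
  proof (rule measurable_count_space_eq1[THEN iffD2], rule funcsetI)
    fix i assume i: "i \<in> ?I"
    then have "x (i j) \<in> D" if "j \<in> J" for j using that by (intro x) (auto simp: PiE_iff)
    then show "(\<lambda>j\<in>J. x (i j)) \<in> space (tuple_space D J)" by auto
  qed
  have "(\<integral>y. f y \<partial>factorial_measure D J (\<Sum>l=1..N. {#x l#})) = (\<integral>i. f (\<lambda>j\<in>J. x (i j)) \<partial>count_space ?I)"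
    by (subst factorial_measure_enumeration[of N x D J, OF x], assumption, rule integral_distr[OF meas f])
  also have "\<dots> = (\<Sum>i\<in>?I. f (\<lambda>j\<in>J. x (i j)))"
    using finite_inj_on_PiE[OF J, of "{1..N}"] by (intro lebesgue_integral_count_space_finite) simp
  finally show ?thesis by simp
qed

section \<open>Poisson point processes\<close>

lemma (in prob_space) indep_var_nn_integral:
  assumes "indep_var S X T Z" "f \<in> borel_measurable S" "g \<in> borel_measurable T"
  shows "(\<integral>\<^sup>+\<omega>. f (X \<omega>) * g (Z \<omega>) \<partial>M) = (\<integral>\<^sup>+\<omega>. f (X \<omega>) \<partial>M) * (\<integral>\<^sup>+\<omega>. (g (Z \<omega>) :: ennreal) \<partial>M)"
proof -
  \<comment> \<open>Independence of a pair is coded as independence of a family indexed by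
    \<open>bool\<close>; after composition both targets are the same Borel space.\<close>
  have [simp]: "case_bool borel borel = (\<lambda>_. borel :: ennreal measure)"
    by (auto simp: fun_eq_iff split: bool.split)
  have "indep_vars (\<lambda>_. borel) (case_bool (f \<circ> X) (g \<circ> Z)) UNIV"
    using indep_var_compose[OF assms] by (simp add: indep_var_def)
  from indep_vars_nn_integral[OF _ this] show ?thesis
    by (simp add: UNIV_bool comp_def mult.commute)
qed

lemma descending_prod_fact: "(\<Prod>i<m. k + m - i) * fact k = fact (k + m)" for k m :: nat
proof (induction m)
  case (Suc m)
  have "(\<Prod>i<Suc m. k + Suc m - i) = (k + Suc m) * (\<Prod>i<m. k + m - i)"
    by (simp only: prod.lessThan_Suc_shift) simp
  then have "(\<Prod>i<Suc m. k + Suc m - i) * fact k = (k + Suc m) * ((\<Prod>i<m. k + m - i) * fact k)"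
    by (simp only: mult.assoc)
  then show ?case by (simp add: Suc)
qed simp

text \<open>The factorial moments of a Poisson variable are the powers of its parameter: the terms
  with \<open>k < m\<close> vanish, and after a shift by \<open>m\<close> the falling factorial
  turns \<open>fact (k + m)\<close> into \<open>fact k\<close>, leaving the exponential
  series.\<close>

lemma suminf_descending_poisson:
  assumes "0 \<le> r"
  shows "(\<Sum>k. of_nat (\<Prod>i<m. k - i) * ennreal (r ^ k / fact k * exp (- r))) = ennreal r ^ m"
proof -
  define f where "f k = real (\<Prod>i<m. k - i) * (r ^ k / fact k * exp (- r))" for k
  \<comment> \<open>For \<open>k < m\<close> the product contains the factor with
    \<open>i = k\<close>, which is 0.\<close>
  have f0: "f k = 0" if "k < m" for k
    using that by (force simp: f_def)
  have "f (k + m) = r ^ m * exp (- r) * (r ^ k /\<^sub>R fact k)" for k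
  proof -
    have "real (\<Prod>i<m. k + m - i) = fact (k + m) / fact k"
      using arg_cong[OF descending_prod_fact[of k m], of real] by (simp add: field_simps)
    then show ?thesis by (simp add: f_def power_add field_simps)
  qed
  moreover have "(\<lambda>k. r ^ m * exp (- r) * (r ^ k /\<^sub>R fact k)) sums (r ^ m * exp (- r) * exp r)"
    by (intro sums_mult exp_converges)
  moreover have "r ^ m * exp (- r) * exp r = r ^ m"
    by (simp add: exp_minus)
  ultimately have "(\<lambda>k. f (k + m)) sums (r ^ m)"
    by (simp only:)
  then have "f sums (r ^ m)"
    using sums_iff_shift[of f m "r ^ m"] f0 by simp
  moreover have "0 \<le> f k" for k unfolding f_def using assms
    by (intro mult_nonneg_nonneg divide_nonneg_nonneg of_nat_0_le_iff) auto
  ultimately have "(\<Sum>k. ennreal (f k)) = ennreal (r ^ m)" by (intro suminf_ennreal_eq)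
  moreover have "ennreal (f k) = of_nat (\<Prod>i<m. k - i) * ennreal (r ^ k / fact k * exp (- r))" for k
    using assms by (simp only: f_def ennreal_mult' of_nat_0_le_iff ennreal_of_nat_eq_real_of_nat)
  ultimately show ?thesis using assms by (simp add: ennreal_power)
qed

lemma nn_integral_nat_valued:
  fixes g :: "nat \<Rightarrow> ennreal"
  assumes "X \<in> M \<rightarrow>\<^sub>M count_space UNIV"
  shows "(\<integral>\<^sup>+\<omega>. g (X \<omega>) \<partial>M) = (\<Sum>k. g k * emeasure M {\<omega>\<in>space M. X \<omega> = k})"
proof -
  have sets: "{\<omega>\<in>space M. X \<omega> = k} \<in> sets M" for k
    using measurable_sets[OF assms, of "{k}"] by (simp add: vimage_def Int_def conj_commute)
  have "(\<integral>\<^sup>+\<omega>. g (X \<omega>) \<partial>M) = (\<integral>\<^sup>+\<omega>. (\<Sum>k. g k * indicator {\<omega>\<in>space M. X \<omega> = k} \<omega>) \<partial>M)"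
  proof (rule nn_integral_cong)
    fix \<omega> assume "\<omega> \<in> space M"
    then show "g (X \<omega>) = (\<Sum>k. g k * indicator {\<omega>\<in>space M. X \<omega> = k} \<omega>)"
      by (intro suminf_cmult_indicator[symmetric]) (auto simp: disjoint_family_on_def)
  qed
  also have "\<dots> = (\<Sum>k. \<integral>\<^sup>+\<omega>. g k * indicator {\<omega>\<in>space M. X \<omega> = k} \<omega> \<partial>M)"
    using sets by (intro nn_integral_suminf) auto
  also have "\<dots> = (\<Sum>k. g k * emeasure M {\<omega>\<in>space M. X \<omega> = k})"
    using sets by (simp add: nn_integral_cmult_indicator)
  finally show ?thesis .
qed

context
  fixes Q :: "'v measure" and \<nu> :: "'a::topological_space measure" and \<Theta> :: "'v \<Rightarrow> 'a multiset" and D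
  assumes Q: "prob_space Q" and \<Theta>: "poisson_point_process Q \<nu> \<Theta>"
    and D: "D \<in> sets borel" and sets_\<nu>: "sets \<nu> = sets (restrict_space borel D)" and fin_\<nu>: "finite_measure \<nu>"
begin

interpretation Q: prob_space Q by (rule Q)
interpretation \<nu>: finite_measure \<nu> by (rule fin_\<nu>)

lemma space_intensity: "space \<nu> = D"
  using sets_eq_imp_space_eq[OF sets_\<nu>] by (simp add: space_restrict_space)

lemma sets_intensityD: "A \<in> sets borel \<and> A \<subseteq> D" if "A \<in> sets \<nu>"
  using that D by (auto simp: sets_\<nu> sets_restrict_space)

lemma poisson_measurable: "\<Theta> \<in> Q \<rightarrow>\<^sub>M config_space"
  using \<Theta> by (simp add: poisson_point_process_def)

lemma poisson_set_mset: "\<omega> \<in> space Q \<Longrightarrow> set_mset (\<Theta> \<omega>) \<subseteq> D"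
  using \<Theta> by (auto simp: poisson_point_process_def space_intensity)

lemma poisson_factorial_moment:
  assumes A: "A \<in> sets \<nu>"
  shows "(\<integral>\<^sup>+\<omega>. of_nat (\<Prod>i<m. num_points A (\<Theta> \<omega>) - i) \<partial>Q) = emeasure \<nu> A ^ m"
proof -
  have "(\<lambda>\<omega>. num_points A (\<Theta> \<omega>)) \<in> Q \<rightarrow>\<^sub>M count_space UNIV"
    using sets_intensityD[OF A] by (intro measurable_compose[OF poisson_measurable measurable_num_points]) auto
  moreover have "emeasure Q {\<omega>\<in>space Q. num_points A (\<Theta> \<omega>) = k} =
      ennreal (measure \<nu> A ^ k / fact k * exp (- measure \<nu> A))" for k
    using \<Theta> A by (simp add: Q.emeasure_eq_measure poisson_point_process_def)
  ultimately show ?thesis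
    using nn_integral_nat_valued[of "\<lambda>\<omega>. num_points A (\<Theta> \<omega>)" Q "\<lambda>k. of_nat (\<Prod>i<m. k - i)"]
    by (simp only: suminf_descending_poisson \<nu>.emeasure_eq_measure measure_nonneg)
qed

text \<open>Counts of disjoint blocks are independent, so the expectation of the product of falling
  factorials splits. A block used by r indices contributes its intensity to the power r, and
  distributing the powers over the indices gives the product over \<open>J\<close>.\<close>

lemma poisson_blocks:
  assumes "finite J" and B: "\<And>b. b < m \<Longrightarrow> B b \<in> sets \<nu>" "disjoint_family_on B {..<m}" and s: "s \<in> J \<rightarrow> {..<m::nat}"
  shows "(\<integral>\<^sup>+\<omega>. of_nat (rect_count J (\<lambda>j. B (s j)) (\<Theta> \<omega>)) \<partial>Q) = (\<Prod>j\<in>J. emeasure \<nu> (B (s j)))"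
proof -
  let ?k = "\<lambda>b. card {j\<in>J. s j = b}"
  let ?g = "\<lambda>b k. of_nat (\<Prod>i<?k b. k - i) :: ennreal"
  have "(\<forall>b<m. B b \<in> sets \<nu>) \<and> disjoint_family_on B {..<m} \<longrightarrow>
      Q.indep_vars (\<lambda>_. count_space UNIV) (\<lambda>b \<omega>. num_points (B b) (\<Theta> \<omega>)) {..<m}"
    using \<Theta> unfolding poisson_point_process_def by (elim conjE) (drule spec[of _ m], drule spec[of _ B], assumption)
  then have "Q.indep_vars (\<lambda>_. count_space UNIV) (\<lambda>b \<omega>. num_points (B b) (\<Theta> \<omega>)) {..<m}"
    using B by simp
  then have indep: "Q.indep_vars (\<lambda>_. borel) (\<lambda>b \<omega>. ?g b (num_points (B b) (\<Theta> \<omega>))) {..<m}"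
    by (rule Q.indep_vars_compose2) auto
  have "(\<integral>\<^sup>+\<omega>. of_nat (rect_count J (\<lambda>j. B (s j)) (\<Theta> \<omega>)) \<partial>Q) =
      (\<integral>\<^sup>+\<omega>. (\<Prod>b<m. ?g b (num_points (B b) (\<Theta> \<omega>))) \<partial>Q)"
    by (simp only: rect_count_blocks[OF \<open>finite J\<close> _ s B(2)] finite_lessThan of_nat_prod)
  also have "\<dots> = (\<Prod>b<m. \<integral>\<^sup>+\<omega>. ?g b (num_points (B b) (\<Theta> \<omega>)) \<partial>Q)"
    by (rule Q.indep_vars_nn_integral[OF _ indep]) auto
  also have "\<dots> = (\<Prod>b<m. emeasure \<nu> (B b) ^ ?k b)"
    using B(1) poisson_factorial_moment by (intro prod.cong) auto
  also have "\<dots> = (\<Prod>b<m. \<Prod>j\<in>{j\<in>J. s j = b}. emeasure \<nu> (B (s j)))"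
    by (intro prod.cong) auto
  also have "\<dots> = (\<Prod>j\<in>J. emeasure \<nu> (B (s j)))"
    using \<open>finite J\<close> s by (intro prod.group) auto
  finally show ?thesis .
qed

text \<open>Both sides are finite measures in \<open>A\<close>, so their equality on block
  rectangles survives complements and disjoint unions.\<close>

lemma poisson_factorial_measure:
  assumes "finite J" and "A \<in> sets (PiM J (\<lambda>_. \<nu>))"
  shows "(\<integral>\<^sup>+\<omega>. emeasure (factorial_measure UNIV J (\<Theta> \<omega>)) A \<partial>Q) = emeasure (PiM J (\<lambda>_. \<nu>)) A"
proof -
  interpret product_sigma_finite "\<lambda>_. \<nu>"
    by (simp add: product_sigma_finite_def \<nu>.sigma_finite_measure_axioms)
  interpret P: finite_measure "PiM J (\<lambda>_. \<nu>)"
    using \<open>finite J\<close> fin_\<nu> by (rule finite_measure_PiM)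
  have sets_P: "sets (PiM J (\<lambda>_. \<nu>)) = sets (tuple_space D J)"
    using sets_\<nu> by (rule sets_PiM_restrict_borel)
  have U: "A \<in> sets (tuple_space UNIV J)" if "A \<in> sets (PiM J (\<lambda>_. \<nu>))" for A
    using sets_tuple_space_mono[OF \<open>finite J\<close> D, of UNIV A] that sets_P by simp
  have meas: "(\<lambda>\<omega>. emeasure (factorial_measure UNIV J (\<Theta> \<omega>)) A) \<in> borel_measurable Q"
    if "A \<in> sets (PiM J (\<lambda>_. \<nu>))" for A
    using measurable_compose[OF poisson_measurable measurable_factorial_measure[OF \<open>finite J\<close> U[OF that]]] .
  have fin: "finite_measure (factorial_measure UNIV J (\<Theta> \<omega>))" for \<omega>
    using \<open>finite J\<close> by (intro finite_measure_factorial_measure) auto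
  have on_blocks: "(\<integral>\<^sup>+\<omega>. emeasure (factorial_measure UNIV J (\<Theta> \<omega>)) (\<Pi>\<^sub>E j\<in>J. B (s j)) \<partial>Q) =
      emeasure (PiM J (\<lambda>_. \<nu>)) (\<Pi>\<^sub>E j\<in>J. B (s j))"
    if B: "\<And>b. b < m \<Longrightarrow> B b \<in> sets \<nu>" "disjoint_family_on B {..<m}" "s \<in> J \<rightarrow> {..<m}"
    for m :: nat and B s
  proof -
    have BU: "B (s j) \<in> sets (restrict_space borel UNIV)" if "j \<in> J" for j
      using sets_intensityD[OF B(1)[of "s j"]] B(3) that by (auto simp: sets_restrict_space)
    have "emeasure (PiM J (\<lambda>_. \<nu>)) (\<Pi>\<^sub>E j\<in>J. B (s j)) = (\<Prod>j\<in>J. emeasure \<nu> (B (s j)))"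
      using \<open>finite J\<close> B by (intro emeasure_PiM) auto
    then show ?thesis
      using BU \<open>finite J\<close> poisson_blocks[OF \<open>finite J\<close> B]
      by (simp add: emeasure_factorial_measure_PiE)
  qed
  from assms show ?thesis
  proof (induction rule: Pi\<^sub>E_disjoint_blocks_induct)
    case (block m B s)
    then show ?case by (rule on_blocks)
  next
    case (compl A)
    let ?S = "space (PiM J (\<lambda>_. \<nu>))"
    \<comment> \<open>Taking \<open>D\<close> as the only block settles the total mass, from which
      complements are subtracted.\<close>
    have S: "(\<integral>\<^sup>+\<omega>. emeasure (factorial_measure UNIV J (\<Theta> \<omega>)) ?S \<partial>Q) = emeasure (PiM J (\<lambda>_. \<nu>)) ?S"
      using on_blocks[of 1 "\<lambda>_. D" "\<lambda>_. 0"] sets.top[of \<nu>]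
      by (simp add: space_PiM space_intensity disjoint_family_on_def)
    have SA: "?S \<in> sets (PiM J (\<lambda>_. \<nu>))" "A \<subseteq> ?S" using compl(1) sets.sets_into_space by auto
    have "emeasure (factorial_measure UNIV J (\<Theta> \<omega>)) (?S - A) =
        emeasure (factorial_measure UNIV J (\<Theta> \<omega>)) ?S - emeasure (factorial_measure UNIV J (\<Theta> \<omega>)) A" for \<omega>
      using U[OF SA(1)] U[OF compl(1)] SA(2) finite_measure.emeasure_finite[OF fin]
      by (intro emeasure_Diff) auto
    then have "(\<integral>\<^sup>+\<omega>. emeasure (factorial_measure UNIV J (\<Theta> \<omega>)) (?S - A) \<partial>Q) =
        (\<integral>\<^sup>+\<omega>. emeasure (factorial_measure UNIV J (\<Theta> \<omega>)) ?S - emeasure (factorial_measure UNIV J (\<Theta> \<omega>)) A \<partial>Q)"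
      by simp
    \<comment> \<open>The expectations may be subtracted because the one of \<open>A\<close> is
      finite, by the induction hypothesis and the finite intensity.\<close>
    also have "\<dots> = (\<integral>\<^sup>+\<omega>. emeasure (factorial_measure UNIV J (\<Theta> \<omega>)) ?S \<partial>Q) -
        (\<integral>\<^sup>+\<omega>. emeasure (factorial_measure UNIV J (\<Theta> \<omega>)) A \<partial>Q)"
      using meas SA compl P.emeasure_finite[of A] U[OF SA(1)]
      by (intro nn_integral_diff) (auto intro!: emeasure_mono)
    also have "\<dots> = emeasure (PiM J (\<lambda>_. \<nu>)) (?S - A)"
      using compl SA P.emeasure_finite[of A] by (simp add: S emeasure_Diff)
    finally show ?case .
  next
    case (union A)
    then have A: "A i \<in> sets (PiM J (\<lambda>_. \<nu>))" for i by auto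
    have "(\<integral>\<^sup>+\<omega>. emeasure (factorial_measure UNIV J (\<Theta> \<omega>)) (\<Union>i. A i) \<partial>Q) =
        (\<integral>\<^sup>+\<omega>. (\<Sum>i. emeasure (factorial_measure UNIV J (\<Theta> \<omega>)) (A i)) \<partial>Q)"
      using U[OF A] union(1) by (intro nn_integral_cong suminf_emeasure[symmetric]) auto
    also have "\<dots> = (\<Sum>i. \<integral>\<^sup>+\<omega>. emeasure (factorial_measure UNIV J (\<Theta> \<omega>)) (A i) \<partial>Q)"
      using meas[OF A] by (rule nn_integral_suminf)
    also have "\<dots> = emeasure (PiM J (\<lambda>_. \<nu>)) (\<Union>i. A i)"
      unfolding union(3) using A union(1) by (intro suminf_emeasure) auto
    finally show ?case .
  qed simp
qed

text \<open>The sides may overlap here, and then their counts are dependent; the product formula is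
  nevertheless available because the whole factorial moment measure has been identified.\<close>

lemma poisson_rect_count:
  assumes "finite J" and A: "\<And>j. j \<in> J \<Longrightarrow> A j \<in> sets \<nu>"
  shows "(\<integral>\<^sup>+\<omega>. of_nat (rect_count J A (\<Theta> \<omega>)) \<partial>Q) = (\<Prod>j\<in>J. emeasure \<nu> (A j))"
proof -
  interpret product_sigma_finite "\<lambda>_. \<nu>"
    by (simp add: product_sigma_finite_def \<nu>.sigma_finite_measure_axioms)
  have "A j \<in> sets (restrict_space borel UNIV)" if "j \<in> J" for j
    using sets_intensityD[OF A[OF that]] by (auto simp: sets_restrict_space)
  then show ?thesis
    using assms poisson_factorial_measure[OF \<open>finite J\<close>, of "Pi\<^sub>E J A"]
    by (simp add: emeasure_factorial_measure_PiE emeasure_PiM sets_PiM_I_finite)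
qed

end

section \<open>Factorial measures of the gas\<close>

text \<open>Equal sizes of \<open>I\<close> and \<open>I'\<close> give equal sizes of their
  complements in \<open>J\<close>; the two bijections are glued and extended by the
  identity.\<close>

lemma ex_permutes_image:
  assumes "finite J" "I \<subseteq> J" "I' \<subseteq> J" "card I = card I'"
  obtains \<pi> where "\<pi> permutes J" "\<pi> ` I' = I"
proof -
  have fin: "finite I" "finite I'" using assms by (auto intro: finite_subset)
  obtain f where f: "bij_betw f I' I" using fin assms(4) by (metis bij_betw_iff_card)
  have "card (J - I') = card (J - I)" using assms fin by (simp add: card_Diff_subset)
  then obtain g where g: "bij_betw g (J - I') (J - I)"
    using assms(1) by (metis bij_betw_iff_card finite_Diff)
  define \<pi> where "\<pi> j = (if j \<in> I' then f j else if j \<in> J then g j else j)" for j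
  have 1: "bij_betw \<pi> I' I" using f by (rule bij_betw_cong[THEN iffD1, rotated]) (simp add: \<pi>_def)
  have 2: "bij_betw \<pi> (J - I') (J - I)" using g by (rule bij_betw_cong[THEN iffD1, rotated]) (simp add: \<pi>_def)
  have "bij_betw \<pi> (I' \<union> (J - I')) (I \<union> (J - I))" using 1 2 by (rule bij_betw_combine) auto
  then have "bij_betw \<pi> J J" using assms(2,3) by (simp add: Un_absorb1 Un_Diff_cancel)
  then have "\<pi> permutes J" using assms(3) by (intro bij_imp_permutes) (auto simp: \<pi>_def)
  then show thesis using that 1 by (simp add: bij_betw_def)
qed

lemma num_points_empty [simp]: "num_points A {#} = 0"
  by (simp add: num_points_def)

lemma num_points_add [simp]: "num_points A (c + c') = num_points A c + num_points A c'"
  by (simp add: num_points_def)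

lemma num_points_single [simp]: "num_points A {#y#} = of_bool (y \<in> A)"
  by (simp add: num_points_def)

lemma num_points_filter [simp]: "num_points A (filter_mset (\<lambda>y. y \<in> D) c) = num_points (A \<inter> D) c"
  by (simp add: num_points_def filter_filter_mset conj_commute)

lemma num_points_sum: "finite L \<Longrightarrow> num_points A (\<Sum>l\<in>L. c l) = (\<Sum>l\<in>L. num_points A (c l))"
  by (induction L rule: finite_induct) auto

lemma measurable_add_nat:
  fixes f g :: "'w \<Rightarrow> nat"
  assumes "f \<in> M \<rightarrow>\<^sub>M count_space UNIV" "g \<in> M \<rightarrow>\<^sub>M count_space UNIV"
  shows "(\<lambda>\<omega>. f \<omega> + g \<omega>) \<in> M \<rightarrow>\<^sub>M count_space UNIV"
  by (rule measurable_compose_countable[where f = "\<lambda>k \<omega>. k + g \<omega>", OF _ assms(1)])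
    (rule measurable_compose[OF assms(2)], simp)

lemma measurable_point_sum:
  fixes X :: "'l \<Rightarrow> 'w \<Rightarrow> 'a::topological_space"
  assumes "finite L" "\<And>l. l \<in> L \<Longrightarrow> X l \<in> M \<rightarrow>\<^sub>M borel"
  shows "(\<lambda>\<omega>. \<Sum>l\<in>L. {#X l \<omega>#}) \<in> M \<rightarrow>\<^sub>M config_space"
proof (rule measurable_config_spaceI)
  fix A :: "'a set" assume A: "A \<in> sets borel"
  have "(\<lambda>\<omega>. \<Sum>l\<in>L. of_bool (X l \<omega> \<in> A) :: nat) \<in> M \<rightarrow>\<^sub>M count_space UNIV"
    using assms
  proof (induction L rule: finite_induct)
    case (insert l L)
    have "(\<lambda>\<omega>. of_bool (X l \<omega> \<in> A) :: nat) \<in> M \<rightarrow>\<^sub>M count_space UNIV"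
    proof (rule measurable_compose[where f = "X l" and N = borel])
      show "X l \<in> M \<rightarrow>\<^sub>M borel" using insert by simp
      have "(\<lambda>y. of_bool (y \<in> A) :: nat) = (\<lambda>y. if y \<in> A then 1 else 0)" by auto
      then show "(\<lambda>y. of_bool (y \<in> A) :: nat) \<in> borel \<rightarrow>\<^sub>M count_space UNIV"
        using A by (simp add: measurable_If_set)
    qed
    then show ?case
      unfolding sum.insert[OF insert.hyps] by (rule measurable_add_nat) (use insert in simp)
  qed simp
  then show "(\<lambda>\<omega>. num_points A (\<Sum>l\<in>L. {#X l \<omega>#})) \<in> M \<rightarrow>\<^sub>M count_space UNIV"
    using assms(1) by (simp add: num_points_sum)
qed

lemma measurable_rect_count:
  assumes "finite J" "\<And>j. j \<in> J \<Longrightarrow> A j \<in> sets borel"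
  shows "(\<lambda>c. of_nat (rect_count J A c) :: ennreal) \<in> borel_measurable config_space"
  using measurable_factorial_measure[OF assms(1) PiE_in_sets_tuple_space[of J A UNIV]] assms
  by (simp add: emeasure_factorial_measure_PiE sets_restrict_space)

text \<open>The count is a sum of indicators over the injective choices \<open>i\<close> of
  particles. Distinct indices pick distinct, hence independent, coordinates, so each indicator has a
  product as its expectation, however much the sides overlap.\<close>

lemma nn_integral_rect_count_point_sum:
  fixes p :: "nat \<Rightarrow> 'a::topological_space measure"
  assumes "finite J" and A: "\<And>j. j \<in> J \<Longrightarrow> A j \<in> sets borel"
    and p: "\<And>l. prob_space (p l)" "\<And>l. sets (p l) = sets borel"
  shows "(\<integral>\<^sup>+y. of_nat (rect_count J A (\<Sum>l=1..N. {#y l#})) \<partial>PiM {1..N} p) =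
    (\<Sum>i | i \<in> J \<rightarrow>\<^sub>E {1..N} \<and> inj_on i J. \<Prod>j\<in>J. emeasure (p (i j)) (A j))"
proof -
  let ?P = "PiM {1..N} p" and ?I = "{i. i \<in> J \<rightarrow>\<^sub>E {1..N} \<and> inj_on i J}"
  let ?S = "\<lambda>i. {y\<in>space ?P. (\<lambda>j\<in>J. y (i j)) \<in> Pi\<^sub>E J A}"
  have finI: "finite ?I" using finite_inj_on_PiE[OF \<open>finite J\<close>, of "{1..N}"] by simp
  have i_in: "i j \<in> {1..N}" if "i \<in> ?I" "j \<in> J" for i j using that by (auto simp: PiE_iff)
  have meas: "(\<lambda>y. \<lambda>j\<in>J. y (i j)) \<in> ?P \<rightarrow>\<^sub>M PiM J (\<lambda>j. p (i j))" if "i \<in> ?I" for i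
    using i_in[OF that] by (intro measurable_restrict measurable_component_singleton)
  have PA: "Pi\<^sub>E J A \<in> sets (PiM J (\<lambda>j. p (i j)))" for i
    using assms by (intro sets_PiM_I_finite) auto
  have S: "?S i \<in> sets ?P" if "i \<in> ?I" for i
    using measurable_sets[OF meas[OF that] PA] by (simp add: vimage_def Int_def conj_commute)
  have prob: "emeasure ?P (?S i) = (\<Prod>j\<in>J. emeasure (p (i j)) (A j))" if i: "i \<in> ?I" for i
  proof -
    interpret product_sigma_finite "\<lambda>j. p (i j)"
      using p(1) by (simp add: product_sigma_finite_def prob_space_imp_sigma_finite)
    \<comment> \<open>Injectivity of \<open>i\<close> enters here: without repeated coordinates the
      selected tuple again has a product law.\<close>
    have "distr ?P (PiM J (\<lambda>j. p (i j))) (\<lambda>y. \<lambda>j\<in>J. y (i j)) = PiM J (\<lambda>j. p (i j))"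
      using p(1) i by (intro distr_PiM_reindex) auto
    moreover have "emeasure (distr ?P (PiM J (\<lambda>j. p (i j))) (\<lambda>y. \<lambda>j\<in>J. y (i j))) (Pi\<^sub>E J A) = emeasure ?P (?S i)"
      by (subst emeasure_distr[OF meas[OF i] PA]) (rule arg_cong[where f = "emeasure ?P"], blast)
    ultimately have "emeasure ?P (?S i) = emeasure (PiM J (\<lambda>j. p (i j))) (Pi\<^sub>E J A)"
      by simp
    also have "\<dots> = (\<Prod>j\<in>J. emeasure (p (i j)) (A j))"
      using assms by (intro emeasure_PiM) auto
    finally show ?thesis .
  qed
  have "(of_nat (rect_count J A (\<Sum>l=1..N. {#y l#})) :: ennreal) = (\<Sum>i\<in>?I. indicator (?S i) y)"
    if "y \<in> space ?P" for y
  proof -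
    have "{i \<in> J \<rightarrow>\<^sub>E {1..N}. inj_on i J \<and> (\<forall>j\<in>J. y (i j) \<in> A j)} = ?I \<inter> {i. y \<in> ?S i}"
      using that by (auto simp: PiE_iff)
    then have "(of_nat (rect_count J A (\<Sum>l=1..N. {#y l#})) :: ennreal) = of_nat (card (?I \<inter> {i. y \<in> ?S i}))"
      using assms by (subst rect_count_enumeration) auto
    also have "\<dots> = (\<Sum>i\<in>?I. indicator (?S i) y)"
      using finI by (simp add: indicator_def sum.If_cases)
    finally show ?thesis .
  qed
  then have "(\<integral>\<^sup>+y. of_nat (rect_count J A (\<Sum>l=1..N. {#y l#})) \<partial>?P) = (\<integral>\<^sup>+y. (\<Sum>i\<in>?I. indicator (?S i) y) \<partial>?P)"
    by (rule nn_integral_cong)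
  also have "\<dots> = (\<Sum>i\<in>?I. emeasure ?P (?S i))"
    using S by (subst nn_integral_sum) auto
  finally show ?thesis using prob by simp
qed

section \<open>The product measures that make up the expected factorial measure\<close>

definition gas_index :: "nat set \<Rightarrow> nat \<Rightarrow> (nat set \<times> (nat \<Rightarrow> nat)) set" where
  "gas_index J N = (SIGMA I:Pow J. {i. i \<in> J - I \<rightarrow>\<^sub>E {1..N} \<and> inj_on i (J - I)})"

text \<open>In the application, restricting the law \<open>p (i j)\<close> to \<open>D\<close> keeps
  exactly the event that the particle is not yet absorbed, so such a factor may have mass below 1.
  Within \<open>J\<close> the map \<open>i\<close> is consulted only off \<open>I\<close>.\<close>

definition gas_product ::
    "'a::topological_space measure \<Rightarrow> (nat \<Rightarrow> 'a measure) \<Rightarrow> 'a set \<Rightarrow> nat set \<Rightarrow> nat set \<Rightarrow> (nat \<Rightarrow> nat) \<Rightarrow> (nat \<Rightarrow> 'a) measure" where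
  "gas_product \<nu> p D J I i = PiM J (\<lambda>j. if j \<in> I then \<nu> else restrict_space (p (i j)) D)"

lemma finite_gas_index:
  assumes "finite J"
  shows "finite (gas_index J N)"
  unfolding gas_index_def
proof (rule finite_SigmaI)
  show "finite {i. i \<in> J - I \<rightarrow>\<^sub>E {1..N} \<and> inj_on i (J - I)}" for I
    using assms finite_inj_on_PiE[of "J - I" "{1..N}"] by simp
qed (use assms in simp)

definition gas_density ::
    "nat set \<Rightarrow> nat \<Rightarrow> ('a \<Rightarrow> ennreal) \<Rightarrow> (nat \<Rightarrow> 'a \<Rightarrow> ennreal) \<Rightarrow> (nat \<Rightarrow> 'a) \<Rightarrow> ennreal" where
  "gas_density J N g q z = (\<Sum>(I, i)\<in>gas_index J N. (\<Prod>j\<in>I. g (z j)) * (\<Prod>j\<in>J - I. q (i j) (z j)))"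

lemma sum_gas_index:
  assumes "finite J"
  shows "(\<Sum>(I, i)\<in>gas_index J N. h I i) =
    (\<Sum>I\<in>Pow J. \<Sum>i | i \<in> J - I \<rightarrow>\<^sub>E {1..N} \<and> inj_on i (J - I). h I i)"
  unfolding gas_index_def using assms by (intro sum.Sigma[symmetric] ballI) (simp_all add: finite_inj_on_PiE)

context
  fixes \<nu> :: "'a::topological_space measure" and D and p :: "nat \<Rightarrow> 'a measure"
  assumes D: "D \<in> sets borel" and sets_\<nu>: "sets \<nu> = sets (restrict_space borel D)" and fin_\<nu>: "finite_measure \<nu>"
    and p: "\<And>l. prob_space (p l)" "\<And>l. sets (p l) = sets borel"
begin

lemma gas_factor:
  "finite_measure (if j \<in> I then \<nu> else restrict_space (p l) D)"
  "sets (if j \<in> I then \<nu> else restrict_space (p l) D) = sets (restrict_space borel D)"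
proof -
  have "finite_measure (restrict_space (p l) D)"
    using D p prob_space.finite_measure[OF p(1)] by (intro finite_measure_restrict_space) auto
  then show "finite_measure (if j \<in> I then \<nu> else restrict_space (p l) D)" using fin_\<nu> by simp
  show "sets (if j \<in> I then \<nu> else restrict_space (p l) D) = sets (restrict_space borel D)"
    using sets_\<nu> p(2) by (simp add: sets_restrict_space)
qed

lemma sets_gas_product: "sets (gas_product \<nu> p D J I i) = sets (tuple_space D J)"
  unfolding gas_product_def using gas_factor by (intro sets_PiM_restrict_borel)

lemma finite_measure_gas_product: "finite J \<Longrightarrow> finite_measure (gas_product \<nu> p D J I i)"
  unfolding gas_product_def using gas_factor by (intro finite_measure_PiM)

lemma emeasure_gas_product:
  assumes "finite J" "I \<subseteq> J" and A: "\<And>j. j \<in> J \<Longrightarrow> A j \<in> sets (restrict_space borel D)"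
  shows "emeasure (gas_product \<nu> p D J I i) (Pi\<^sub>E J A) =
    (\<Prod>j\<in>I. emeasure \<nu> (A j)) * (\<Prod>j\<in>J - I. emeasure (p (i j)) (A j))"
proof -
  interpret product_sigma_finite "\<lambda>j. if j \<in> I then \<nu> else restrict_space (p (i j)) D"
    unfolding product_sigma_finite_def by (intro allI finite_measure.sigma_finite_measure gas_factor(1))
  have "emeasure (gas_product \<nu> p D J I i) (Pi\<^sub>E J A) =
      (\<Prod>j\<in>J. emeasure (if j \<in> I then \<nu> else restrict_space (p (i j)) D) (A j))"
    unfolding gas_product_def using \<open>finite J\<close> A by (intro emeasure_PiM) (simp_all only: gas_factor(2))
  also have "\<dots> = (\<Prod>j\<in>J - I. emeasure (p (i j)) (A j)) * (\<Prod>j\<in>I. emeasure \<nu> (A j))"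
  proof -
    have "emeasure (restrict_space (p l) D) (A j) = emeasure (p l) (A j)" if "j \<in> J" for j l
      using A[OF that] D p by (intro emeasure_restrict_space) (auto simp: sets_restrict_space)
    then show ?thesis
      using assms(1,2) by (simp add: prod.subset_diff[OF \<open>I \<subseteq> J\<close> \<open>finite J\<close>])
  qed
  finally show ?thesis by (simp add: mult.commute)
qed

text \<open>Over counting measure on a finite index set a mixture is a finite sum of measures, so
  the general integration results apply to such sums.\<close>

lemma emeasure_gas_mixture:
  assumes "finite J" "A \<in> sets (tuple_space D J)"
  shows "emeasure (mixture (count_space (gas_index J N)) (tuple_space D J) (\<lambda>(I, i). gas_product \<nu> p D J I i)) A =
    (\<Sum>(I, i)\<in>gas_index J N. emeasure (gas_product \<nu> p D J I i) A)"
  using assms finite_gas_index[OF assms(1), of N]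
  by (subst emeasure_mixture)
    (auto simp: sets_gas_product nn_integral_count_space_finite split_beta)

text \<open>The measures on the right of (a) are assembled on tuples in \<open>C\<close>, later the
  closure of \<open>D\<close>, because the dual semigroup also charges the boundary. Cutting down to
  tuples in \<open>D\<close> turns each transition law into its restriction. Of the semigroup only
  the expansion of \<open>\<delta>\<close> over injections enters.\<close>

lemma restrict_merge_eq_gas_mixture:
  assumes J: "finite J" "I \<subseteq> J" and C: "C \<in> sets borel" "D \<subseteq> C"
    and sets_\<delta>: "sets \<delta> = sets (tuple_space C (J - I))"
    and \<delta>: "\<And>A. A \<in> sets (tuple_space C (J - I)) \<Longrightarrow> emeasure \<delta> A =
        (\<Sum>i | i \<in> J - I \<rightarrow>\<^sub>E {1..N} \<and> inj_on i (J - I). emeasure (PiM (J - I) (\<lambda>j. p (i j))) A)"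
  shows "restrict_space (distr (PiM I (\<lambda>_. \<nu>) \<Otimes>\<^sub>M \<delta>) (tuple_space C J) (merge I (J - I))) (J \<rightarrow>\<^sub>E D) =
    mixture (count_space {i. i \<in> J - I \<rightarrow>\<^sub>E {1..N} \<and> inj_on i (J - I)}) (tuple_space D J) (\<lambda>i. gas_product \<nu> p D J I i)"
    (is "restrict_space (distr ?P _ _) _ = mixture (count_space ?I) _ _")
proof (rule measure_eqI_tuple_space[OF J(1)])
  let ?K = "J - I"
  have fin: "finite I" "finite ?K" using J by (auto intro: finite_subset)
  have finI: "finite ?I" using finite_inj_on_PiE[OF fin(2), of "{1..N}"] by simp
  have prob: "prob_space (PiM ?K (\<lambda>j. p (i j)))" for i by (intro prob_space_PiM p)
  have "finite_measure \<delta>"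
  proof (rule finite_measureI)
    show "emeasure \<delta> (space \<delta>) \<noteq> \<infinity>"
      using finI sets.top[of \<delta>] finite_measure.emeasure_finite[OF prob_space.finite_measure[OF prob]]
      by (simp add: sets_\<delta> \<delta>)
  qed
  then interpret \<delta>: finite_measure \<delta> .
  interpret \<nu>: product_sigma_finite "\<lambda>_. \<nu>"
    using fin_\<nu> by (simp add: product_sigma_finite_def finite_measure.sigma_finite_measure)
  have sets_P: "sets ?P = sets (tuple_space D I \<Otimes>\<^sub>M tuple_space C ?K)"
    using sets_\<nu> sets_\<delta> by (intro sets_pair_measure_cong sets_PiM_restrict_borel)
  \<comment> \<open>The reservoir coordinates live on \<open>D\<close> and are embedded into
    \<open>C\<close> by the identity, so that \<open>merge\<close> acts between tuple spaces over
    the same set.\<close>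
  have "(\<lambda>w. (fst w, snd w)) \<in> tuple_space D I \<Otimes>\<^sub>M tuple_space C ?K \<rightarrow>\<^sub>M tuple_space C I \<Otimes>\<^sub>M tuple_space C ?K"
    by (intro measurable_Pair measurable_compose[OF measurable_fst measurable_id_tuple_space] measurable_snd C)
  moreover have "merge I ?K \<in> tuple_space C I \<Otimes>\<^sub>M tuple_space C ?K \<rightarrow>\<^sub>M tuple_space C J"
    using measurable_merge[of I ?K "\<lambda>_. restrict_space borel C"] J(2) by (simp add: tuple_space_def Un_absorb1)
  ultimately have "merge I ?K \<in> tuple_space D I \<Otimes>\<^sub>M tuple_space C ?K \<rightarrow>\<^sub>M tuple_space C J"
    using measurable_compose[of "\<lambda>w. (fst w, snd w)"] by simp
  then have merge: "merge I ?K \<in> ?P \<rightarrow>\<^sub>M tuple_space C J"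
    using measurable_cong_sets[OF sets_P refl] by blast
  let ?d = "distr ?P (tuple_space C J) (merge I ?K)"
  have sets_d: "sets (restrict_space ?d (J \<rightarrow>\<^sub>E D)) = sets (tuple_space D J)"
    using sets_restrict_space_tuple_space[OF C(2), of J] by (simp add: sets_restrict_space)
  then show "sets (restrict_space ?d (J \<rightarrow>\<^sub>E D)) = sets (tuple_space D J)" .
  have eq: "emeasure (restrict_space ?d (J \<rightarrow>\<^sub>E D)) (Pi\<^sub>E J A) = (\<Sum>i\<in>?I. emeasure (gas_product \<nu> p D J I i) (Pi\<^sub>E J A))"
    if A: "\<And>j. j \<in> J \<Longrightarrow> A j \<in> sets (restrict_space borel D)" for A
  proof -
    have A': "A j \<in> sets borel" "A j \<subseteq> D" "A j \<in> sets \<nu>" if "j \<in> J" for j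
      using A[OF that] D sets_\<nu> by (auto simp: sets_restrict_space)
    have PC: "Pi\<^sub>E L A \<in> sets (tuple_space C L)" if "L \<subseteq> J" for L
    proof (rule PiE_in_sets_tuple_space)
      show "finite L" using that J(1) by (rule finite_subset)
    qed (use that A' C in blast)+
    have DC: "(J \<rightarrow>\<^sub>E D) \<inter> space ?d \<in> sets ?d"
      using C D J by (auto intro!: sets.Int PiE_in_sets_tuple_space)
    have "emeasure (restrict_space ?d (J \<rightarrow>\<^sub>E D)) (Pi\<^sub>E J A) = emeasure ?d (Pi\<^sub>E J A)"
      using DC A' by (intro emeasure_restrict_space) (auto intro!: PiE_mono)
    also have "\<dots> = emeasure ?P (merge I ?K -` Pi\<^sub>E J A \<inter> space ?P)"
      using merge PC by (intro emeasure_distr) auto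
    \<comment> \<open>The index sets are disjoint, so the preimage of a rectangle is a product of
      two rectangles and its mass factorises.\<close>
    also have "merge I ?K -` Pi\<^sub>E J A \<inter> space ?P = Pi\<^sub>E I A \<times> Pi\<^sub>E ?K A"
    proof -
      have "space ?P = (I \<rightarrow>\<^sub>E D) \<times> (?K \<rightarrow>\<^sub>E C)"
        using sets_eq_imp_space_eq[OF sets_P] by (simp add: space_pair_measure)
      moreover have "merge I ?K (z, v) \<in> Pi\<^sub>E J A \<longleftrightarrow> z \<in> Pi\<^sub>E I A \<and> v \<in> Pi\<^sub>E ?K A"
        if "z \<in> I \<rightarrow>\<^sub>E D" "v \<in> ?K \<rightarrow>\<^sub>E C" for z v
      proof
        assume *: "merge I ?K (z, v) \<in> Pi\<^sub>E J A"
        have "z j \<in> A j" if "j \<in> I" for j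
          using PiE_mem[OF *, of j] that J(2) by (auto simp: merge_def)
        moreover have "v j \<in> A j" if "j \<in> ?K" for j
          using PiE_mem[OF *, of j] that by (auto simp: merge_def)
        ultimately show "z \<in> Pi\<^sub>E I A \<and> v \<in> Pi\<^sub>E ?K A"
          using that by (simp add: PiE_iff)
      next
        assume "z \<in> Pi\<^sub>E I A \<and> v \<in> Pi\<^sub>E ?K A"
        then show "merge I ?K (z, v) \<in> Pi\<^sub>E J A"
          using J(2) by (auto simp: merge_def PiE_iff extensional_def)
      qed
      moreover have "Pi\<^sub>E I A \<subseteq> I \<rightarrow>\<^sub>E D" "Pi\<^sub>E ?K A \<subseteq> ?K \<rightarrow>\<^sub>E C"
        using A'(2) J(2) C(2) by (intro PiE_mono, blast)+
      ultimately have "w \<in> merge I ?K -` Pi\<^sub>E J A \<inter> space ?P \<longleftrightarrow> w \<in> Pi\<^sub>E I A \<times> Pi\<^sub>E ?K A" for w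
        by (cases w) (simp add: subset_iff, metis)
      then show ?thesis by (rule set_eqI)
    qed
    also have "emeasure ?P (Pi\<^sub>E I A \<times> Pi\<^sub>E ?K A) = emeasure (PiM I (\<lambda>_. \<nu>)) (Pi\<^sub>E I A) * emeasure \<delta> (Pi\<^sub>E ?K A)"
      using PC[of ?K] A' J fin by (intro \<delta>.emeasure_pair_measure_Times sets_PiM_I_finite) (auto simp: sets_\<delta>)
    also have "emeasure (PiM I (\<lambda>_. \<nu>)) (Pi\<^sub>E I A) = (\<Prod>j\<in>I. emeasure \<nu> (A j))"
      using A' J fin by (intro \<nu>.emeasure_PiM) auto
    also have "emeasure \<delta> (Pi\<^sub>E ?K A) = (\<Sum>i\<in>?I. \<Prod>j\<in>?K. emeasure (p (i j)) (A j))"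
    proof -
      have "emeasure (PiM ?K (\<lambda>j. p (i j))) (Pi\<^sub>E ?K A) = (\<Prod>j\<in>?K. emeasure (p (i j)) (A j))" for i
      proof -
        interpret product_sigma_finite "\<lambda>j. p (i j)"
          using p(1) by (simp add: product_sigma_finite_def prob_space_imp_sigma_finite)
        show ?thesis using A' p(2) fin by (intro emeasure_PiM) auto
      qed
      then show ?thesis using PC[of ?K] by (simp add: \<delta>)
    qed
    finally show ?thesis
      using emeasure_gas_product[OF J A] by (simp add: sum_distrib_left)
  qed
  have mix: "emeasure (mixture (count_space ?I) (tuple_space D J) (\<lambda>i. gas_product \<nu> p D J I i)) B =
      (\<Sum>i\<in>?I. emeasure (gas_product \<nu> p D J I i) B)" if "B \<in> sets (tuple_space D J)" for B
    using that finI
    by (subst emeasure_mixture) (auto simp: sets_gas_product nn_integral_count_space_finite)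
  show "emeasure (restrict_space ?d (J \<rightarrow>\<^sub>E D)) (Pi\<^sub>E J A) =
      emeasure (mixture (count_space ?I) (tuple_space D J) (\<lambda>i. gas_product \<nu> p D J I i)) (Pi\<^sub>E J A)"
    if A: "\<And>j. j \<in> J \<Longrightarrow> A j \<in> sets (restrict_space borel D)" for A
    using eq[OF A] mix[of "Pi\<^sub>E J A"] A J by (auto simp: tuple_space_def intro!: sets_PiM_I_finite)
  have "emeasure (restrict_space ?d (J \<rightarrow>\<^sub>E D)) (J \<rightarrow>\<^sub>E D) = (\<Sum>i\<in>?I. emeasure (gas_product \<nu> p D J I i) (J \<rightarrow>\<^sub>E D))"
    using eq[of "\<lambda>_. D"] sets.top[of "restrict_space borel D"] by (simp add: space_restrict_space)
  also have "\<dots> \<noteq> \<infinity>"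
    using finite_measure.emeasure_finite[OF finite_measure_gas_product[OF J(1)]] finI by simp
  finally show "emeasure (restrict_space ?d (J \<rightarrow>\<^sub>E D)) (J \<rightarrow>\<^sub>E D) \<noteq> \<infinity>" .
qed simp

section \<open>Symmetric integrands and the binomial coefficients\<close>

lemma integral_gas_product_permutes:
  fixes f :: "(nat \<Rightarrow> 'a) \<Rightarrow> real"
  assumes J: "finite J" and \<pi>: "\<pi> permutes J" and f: "f \<in> borel_measurable (tuple_space D J)"
    "\<And>z. z \<in> J \<rightarrow>\<^sub>E D \<Longrightarrow> f (z \<circ> \<pi>) = f z"
  shows "(\<integral>z. f z \<partial>gas_product \<nu> p D J I (restrict (i \<circ> \<pi>) (J - I))) = (\<integral>z. f z \<partial>gas_product \<nu> p D J (\<pi> ` I) i)"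
proof -
  let ?M = "\<lambda>j. if j \<in> \<pi> ` I then \<nu> else restrict_space (p (i j)) D"
  have \<pi>': "\<pi> j \<in> \<pi> ` I \<longleftrightarrow> j \<in> I" for j using permutes_inj[OF \<pi>] by (auto simp: inj_def)
  have sets_N: "sets (PiM J (\<lambda>j. ?M (\<pi> j))) = sets (tuple_space D J)"
    by (rule sets_PiM_restrict_borel) (rule gas_factor(2))
  \<comment> \<open>The factor at \<open>j\<close> on the left is the factor at
    \<open>\<pi> j\<close> of the product whose reservoir set is the image of \<open>I\<close>, so
    the two products differ only by a relabelling of coordinates, which \<open>f\<close> does not
    notice.\<close>
  have "gas_product \<nu> p D J I (restrict (i \<circ> \<pi>) (J - I)) = PiM J (\<lambda>j. ?M (\<pi> j))"
    unfolding gas_product_def by (intro PiM_cong refl) (simp add: \<pi>')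
  also have "\<dots> = distr (PiM J ?M) (PiM J (\<lambda>j. ?M (\<pi> j))) (\<lambda>z. z \<circ> \<pi>)"
    by (intro distr_PiM_permutes[symmetric] J \<pi> finite_measure.sigma_finite_measure gas_factor(1))
  finally have eq: "gas_product \<nu> p D J I (restrict (i \<circ> \<pi>) (J - I)) =
      distr (PiM J ?M) (PiM J (\<lambda>j. ?M (\<pi> j))) (\<lambda>z. z \<circ> \<pi>)" .
  have sets_M: "sets (PiM J ?M) = sets (tuple_space D J)"
    by (rule sets_PiM_restrict_borel) (rule gas_factor(2))
  have meas: "(\<lambda>z. z \<circ> \<pi>) \<in> PiM J ?M \<rightarrow>\<^sub>M PiM J (\<lambda>j. ?M (\<pi> j))"
  proof (rule measurable_PiM_single')
    fix j assume "j \<in> J"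
    then have "\<pi> j \<in> J" using \<pi> by (simp add: permutes_in_image)
    from measurable_component_singleton[OF this, of ?M]
    show "(\<lambda>z. (z \<circ> \<pi>) j) \<in> PiM J ?M \<rightarrow>\<^sub>M ?M (\<pi> j)" by (simp add: comp_def)
  qed (use \<pi> in \<open>auto simp: space_PiM PiE_iff extensional_def permutes_in_image permutes_not_in\<close>)
  have "(\<integral>z. f z \<partial>gas_product \<nu> p D J I (restrict (i \<circ> \<pi>) (J - I))) = (\<integral>z. f (z \<circ> \<pi>) \<partial>PiM J ?M)"
    unfolding eq
  proof (rule integral_distr[OF meas])
    show "f \<in> borel_measurable (PiM J (\<lambda>j. ?M (\<pi> j)))"
      using f(1) measurable_cong_sets[OF sets_N refl] by blast
  qed
  also have "\<dots> = (\<integral>z. f z \<partial>gas_product \<nu> p D J (\<pi> ` I) i)"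
    unfolding gas_product_def
    using f(2) sets_eq_imp_space_eq[OF sets_M] by (intro Bochner_Integration.integral_cong refl) simp
  finally show ?thesis .
qed

text \<open>Composition with a permutation that takes \<open>I'\<close> to \<open>I\<close> carries
  the injections on \<open>J - I\<close> bijectively to those on \<open>J - I'\<close>, and symmetry
  of \<open>f\<close> equates the corresponding integrals.\<close>

lemma sum_integral_gas_product_eq:
  fixes f :: "(nat \<Rightarrow> 'a) \<Rightarrow> real"
  assumes J: "finite J" "I \<subseteq> J" "I' \<subseteq> J" "card I = card I'" and f: "f \<in> borel_measurable (tuple_space D J)"
    "\<And>z \<pi>. \<pi> permutes J \<Longrightarrow> z \<in> J \<rightarrow>\<^sub>E D \<Longrightarrow> f (z \<circ> \<pi>) = f z"
  shows "(\<Sum>i | i \<in> J - I \<rightarrow>\<^sub>E {1..N} \<and> inj_on i (J - I). \<integral>z. f z \<partial>gas_product \<nu> p D J I i) =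
    (\<Sum>i | i \<in> J - I' \<rightarrow>\<^sub>E {1..N} \<and> inj_on i (J - I'). \<integral>z. f z \<partial>gas_product \<nu> p D J I' i)"
proof -
  obtain \<pi> where \<pi>: "\<pi> permutes J" "\<pi> ` I' = I" using ex_permutes_image[OF J] .
  have inv: "\<pi> (inv \<pi> j) = j" "inv \<pi> (\<pi> j) = j" for j using \<pi>(1) by (simp_all add: permutes_inverses)
  have mem: "\<pi> j \<in> J - I \<longleftrightarrow> j \<in> J - I'" for j
    unfolding \<pi>(2)[symmetric]
    by (simp add: inj_image_mem_iff[OF permutes_inj[OF \<pi>(1)]] permutes_in_image[OF \<pi>(1)])
  have mem': "inv \<pi> j \<in> J - I' \<longleftrightarrow> j \<in> J - I" for j using mem[of "inv \<pi> j"] inv(1) by simp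
  have inj: "inj \<pi>" "inj (inv \<pi>)" using permutes_inj[OF \<pi>(1)] permutes_inj[OF permutes_inv[OF \<pi>(1)]] by auto
  show ?thesis
  proof (rule sum.reindex_bij_witness[where j = "\<lambda>i. restrict (i \<circ> \<pi>) (J - I')" and i = "\<lambda>i. restrict (i \<circ> inv \<pi>) (J - I)"])
    fix i assume i: "i \<in> {i. i \<in> J - I \<rightarrow>\<^sub>E {1..N} \<and> inj_on i (J - I)}"
    show "restrict (restrict (i \<circ> \<pi>) (J - I') \<circ> inv \<pi>) (J - I) = i"
    proof
      fix j
      show "restrict (restrict (i \<circ> \<pi>) (J - I') \<circ> inv \<pi>) (J - I) j = i j"
        using i mem'[of j] inv by (cases "j \<in> J - I") (auto simp: PiE_iff extensional_def)
    qed
    have "inj_on (i \<circ> \<pi>) (J - I')"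
    proof (rule comp_inj_on)
      show "inj_on \<pi> (J - I')" using inj(1) by (rule inj_on_subset) simp
      show "inj_on i (\<pi> ` (J - I'))" by (rule inj_on_subset[of i "J - I"]) (use i mem in blast)+
    qed
    then show "restrict (i \<circ> \<pi>) (J - I') \<in> {i. i \<in> J - I' \<rightarrow>\<^sub>E {1..N} \<and> inj_on i (J - I')}"
      using i mem by (auto simp: PiE_iff)
    show "(\<integral>z. f z \<partial>gas_product \<nu> p D J I' (restrict (i \<circ> \<pi>) (J - I'))) = (\<integral>z. f z \<partial>gas_product \<nu> p D J I i)"
      using integral_gas_product_permutes[OF J(1) \<pi>(1) f(1) f(2)[OF \<pi>(1)], of I' i] \<pi>(2) by simp
  next
    fix i assume i: "i \<in> {i. i \<in> J - I' \<rightarrow>\<^sub>E {1..N} \<and> inj_on i (J - I')}"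
    show "restrict (restrict (i \<circ> inv \<pi>) (J - I) \<circ> \<pi>) (J - I') = i"
    proof
      fix j
      show "restrict (restrict (i \<circ> inv \<pi>) (J - I) \<circ> \<pi>) (J - I') j = i j"
        using i mem[of j] inv by (cases "j \<in> J - I'") (auto simp: PiE_iff extensional_def)
    qed
    have "inj_on (i \<circ> inv \<pi>) (J - I)"
    proof (rule comp_inj_on)
      show "inj_on (inv \<pi>) (J - I)" using inj(2) by (rule inj_on_subset) simp
      show "inj_on i (inv \<pi> ` (J - I))" by (rule inj_on_subset[of i "J - I'"]) (use i mem' in blast)+
    qed
    then show "restrict (i \<circ> inv \<pi>) (J - I) \<in> {i. i \<in> J - I \<rightarrow>\<^sub>E {1..N} \<and> inj_on i (J - I)}"
      using i mem' by (auto simp: PiE_iff)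
  qed
qed

text \<open>Grouping the sets \<open>I\<close> by size leaves one representative per size, repeated
  as often as there are subsets of that size. The representative \<open>{1..k}\<close> matches the
  formula in (a), where the first \<open>k\<close> coordinates come from the reservoir.\<close>

lemma sum_integral_gas_product_binomial:
  fixes f :: "(nat \<Rightarrow> 'a) \<Rightarrow> real"
  assumes f: "f \<in> borel_measurable (tuple_space D {1..n})"
    "\<And>z \<pi>. \<pi> permutes {1..n} \<Longrightarrow> z \<in> {1..n} \<rightarrow>\<^sub>E D \<Longrightarrow> f (z \<circ> \<pi>) = f z"
  shows "(\<Sum>(I, i)\<in>gas_index {1..n} N. \<integral>z. f z \<partial>gas_product \<nu> p D {1..n} I i) =
    (\<Sum>k=0..n. real (n choose k) * (\<Sum>i | i \<in> {1..n} - {1..k} \<rightarrow>\<^sub>E {1..N} \<and> inj_on i ({1..n} - {1..k}).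
      \<integral>z. f z \<partial>gas_product \<nu> p D {1..n} {1..k} i))"
proof -
  let ?T = "\<lambda>I. \<Sum>i | i \<in> {1..n} - I \<rightarrow>\<^sub>E {1..N} \<and> inj_on i ({1..n} - I). \<integral>z. f z \<partial>gas_product \<nu> p D {1..n} I i"
  have "(\<Sum>(I, i)\<in>gas_index {1..n} N. \<integral>z. f z \<partial>gas_product \<nu> p D {1..n} I i) = (\<Sum>I\<in>Pow {1..n}. ?T I)"
    by (rule sum_gas_index) simp
  also have "\<dots> = (\<Sum>k\<in>{0..n}. \<Sum>I\<in>{I\<in>Pow {1..n}. card I = k}. ?T I)"
    using card_mono[of "{1..n}"] by (intro sum.group[symmetric]) auto
  also have "\<dots> = (\<Sum>k=0..n. real (n choose k) * ?T {1..k})"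
  proof (intro sum.cong refl)
    fix k assume k: "k \<in> {0..n}"
    have "(\<Sum>I\<in>{I\<in>Pow {1..n}. card I = k}. ?T I) = (\<Sum>I\<in>{I\<in>Pow {1..n}. card I = k}. ?T {1..k})"
    proof (rule sum.cong[OF refl])
      fix I assume I: "I \<in> {I\<in>Pow {1..n}. card I = k}"
      show "?T I = ?T {1..k}"
        by (rule sum_integral_gas_product_eq[OF _ _ _ _ f]) (use I k in simp_all)
    qed
    then show "(\<Sum>I\<in>{I\<in>Pow {1..n}. card I = k}. ?T I) = real (n choose k) * ?T {1..k}"
      using n_subsets[of "{1..n}" k] by simp
  qed
  finally show ?thesis .
qed

lemma finite_measure_gas_mixture:
  assumes "finite J"
  shows "finite_measure (mixture (count_space (gas_index J N)) (tuple_space D J) (\<lambda>(I, i). gas_product \<nu> p D J I i))"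
proof (rule finite_measureI)
  have "(\<Sum>(I, i)\<in>gas_index J N. emeasure (gas_product \<nu> p D J I i) (J \<rightarrow>\<^sub>E D)) \<noteq> \<infinity>"
    using finite_measure.emeasure_finite[OF finite_measure_gas_product[OF assms]] finite_gas_index[OF assms, of N]
    by (auto simp: split_beta)
  then show "emeasure (mixture (count_space (gas_index J N)) (tuple_space D J) (\<lambda>(I, i). gas_product \<nu> p D J I i))
      (space (mixture (count_space (gas_index J N)) (tuple_space D J) (\<lambda>(I, i). gas_product \<nu> p D J I i))) \<noteq> \<infinity>"
    using emeasure_gas_mixture[OF assms sets.top, of N] by simp
qed

lemma integral_gas_mixture:
  fixes f :: "(nat \<Rightarrow> 'a) \<Rightarrow> real"
  assumes J: "finite J" and f: "f \<in> borel_measurable (tuple_space D J)" "\<And>z. z \<in> J \<rightarrow>\<^sub>E D \<Longrightarrow> \<bar>f z\<bar> \<le> C"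
  shows "(\<integral>z. f z \<partial>mixture (count_space (gas_index J N)) (tuple_space D J) (\<lambda>(I, i). gas_product \<nu> p D J I i)) =
    (\<Sum>(I, i)\<in>gas_index J N. \<integral>z. f z \<partial>gas_product \<nu> p D J I i)"
proof -
  have "(\<integral>z. f z \<partial>mixture (count_space (gas_index J N)) (tuple_space D J) (\<lambda>(I, i). gas_product \<nu> p D J I i)) =
      (\<integral>a. \<integral>z. f z \<partial>(case a of (I, i) \<Rightarrow> gas_product \<nu> p D J I i) \<partial>count_space (gas_index J N))"
    using f finite_measure_gas_mixture[OF J] finite_measure_gas_product[OF J]
    by (intro integral_mixture[where C = C]) (auto simp: sets_gas_product split: prod.split)
  then show ?thesis
    by (simp add: lebesgue_integral_count_space_finite[OF finite_gas_index[OF J]] split_beta)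
qed

text \<open>Integrating over the tuples in \<open>D\<close> is integrating against the restricted
  measure, which has been identified as a finite mixture.\<close>

lemma integral_restrict_merge:
  fixes f :: "(nat \<Rightarrow> 'a) \<Rightarrow> real"
  assumes J: "finite J" "I \<subseteq> J" and C: "C \<in> sets borel" "D \<subseteq> C"
    and sets_\<delta>: "sets \<delta> = sets (tuple_space C (J - I))"
    and \<delta>: "\<And>A. A \<in> sets (tuple_space C (J - I)) \<Longrightarrow> emeasure \<delta> A =
        (\<Sum>i | i \<in> J - I \<rightarrow>\<^sub>E {1..N} \<and> inj_on i (J - I). emeasure (PiM (J - I) (\<lambda>j. p (i j))) A)"
    and f: "f \<in> borel_measurable (tuple_space D J)" "\<And>z. z \<in> J \<rightarrow>\<^sub>E D \<Longrightarrow> \<bar>f z\<bar> \<le> B"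
  shows "(LINT z : J \<rightarrow>\<^sub>E D | distr (PiM I (\<lambda>_. \<nu>) \<Otimes>\<^sub>M \<delta>) (tuple_space C J) (merge I (J - I)). f z) =
    (\<Sum>i | i \<in> J - I \<rightarrow>\<^sub>E {1..N} \<and> inj_on i (J - I). \<integral>z. f z \<partial>gas_product \<nu> p D J I i)"
proof -
  let ?I = "{i. i \<in> J - I \<rightarrow>\<^sub>E {1..N} \<and> inj_on i (J - I)}"
  let ?d = "distr (PiM I (\<lambda>_. \<nu>) \<Otimes>\<^sub>M \<delta>) (tuple_space C J) (merge I (J - I))"
  let ?X = "mixture (count_space ?I) (tuple_space D J) (\<lambda>i. gas_product \<nu> p D J I i)"
  have finI: "finite ?I" using finite_inj_on_PiE[of "J - I" "{1..N}"] J by simp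
  have "(J \<rightarrow>\<^sub>E D) \<inter> space ?d \<in> sets ?d"
    using C D J by (auto intro!: sets.Int PiE_in_sets_tuple_space)
  then have "(LINT z : J \<rightarrow>\<^sub>E D | ?d. f z) = (\<integral>z. f z \<partial>restrict_space ?d (J \<rightarrow>\<^sub>E D))"
    unfolding set_lebesgue_integral_def by (rule integral_restrict_space[symmetric])
  also have "\<dots> = (\<integral>z. f z \<partial>?X)"
    by (simp only: restrict_merge_eq_gas_mixture[OF J C sets_\<delta> \<delta>])
  also have "\<dots> = (\<integral>i. \<integral>z. f z \<partial>gas_product \<nu> p D J I i \<partial>count_space ?I)"
  proof (rule integral_mixture[where C = B])
    have "emeasure ?X (J \<rightarrow>\<^sub>E D) = (\<Sum>i\<in>?I. emeasure (gas_product \<nu> p D J I i) (J \<rightarrow>\<^sub>E D))"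
      using finI sets.top[of "tuple_space D J"]
      by (subst emeasure_mixture) (auto simp: sets_gas_product nn_integral_count_space_finite)
    also have "\<dots> \<noteq> \<infinity>"
      using finite_measure.emeasure_finite[OF finite_measure_gas_product[OF J(1)]] finI by simp
    finally show "finite_measure ?X" by (intro finite_measureI) simp
  qed (use f finite_measure_gas_product[OF J(1)] in \<open>auto simp: sets_gas_product\<close>)
  also have "\<dots> = (\<Sum>i\<in>?I. \<integral>z. f z \<partial>gas_product \<nu> p D J I i)"
    by (rule lebesgue_integral_count_space_finite[OF finI])
  finally show ?thesis .
qed

text \<open>A product of measures with densities has the product of the densities, and a finite sum
  of measures has their sum. Densities are given only for the labels in \<open>{1..N}\<close>, so
  each use of \<open>q\<close> must come with a label known to lie there.\<close>

lemma
  assumes J: "finite J" and m: "sets m = sets (restrict_space borel D)" "finite_measure m"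
    and g: "g \<in> borel_measurable m" "\<nu> = density m g"
    and q: "\<And>l. l \<in> {1..N} \<Longrightarrow> q l \<in> borel_measurable m" "\<And>l. l \<in> {1..N} \<Longrightarrow> restrict_space (p l) D = density m (q l)"
  shows measurable_gas_density: "gas_density J N g q \<in> borel_measurable (PiM J (\<lambda>_. m))"
    and gas_mixture_eq_density:
      "mixture (count_space (gas_index J N)) (tuple_space D J) (\<lambda>(I, i). gas_product \<nu> p D J I i) =
      density (PiM J (\<lambda>_. m)) (gas_density J N g q)" (is "?X = _")
proof -
  let ?h = "gas_density J N g q"
  \<comment> \<open>The test is membership in \<open>J - fst a\<close> rather than in
    \<open>fst a\<close>: outside \<open>J\<close> nothing places the value of \<open>i\<close> in
    \<open>{1..N}\<close>, and falling back to \<open>g\<close> there gives a measurable finite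
    density at every index, as \<open>PiM_density\<close> demands.\<close>
  let ?f = "\<lambda>a z. \<Prod>j\<in>J. (if j \<in> J - fst a then q (snd a j) else g) (z j)"
  have h: "(if j \<in> J - I then q (i j) else g) \<in> borel_measurable m"
      "finite_measure (density m (if j \<in> J - I then q (i j) else g))"
      "j \<in> J \<Longrightarrow> (if j \<in> I then \<nu> else restrict_space (p (i j)) D) = density m (if j \<in> J - I then q (i j) else g)"
    if "(I, i) \<in> gas_index J N" for I i j
  proof -
    have i: "i j \<in> {1..N}" if "j \<in> J - I" using \<open>(I, i) \<in> gas_index J N\<close> that by (auto simp: gas_index_def PiE_iff)
    show "(if j \<in> J - I then q (i j) else g) \<in> borel_measurable m" using q(1)[OF i] g(1) by simp
    show "finite_measure (density m (if j \<in> J - I then q (i j) else g))"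
      using gas_factor(1)[where j = j and I = "- (J - I)" and l = "i j"] q(2)[OF i] g(2) by (auto split: if_splits)
    show "(if j \<in> I then \<nu> else restrict_space (p (i j)) D) = density m (if j \<in> J - I then q (i j) else g)" if "j \<in> J"
      using that q(2)[OF i] g(2) by auto
  qed
  have f_eq: "?f (I, i) z = (\<Prod>j\<in>I. g (z j)) * (\<Prod>j\<in>J - I. q (i j) (z j))" if "(I, i) \<in> gas_index J N" for I i z
  proof -
    have "I \<subseteq> J" using that by (auto simp: gas_index_def)
    then show ?thesis
      unfolding fst_conv snd_conv
      using prod.subset_diff[OF _ J, of I "\<lambda>j. (if j \<in> J - I then q (i j) else g) (z j)"] by (simp add: mult.commute)
  qed
  have meas: "?f a \<in> borel_measurable (PiM J (\<lambda>_. m))" if "a \<in> gas_index J N" for a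
  proof (rule borel_measurable_prod_ennreal)
    fix j assume "j \<in> J"
    then have "(\<lambda>z. z j) \<in> PiM J (\<lambda>_. m) \<rightarrow>\<^sub>M m" by (rule measurable_component_singleton)
    then show "(\<lambda>z. (if j \<in> J - fst a then q (snd a j) else g) (z j)) \<in> borel_measurable (PiM J (\<lambda>_. m))"
      by (rule measurable_compose) (use h(1)[of "fst a" "snd a" j] that in simp)
  qed
  have sum_f: "(\<Sum>a\<in>gas_index J N. ?f a z) = ?h z" for z
    unfolding gas_density_def using f_eq by (intro sum.cong refl) (auto split: prod.split)
  have "(\<lambda>z. \<Sum>a\<in>gas_index J N. ?f a z) \<in> borel_measurable (PiM J (\<lambda>_. m))"
    using meas by (rule borel_measurable_sum)
  then show h_meas: "?h \<in> borel_measurable (PiM J (\<lambda>_. m))" by (simp only: sum_f)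
  have gas: "gas_product \<nu> p D J I i = density (PiM J (\<lambda>_. m)) (?f (I, i))" if "(I, i) \<in> gas_index J N" for I i
  proof -
    have "gas_product \<nu> p D J I i = PiM J (\<lambda>j. density m (if j \<in> J - I then q (i j) else g))"
      unfolding gas_product_def using h(3)[OF that] by (intro PiM_cong refl)
    also have "\<dots> = density (PiM J (\<lambda>_. m)) (?f (I, i))"
      using h(1,2)[OF that] finite_measure.sigma_finite_measure J m(2) unfolding fst_conv snd_conv
      by (intro PiM_density) blast+
    finally show ?thesis .
  qed
  have sets_m: "sets (PiM J (\<lambda>_. m)) = sets (tuple_space D J)"
    using m(1) by (rule sets_PiM_restrict_borel)
  show "?X = density (PiM J (\<lambda>_. m)) ?h"
  proof (rule measure_eqI)
    fix A assume "A \<in> sets ?X"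
    then have A: "A \<in> sets (tuple_space D J)" "A \<in> sets (PiM J (\<lambda>_. m))" by (simp_all add: sets_m)
    have "emeasure ?X A = (\<Sum>a\<in>gas_index J N. emeasure (case a of (I, i) \<Rightarrow> gas_product \<nu> p D J I i) A)"
      unfolding emeasure_gas_mixture[OF J A(1)] by (simp add: split_beta)
    also have "\<dots> = (\<Sum>a\<in>gas_index J N. \<integral>\<^sup>+z. ?f a z * indicator A z \<partial>PiM J (\<lambda>_. m))"
    proof (rule sum.cong[OF refl])
      fix a assume a: "a \<in> gas_index J N"
      then have "(case a of (I, i) \<Rightarrow> gas_product \<nu> p D J I i) = density (PiM J (\<lambda>_. m)) (?f a)"
        using gas[of "fst a" "snd a"] by (simp only: split_beta prod.collapse)
      then show "emeasure (case a of (I, i) \<Rightarrow> gas_product \<nu> p D J I i) A = (\<integral>\<^sup>+z. ?f a z * indicator A z \<partial>PiM J (\<lambda>_. m))"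
        using meas[OF a] A(2) by (simp only: emeasure_density)
    qed
    also have "\<dots> = (\<integral>\<^sup>+z. (\<Sum>a\<in>gas_index J N. ?f a z * indicator A z) \<partial>PiM J (\<lambda>_. m))"
      using meas A(2) by (intro nn_integral_sum[symmetric] borel_measurable_times_ennreal) auto
    also have "\<dots> = emeasure (density (PiM J (\<lambda>_. m)) ?h) A"
      unfolding emeasure_density[OF h_meas A(2)] sum_distrib_right[symmetric] sum_f ..
    finally show "emeasure ?X A = emeasure (density (PiM J (\<lambda>_. m)) ?h) A" .
  qed (simp add: sets_m)
qed

section \<open>The gas at a fixed time\<close>

context
  fixes Q :: "'v measure" and \<xi> \<Theta> H :: "'v \<Rightarrow> 'a multiset" and N :: nat
  assumes Q: "prob_space Q" and \<Theta>: "poisson_point_process Q \<nu> \<Theta>"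
    and \<xi>: "distr Q config_space \<xi> = distr (PiM {1..N} p) config_space (\<lambda>y. \<Sum>l=1..N. {#y l#})"
    and indep: "prob_space.indep_var Q config_space \<xi> config_space \<Theta>"
    and H: "\<And>\<omega>. \<omega> \<in> space Q \<Longrightarrow> H \<omega> = filter_mset (\<lambda>y. y \<in> D) (\<xi> \<omega>) + \<Theta> \<omega>"
begin

interpretation Q: prob_space Q by (rule Q)

lemma measurable_\<xi>: "\<xi> \<in> Q \<rightarrow>\<^sub>M config_space"
  using indep by (rule Q.indep_var_rv1)

lemma set_mset_gas: "\<omega> \<in> space Q \<Longrightarrow> set_mset (H \<omega>) \<subseteq> D"
  using H poisson_set_mset[OF Q \<Theta> D sets_\<nu> fin_\<nu>] by auto

lemma measurable_gas: "H \<in> Q \<rightarrow>\<^sub>M config_space"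
proof (rule measurable_config_spaceI)
  fix A :: "'a set" assume A: "A \<in> sets borel"
  have "(\<lambda>\<omega>. num_points (A \<inter> D) (\<xi> \<omega>) + num_points A (\<Theta> \<omega>)) \<in> Q \<rightarrow>\<^sub>M count_space UNIV"
    using A D by (intro measurable_add_nat measurable_compose[OF measurable_\<xi> measurable_num_points]
        measurable_compose[OF poisson_measurable[OF Q \<Theta> D sets_\<nu> fin_\<nu>] measurable_num_points]) auto
  then show "(\<lambda>\<omega>. num_points A (H \<omega>)) \<in> Q \<rightarrow>\<^sub>M count_space UNIV"
    by (rule measurable_cong[THEN iffD1, rotated]) (simp add: H)
qed

lemma measurable_emeasure_factorial_measure_gas:
  assumes "finite J" "A \<in> sets (tuple_space D J)"
  shows "(\<lambda>\<omega>. emeasure (factorial_measure D J (H \<omega>)) A) \<in> borel_measurable Q"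
proof -
  have "A \<in> sets (tuple_space UNIV J)"
    using sets_tuple_space_mono[OF assms(1) D _ assms(2)] by simp
  then have "(\<lambda>\<omega>. emeasure (factorial_measure UNIV J (H \<omega>)) A) \<in> borel_measurable Q"
    using measurable_compose[OF measurable_gas measurable_factorial_measure[OF assms(1)]] by simp
  then show ?thesis
    by (rule measurable_cong[THEN iffD1, rotated])
      (simp add: emeasure_factorial_measure_UNIV[OF assms(1) D set_mset_gas assms(2)])
qed

lemma expected_factorial_measure_eq_mixture:
  "expected_factorial_measure Q D J H = mixture Q (tuple_space D J) (\<lambda>\<omega>. factorial_measure D J (H \<omega>))"
  by (simp add: expected_factorial_measure_def mixture_def)

text \<open>The rectangle count of the two superposed configurations splits according to the set
  \<open>I\<close> of indices served by the Poisson part. Independence separates the two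
  expectations, and each is already known in terms of side masses.\<close>

lemma nn_integral_rect_count_gas:
  assumes J: "finite J" and A: "\<And>j. j \<in> J \<Longrightarrow> A j \<in> sets (restrict_space borel D)"
  shows "(\<integral>\<^sup>+\<omega>. of_nat (rect_count J A (H \<omega>)) \<partial>Q) =
    (\<Sum>(I, i)\<in>gas_index J N. emeasure (gas_product \<nu> p D J I i) (Pi\<^sub>E J A))"
proof -
  let ?E = "\<lambda>i. \<lambda>j. emeasure (p (i j)) (A j)"
  have A': "A j \<in> sets borel" "A j \<subseteq> D" "A j \<in> sets \<nu>" if "j \<in> J" for j
    using A[OF that] D sets_\<nu> by (auto simp: sets_restrict_space)
  have fin: "finite I" if "I \<in> Pow J" for I using that J by (auto intro: finite_subset)
  have m: "(\<lambda>c. of_nat (rect_count I A c) :: ennreal) \<in> borel_measurable config_space" if "I \<subseteq> J" for I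
    using that fin A' by (intro measurable_rect_count) auto
  have on_\<xi>: "(\<integral>\<^sup>+\<omega>. of_nat (rect_count I A (\<xi> \<omega>)) \<partial>Q) =
      (\<Sum>i | i \<in> I \<rightarrow>\<^sub>E {1..N} \<and> inj_on i I. \<Prod>j\<in>I. ?E i j)" if "I \<subseteq> J" for I
  proof -
    \<comment> \<open>Only the law of \<open>\<xi>\<close> is prescribed, so the expectation is
      moved to configuration space and evaluated there with independent points of laws
      \<open>p l\<close>.\<close>
    have "(\<integral>\<^sup>+\<omega>. of_nat (rect_count I A (\<xi> \<omega>)) \<partial>Q) = (\<integral>\<^sup>+c. of_nat (rect_count I A c) \<partial>distr Q config_space \<xi>)"
      using m[OF that] measurable_\<xi> by (simp add: nn_integral_distr)
    also have "\<dots> = (\<integral>\<^sup>+y. of_nat (rect_count I A (\<Sum>l=1..N. {#y l#})) \<partial>PiM {1..N} p)"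
      unfolding \<xi>
    proof (rule nn_integral_distr[OF measurable_point_sum])
      show "(\<lambda>y. y l) \<in> PiM {1..N} p \<rightarrow>\<^sub>M borel" if "l \<in> {1..N}" for l
        using measurable_component_singleton[OF that, of p] measurable_cong_sets[OF refl p(2), of "PiM {1..N} p" l] by simp
    qed (use m[OF that] in auto)
    also have "\<dots> = (\<Sum>i | i \<in> I \<rightarrow>\<^sub>E {1..N} \<and> inj_on i I. \<Prod>j\<in>I. ?E i j)"
      using that fin A' p by (intro nn_integral_rect_count_point_sum) auto
    finally show ?thesis .
  qed
  have "rect_count J A (H \<omega>) = (\<Sum>I\<in>Pow J. rect_count (J - I) A (\<xi> \<omega>) * rect_count I A (\<Theta> \<omega>))"
    if "\<omega> \<in> space Q" for \<omega>
    using A' J unfolding H[OF that] rect_count_add[OF J]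
    by (intro sum.cong refl) (subst rect_count_filter, auto)
  then have "(\<integral>\<^sup>+\<omega>. of_nat (rect_count J A (H \<omega>)) \<partial>Q) =
      (\<integral>\<^sup>+\<omega>. (\<Sum>I\<in>Pow J. of_nat (rect_count (J - I) A (\<xi> \<omega>)) * of_nat (rect_count I A (\<Theta> \<omega>))) \<partial>Q)"
    by (intro nn_integral_cong) simp
  also have "\<dots> = (\<Sum>I\<in>Pow J. \<integral>\<^sup>+\<omega>. of_nat (rect_count (J - I) A (\<xi> \<omega>)) * of_nat (rect_count I A (\<Theta> \<omega>)) \<partial>Q)"
  proof (rule nn_integral_sum)
    fix I assume "I \<in> Pow J"
    then show "(\<lambda>\<omega>. of_nat (rect_count (J - I) A (\<xi> \<omega>)) * of_nat (rect_count I A (\<Theta> \<omega>)) :: ennreal) \<in> borel_measurable Q"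
      by (intro borel_measurable_times_ennreal measurable_compose[OF measurable_\<xi> m]
          measurable_compose[OF poisson_measurable[OF Q \<Theta> D sets_\<nu> fin_\<nu>] m]) auto
  qed
  also have "\<dots> = (\<Sum>I\<in>Pow J. \<Sum>i | i \<in> J - I \<rightarrow>\<^sub>E {1..N} \<and> inj_on i (J - I). emeasure (gas_product \<nu> p D J I i) (Pi\<^sub>E J A))"
  proof (intro sum.cong refl)
    fix I assume I: "I \<in> Pow J"
    have "(\<integral>\<^sup>+\<omega>. of_nat (rect_count (J - I) A (\<xi> \<omega>)) * of_nat (rect_count I A (\<Theta> \<omega>)) \<partial>Q) =
        (\<integral>\<^sup>+\<omega>. of_nat (rect_count (J - I) A (\<xi> \<omega>)) \<partial>Q) * (\<integral>\<^sup>+\<omega>. of_nat (rect_count I A (\<Theta> \<omega>)) \<partial>Q)"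
      using I by (intro Q.indep_var_nn_integral[OF indep] m) auto
    also have "\<dots> = (\<Sum>i | i \<in> J - I \<rightarrow>\<^sub>E {1..N} \<and> inj_on i (J - I). \<Prod>j\<in>J - I. ?E i j) * (\<Prod>j\<in>I. emeasure \<nu> (A j))"
      using I A' fin poisson_rect_count[OF Q \<Theta> D sets_\<nu> fin_\<nu>, of I A] on_\<xi>[of "J - I"] by (simp add: subset_iff)
    also have "\<dots> = (\<Sum>i | i \<in> J - I \<rightarrow>\<^sub>E {1..N} \<and> inj_on i (J - I). emeasure (gas_product \<nu> p D J I i) (Pi\<^sub>E J A))"
      using I J A by (simp add: emeasure_gas_product sum_distrib_left mult.commute)
    finally show "(\<integral>\<^sup>+\<omega>. of_nat (rect_count (J - I) A (\<xi> \<omega>)) * of_nat (rect_count I A (\<Theta> \<omega>)) \<partial>Q) =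
      (\<Sum>i | i \<in> J - I \<rightarrow>\<^sub>E {1..N} \<and> inj_on i (J - I). emeasure (gas_product \<nu> p D J I i) (Pi\<^sub>E J A))" .
  qed
  also have "\<dots> = (\<Sum>(I, i)\<in>gas_index J N. emeasure (gas_product \<nu> p D J I i) (Pi\<^sub>E J A))"
    by (rule sum_gas_index[OF J, symmetric])
  finally show ?thesis .
qed

text \<open>Agreement on rectangles suffices because the explicit side has finite mass, which also
  shows that the expected number of tuples is finite.\<close>

lemma expected_factorial_measure_gas:
  assumes J: "finite J"
  shows "expected_factorial_measure Q D J H =
    mixture (count_space (gas_index J N)) (tuple_space D J) (\<lambda>(I, i). gas_product \<nu> p D J I i)" (is "?E = ?M")
proof (rule measure_eqI_tuple_space[OF J])
  have eq: "emeasure ?E (Pi\<^sub>E J A) = emeasure ?M (Pi\<^sub>E J A)"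
    if A: "\<And>j. j \<in> J \<Longrightarrow> A j \<in> sets (restrict_space borel D)" for A
  proof -
    have PA: "Pi\<^sub>E J A \<in> sets (tuple_space D J)"
      using A J by (auto simp: tuple_space_def intro!: sets_PiM_I_finite)
    have "emeasure ?E (Pi\<^sub>E J A) = (\<integral>\<^sup>+\<omega>. emeasure (factorial_measure D J (H \<omega>)) (Pi\<^sub>E J A) \<partial>Q)"
      unfolding expected_factorial_measure_eq_mixture
      using PA measurable_emeasure_factorial_measure_gas[OF J] by (intro emeasure_mixture) auto
    also have "\<dots> = (\<integral>\<^sup>+\<omega>. of_nat (rect_count J A (H \<omega>)) \<partial>Q)"
      using emeasure_factorial_measure_PiE[OF J set_mset_gas A] by (intro nn_integral_cong) simp
    also have "\<dots> = emeasure ?M (Pi\<^sub>E J A)"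
      using nn_integral_rect_count_gas[OF J A] emeasure_gas_mixture[OF J PA] by simp
    finally show ?thesis .
  qed
  then show "emeasure ?E (Pi\<^sub>E J A) = emeasure ?M (Pi\<^sub>E J A)"
    if "\<And>j. j \<in> J \<Longrightarrow> A j \<in> sets (restrict_space borel D)" for A
    using that .
  have "emeasure ?E (J \<rightarrow>\<^sub>E D) = (\<Sum>(I, i)\<in>gas_index J N. emeasure (gas_product \<nu> p D J I i) (J \<rightarrow>\<^sub>E D))"
    using eq[of "\<lambda>_. D"] sets.top[of "restrict_space borel D"] emeasure_gas_mixture[OF J, of "J \<rightarrow>\<^sub>E D" N]
      sets.top[of "tuple_space D J"]
    by (simp add: space_restrict_space)
  also have "\<dots> \<noteq> \<infinity>"
    using finite_measure.emeasure_finite[OF finite_measure_gas_product[OF J]] finite_gas_index[OF J, of N]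
    by (auto simp: split_beta)
  finally show "emeasure ?E (J \<rightarrow>\<^sub>E D) \<noteq> \<infinity>" .
qed (simp_all add: expected_factorial_measure_eq_mixture)

end

end

section \<open>The absorbed diffusion\<close>

text \<open>The density of the reservoir intensity at \<open>z\<close>. Extending \<open>lam\<close>
  by 0 off the frontier lets the transition law at time \<open>t\<close> take the place of the exit
  law, and values in \<open>ennreal\<close> avoid integrability conditions.\<close>

definition boundary_mean ::
    "(real^'d) set \<Rightarrow> (real^'d \<Rightarrow> 'w measure) \<Rightarrow> (real \<Rightarrow> 'w \<Rightarrow> real^'d) \<Rightarrow> (real^'d \<Rightarrow> real) \<Rightarrow> real \<Rightarrow> real^'d \<Rightarrow> ennreal" where
  "boundary_mean D P Y lam t z = (\<integral>\<^sup>+y. ennreal (indicator (frontier D) y * lam y) \<partial>transition_prob D P Y t z)"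

text \<open>If some point is off \<open>F\<close>, the count falls short of \<open>card I\<close>
  and the matching factor on the right vanishes; otherwise the filter removes nothing. This turns
  the absorption functional into a product over the particles.\<close>

lemma prod_mset_filter_point_sum:
  fixes f :: "'a \<Rightarrow> real"
  assumes "finite I"
  shows "(\<Prod>y\<in>#filter_mset (\<lambda>y. y \<in> F) (\<Sum>j\<in>I. {#X j#}). f y) * of_bool (num_points F (\<Sum>j\<in>I. {#X j#}) = card I) =
    (\<Prod>j\<in>I. indicator F (X j) * f (X j))"
proof (cases "\<forall>j\<in>I. X j \<in> F")
  case True
  have "(\<Prod>y\<in>#filter_mset (\<lambda>y. y \<in> F) (\<Sum>j\<in>I. {#X j#}). f y) = (\<Prod>j\<in>I. f (X j))"
    using assms True by (induction I rule: finite_induct) auto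
  moreover have "num_points F (\<Sum>j\<in>I. {#X j#}) = card I"
    using True assms by (simp add: num_points_sum)
  ultimately show ?thesis using True by simp
next
  case False
  then obtain k where k: "k \<in> I" "X k \<notin> F" by blast
  have "num_points F (\<Sum>j\<in>I. {#X j#}) = card {j\<in>I. X j \<in> F}"
    using assms by (simp add: num_points_sum Int_def)
  also have "\<dots> < card I"
    using k assms by (intro psubset_card_mono) auto
  finally have "num_points F (\<Sum>j\<in>I. {#X j#}) \<noteq> card I" by simp
  moreover have "(\<Prod>j\<in>I. indicator F (X j) * f (X j)) = 0"
    using k assms by (intro prod_zero) (auto intro!: bexI[of _ k])
  ultimately show ?thesis by simp
qed

section \<open>Hitting time and stopped path\<close>

lemma hitting_time_cases:
  fixes Y :: "real \<Rightarrow> 'w \<Rightarrow> real^'d"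
  assumes cont: "continuous_on {0..} (\<lambda>t. Y t \<omega>)"
  obtains "hitting_time D Y \<omega> = \<infinity>" "\<And>s. 0 \<le> s \<Longrightarrow> Y s \<omega> \<notin> frontier D"
  | r where "0 \<le> r" "hitting_time D Y \<omega> = ereal r" "Y r \<omega> \<in> frontier D"
      "\<And>s. 0 \<le> s \<Longrightarrow> s < r \<Longrightarrow> Y s \<omega> \<notin> frontier D"
proof -
  define Z where "Z = {t. 0 \<le> t \<and> Y t \<omega> \<in> frontier D}"
  have hit: "hitting_time D Y \<omega> = (INF t\<in>Z. ereal t)" by (simp add: hitting_time_def Z_def)
  show thesis
  proof (cases "Z = {}")
    case True
    show thesis
    proof (rule that(1))
      show "hitting_time D Y \<omega> = \<infinity>" by (simp add: hit True top_ereal_def)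
    qed (use True in \<open>auto simp: Z_def\<close>)
  next
    case False
    \<comment> \<open>Continuity of the path and closedness of the frontier make \<open>Z\<close>
      closed, so the infimum, when \<open>Z\<close> is nonempty, is a time at which the frontier is
      actually reached.\<close>
    have "Z = {0..} \<inter> (\<lambda>t. Y t \<omega>) -` frontier D" by (auto simp: Z_def)
    then have "closed Z"
      using continuous_closed_preimage[OF cont, of "frontier D"] by simp
    moreover have bdd: "bdd_below Z" by (auto simp: Z_def intro: bdd_belowI[of _ 0])
    ultimately have "Inf Z \<in> Z" using False by (intro closed_contains_Inf)
    moreover have "hitting_time D Y \<omega> = ereal (Inf Z)"
      unfolding hit using bdd False by (rule ereal_Inf'[symmetric])
    moreover have "Y s \<omega> \<notin> frontier D" if "0 \<le> s" "s < Inf Z" for s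
      using that cInf_lower[OF _ bdd, of s] by (auto simp: Z_def)
    ultimately show thesis using that(2)[of "Inf Z"] by (auto simp: Z_def)
  qed
qed

lemma hitting_time_nonneg: "0 \<le> hitting_time D Y \<omega>"
  by (auto simp: hitting_time_def intro!: INF_greatest)

context
  fixes Y :: "real \<Rightarrow> 'w \<Rightarrow> real^'d" and M :: "'w measure"
  assumes Y: "\<And>t. 0 \<le> t \<Longrightarrow> Y t \<in> M \<rightarrow>\<^sub>M borel"
    and cont: "\<And>\<omega>. \<omega> \<in> space M \<Longrightarrow> continuous_on {0..} (\<lambda>t. Y t \<omega>)"
begin

text \<open>The path is frozen at its first frontier point, so being on the frontier at time
  \<open>t\<close> records a hit at any earlier time.\<close>

lemma absorbed_in_frontier_iff:
  assumes "\<omega> \<in> space M" "0 \<le> t"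
  shows "absorbed D Y t \<omega> \<in> frontier D \<longleftrightarrow> hitting_time D Y \<omega> \<le> ereal t"
  using hitting_time_cases[of Y \<omega> D, OF cont[OF assms(1)]]
proof cases
  case 1
  then show ?thesis using assms(2) by (simp add: absorbed_def min_def)
next
  case (2 r)
  then show ?thesis using assms(2) 2(4)[of t] by (cases "r \<le> t") (auto simp: absorbed_def min_def)
qed

lemma absorbed_hitting_time:
  assumes "\<omega> \<in> space M" "hitting_time D Y \<omega> \<le> ereal t"
  shows "absorbed D Y (real_of_ereal (hitting_time D Y \<omega>)) \<omega> = absorbed D Y t \<omega>"
  using hitting_time_cases[of Y \<omega> D, OF cont[OF assms(1)]]
proof cases
  case 1
  then show ?thesis using assms(2) by simp
next
  case (2 r)
  then show ?thesis using assms(2) by (simp add: absorbed_def min_def)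
qed

text \<open>The continuous distance to the frontier attains its minimum on the compact interval, so
  the frontier is reached iff the distance gets arbitrarily small, which a dense set of times
  detects. The empty frontier is excluded because \<open>infdist\<close> to the empty set is
  0.\<close>

lemma hitting_time_le_iff_infdist:
  assumes \<omega>: "\<omega> \<in> space M" and u: "0 \<le> u" and F: "frontier D \<noteq> {}"
    and T: "T \<subseteq> {0..u}" "{0..u} \<subseteq> closure T"
  shows "hitting_time D Y \<omega> \<le> ereal u \<longleftrightarrow> (\<forall>k. \<exists>q\<in>T. infdist (Y q \<omega>) (frontier D) < 1 / Suc k)"
proof -
  let ?f = "\<lambda>s. infdist (Y s \<omega>) (frontier D)"
  have cf: "continuous_on {0..u} ?f"
    by (intro continuous_on_infdist continuous_on_subset[OF cont[OF \<omega>]]) auto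
  show ?thesis
  proof
    assume "hitting_time D Y \<omega> \<le> ereal u"
    with hitting_time_cases[of Y \<omega> D, OF cont[OF \<omega>]]
    obtain r where r: "0 \<le> r" "r \<le> u" "Y r \<omega> \<in> frontier D"
      by (metis ereal_infty_less_eq(1) ereal_less_eq(3) PInfty_neq_ereal(1))
    then have f0: "?f r = 0" by simp
    show "\<forall>k. \<exists>q\<in>T. ?f q < 1 / Suc k"
    proof
      fix k :: nat
      have "(0::real) < 1 / Suc k" by simp
      then obtain d where d: "d > 0" "\<And>s. s \<in> {0..u} \<Longrightarrow> dist s r < d \<Longrightarrow> dist (?f s) (?f r) < 1 / Suc k"
        using cf r unfolding continuous_on_iff by (metis atLeastAtMost_iff)
      obtain q where "q \<in> T" "dist q r < d"
        using T(2) r d(1) closure_approachable[of r T] by (metis atLeastAtMost_iff subsetD)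
      then show "\<exists>q\<in>T. ?f q < 1 / Suc k"
        using d(2)[of q] T(1) f0 by (intro bexI[of _ q]) (auto simp: dist_real_def)
    qed
  next
    assume *: "\<forall>k. \<exists>q\<in>T. ?f q < 1 / Suc k"
    obtain s where s: "s \<in> {0..u}" "\<And>v. v \<in> {0..u} \<Longrightarrow> ?f s \<le> ?f v"
      using continuous_attains_inf[OF _ _ cf] u by auto
    have "?f s < 1 / Suc k" for k
      using * s(2) T(1) by (meson le_less_trans subsetD)
    then have "?f s \<le> 0"
      using reals_Archimedean[of "?f s"] by (metis inverse_eq_divide not_le less_asym)
    then have "?f s = 0" using infdist_nonneg[of "Y s \<omega>" "frontier D"] by simp
    then have "Y s \<omega> \<in> frontier D"
      using in_closed_iff_infdist_zero[OF frontier_closed F] by blast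
    then have "hitting_time D Y \<omega> \<le> ereal s"
      using s(1) unfolding hitting_time_def by (intro INF_lower) auto
    then show "hitting_time D Y \<omega> \<le> ereal u"
      using s(1) by (auto intro: order_trans)
  qed
qed

lemma measurable_hitting_time: "hitting_time D Y \<in> borel_measurable M"
proof (rule borel_measurableI_le)
  fix y :: ereal
  show "{\<omega>\<in>space M. hitting_time D Y \<omega> \<le> y} \<in> sets M"
  proof (cases "frontier D = {}")
    case True
    then have "hitting_time D Y \<omega> = \<infinity>" for \<omega> by (simp add: hitting_time_def top_ereal_def)
    then show ?thesis by simp
  next
    case F: False
    show ?thesis
    proof (cases y)
      case (real u)
      show ?thesis
      proof (cases "0 \<le> u")
        case True
        \<comment> \<open>Countability of the dense set makes the event a countable combination of
          measurable ones.\<close>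
        obtain T where T: "countable T" "T \<subseteq> {0..u}" "{0..u} \<subseteq> closure T"
          using separable[of "{0..u}"] by metis
        have "{\<omega>\<in>space M. infdist (Y q \<omega>) (frontier D) < 1 / Suc k} \<in> sets M" if "q \<in> T" for q and k :: nat
        proof -
          have "(\<lambda>\<omega>. infdist (Y q \<omega>) (frontier D)) \<in> borel_measurable M"
          proof (rule measurable_compose[OF Y])
            show "0 \<le> q" using that T(2) by auto
            show "(\<lambda>x. infdist x (frontier D)) \<in> borel_measurable borel"
              by (intro borel_measurable_continuous_onI continuous_on_infdist continuous_on_id)
          qed
          then show ?thesis by measurable
        qed
        then have "{\<omega>\<in>space M. \<forall>k. \<exists>q\<in>T. infdist (Y q \<omega>) (frontier D) < 1 / Suc k} \<in> sets M"
          using T(1) by (intro sets.sets_Collect_countable_All sets.sets_Collect_countable_Ex')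
        moreover have "{\<omega>\<in>space M. hitting_time D Y \<omega> \<le> y} =
            {\<omega>\<in>space M. \<forall>k. \<exists>q\<in>T. infdist (Y q \<omega>) (frontier D) < 1 / Suc k}"
          using hitting_time_le_iff_infdist[OF _ True F T(2,3)] real by auto
        ultimately show ?thesis by simp
      next
        case False
        then have "\<not> hitting_time D Y \<omega> \<le> y" for \<omega>
          using hitting_time_nonneg[of D Y \<omega>] real by (metis ereal_less_eq(5) order_trans)
        then show ?thesis by simp
      qed
    next
      case MInf
      then have "\<not> hitting_time D Y \<omega> \<le> y" for \<omega> using hitting_time_nonneg[of D Y \<omega>] by auto
      then show ?thesis by simp
    qed simp
  qed
qed

text \<open>\<open>Y\<close> is only assumed measurable at each fixed time. The random time is
  therefore approximated by times with countably many values, and path continuity passes to the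
  limit.\<close>

lemma measurable_absorbed:
  assumes t: "0 \<le> t"
  shows "absorbed D Y t \<in> M \<rightarrow>\<^sub>M borel"
proof -
  define s where "s \<omega> = real_of_ereal (min (ereal t) (hitting_time D Y \<omega>))" for \<omega>
  have [measurable]: "s \<in> borel_measurable M"
    unfolding s_def using measurable_hitting_time by measurable
  have s0: "0 \<le> s \<omega>" for \<omega>
    using t hitting_time_nonneg[of D Y \<omega>] by (simp add: s_def real_of_ereal_pos)
  \<comment> \<open>Rounding up to a multiple of \<open>1 / Suc k\<close> keeps the time
    nonnegative, where the path is continuous, and moves it by at most
    \<open>1 / Suc k\<close>.\<close>
  define a where "a k \<omega> = real (nat \<lceil>real (Suc k) * s \<omega>\<rceil>) / real (Suc k)" for k \<omega>
  have a: "\<bar>a k \<omega> - s \<omega>\<bar> \<le> 1 / real (Suc k)" for k \<omega>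
  proof -
    have "0 \<le> real (Suc k) * s \<omega>" using s0[of \<omega>] by simp
    then have "real (nat \<lceil>real (Suc k) * s \<omega>\<rceil>) = real_of_int \<lceil>real (Suc k) * s \<omega>\<rceil>" by simp
    then have "a k \<omega> - s \<omega> = (real_of_int \<lceil>real (Suc k) * s \<omega>\<rceil> - real (Suc k) * s \<omega>) / real (Suc k)"
      by (simp add: a_def field_simps)
    moreover have "0 \<le> real_of_int \<lceil>real (Suc k) * s \<omega>\<rceil> - real (Suc k) * s \<omega>"
        "real_of_int \<lceil>real (Suc k) * s \<omega>\<rceil> - real (Suc k) * s \<omega> \<le> 1"
      by linarith+
    ultimately show ?thesis by (simp add: divide_right_mono)
  qed
  have a0: "0 \<le> a k \<omega>" for k \<omega>
    unfolding a_def by (intro divide_nonneg_nonneg of_nat_0_le_iff)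
  have lim: "(\<lambda>k. a k \<omega>) \<longlonglongrightarrow> s \<omega>" for \<omega>
  proof (rule LIM_zero_cancel, rule tendsto_rabs_zero_cancel)
    show "(\<lambda>k. \<bar>a k \<omega> - s \<omega>\<bar>) \<longlonglongrightarrow> 0"
      by (rule tendsto_sandwich[OF _ _ tendsto_const LIMSEQ_Suc[OF lim_1_over_n]])
        (use a in \<open>auto simp: divide_simps\<close>)
  qed
  have "(\<lambda>\<omega>. Y (a k \<omega>) \<omega>) \<in> M \<rightarrow>\<^sub>M borel" for k
    unfolding a_def
  proof (rule measurable_compose_countable[where f = "\<lambda>i. Y (real i / real (Suc k))"])
    show "Y (real i / real (Suc k)) \<in> M \<rightarrow>\<^sub>M borel" for i by (rule Y) simp
    show "(\<lambda>\<omega>. nat \<lceil>real (Suc k) * s \<omega>\<rceil>) \<in> M \<rightarrow>\<^sub>M count_space UNIV" by measurable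
  qed
  moreover have "(\<lambda>k. Y (a k \<omega>) \<omega>) \<longlonglongrightarrow> Y (s \<omega>) \<omega>" if "\<omega> \<in> space M" for \<omega>
    using s0 a0 by (intro continuous_on_tendsto_compose[OF cont[OF that] lim]) auto
  ultimately have "(\<lambda>\<omega>. Y (s \<omega>) \<omega>) \<in> M \<rightarrow>\<^sub>M borel" by (rule borel_measurable_LIMSEQ_metric)
  moreover have "absorbed D Y t = (\<lambda>\<omega>. Y (s \<omega>) \<omega>)" by (auto simp: absorbed_def s_def)
  ultimately show ?thesis by simp
qed

section \<open>Laws of independent absorbed particles\<close>

context
  fixes P :: "real^'d \<Rightarrow> 'w measure" and t :: real
  assumes P: "P \<in> borel \<rightarrow>\<^sub>M prob_algebra M" and t: "0 \<le> t"
begin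

lemma prob_space_P: "prob_space (P z)"
  and sets_P: "sets (P z) = sets M"
  using measurable_space[OF P, of z] by (auto simp: space_prob_algebra)

lemma space_P: "space (P z) = space M"
  by (rule sets_eq_imp_space_eq[OF sets_P])

lemma measurable_absorbed_P: "absorbed D Y t \<in> P z \<rightarrow>\<^sub>M borel"
  using measurable_absorbed[OF t] measurable_cong_sets[OF sets_P refl] by blast

lemma prob_space_transition_prob: "prob_space (transition_prob D P Y t z)"
  unfolding transition_prob_def using prob_space_P measurable_absorbed_P by (rule prob_space.prob_space_distr)

lemma sets_transition_prob: "sets (transition_prob D P Y t z) = sets borel"
  by (simp add: transition_prob_def)

lemma measurable_transition_prob: "transition_prob D P Y t \<in> borel \<rightarrow>\<^sub>M prob_algebra borel"
  unfolding transition_prob_def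
  by (rule measurable_compose[OF P measurable_distr_prob_space[OF measurable_absorbed[OF t]]])

text \<open>Stopping acts on each path separately, so it carries a product of path laws to the
  product of the one-time laws.\<close>

lemma PiM_transition_prob:
  assumes "finite J"
  shows "PiM J (\<lambda>j. transition_prob D P Y t (z j)) =
    distr (PiM J (\<lambda>j. P (z j))) (PiM J (\<lambda>_. borel)) (\<lambda>\<omega>. \<lambda>j\<in>J. absorbed D Y t (\<omega> j))"
proof -
  have "distr (PiM J (\<lambda>j. P (z j))) (PiM J (\<lambda>j. distr (P (z j)) borel (absorbed D Y t))) (compose J (absorbed D Y t)) =
      PiM J (\<lambda>j. distr (P (z j)) (distr (P (z j)) borel (absorbed D Y t)) (absorbed D Y t))"
    using assms prob_space_P measurable_absorbed_P
    by (intro distr_PiM_finite_prob_space') (auto intro!: prob_space.prob_space_distr)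
  moreover have "distr (P z) (distr (P z) borel (absorbed D Y t)) (absorbed D Y t) = distr (P z) borel (absorbed D Y t)" for z
    by (rule distr_cong) auto
  moreover have "distr (PiM J (\<lambda>j. P (z j))) (PiM J (\<lambda>j. distr (P (z j)) borel (absorbed D Y t))) (compose J (absorbed D Y t)) =
      distr (PiM J (\<lambda>j. P (z j))) (PiM J (\<lambda>_. borel)) (\<lambda>\<omega>. \<lambda>j\<in>J. absorbed D Y t (\<omega> j))"
    by (rule distr_cong) (auto simp: compose_def intro!: sets_PiM_cong)
  ultimately show ?thesis by (simp add: transition_prob_def)
qed

lemma measurable_restrict_absorbed:
  "(\<lambda>\<omega>. \<lambda>j\<in>J. absorbed D Y t (\<omega> j)) \<in> PiM J (\<lambda>j. P (z j)) \<rightarrow>\<^sub>M PiM J (\<lambda>_. borel)"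
proof (rule measurable_restrict)
  fix j assume "j \<in> J"
  then have "(\<lambda>\<omega>. \<omega> j) \<in> PiM J (\<lambda>j. P (z j)) \<rightarrow>\<^sub>M P (z j)" by (rule measurable_component_singleton)
  then show "(\<lambda>\<omega>. absorbed D Y t (\<omega> j)) \<in> PiM J (\<lambda>j. P (z j)) \<rightarrow>\<^sub>M borel"
    by (rule measurable_compose) (rule measurable_absorbed_P)
qed

lemma tensor_semigroup_indicator:
  assumes "finite J" "A \<in> sets (PiM J (\<lambda>_. borel))"
  shows "ennreal (tensor_semigroup D P Y J t (indicator A) z) = emeasure (PiM J (\<lambda>j. transition_prob D P Y t (z j))) A"
proof -
  interpret PP: prob_space "PiM J (\<lambda>j. P (z j))" by (intro prob_space_PiM prob_space_P)
  let ?f = "\<lambda>\<omega>. \<lambda>j\<in>J. absorbed D Y t (\<omega> j)"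
  let ?S = "?f -` A \<inter> space (PiM J (\<lambda>j. P (z j)))"
  have S: "?S \<in> sets (PiM J (\<lambda>j. P (z j)))"
    using measurable_sets[OF measurable_restrict_absorbed assms(2)] .
  have "tensor_semigroup D P Y J t (indicator A) z = (\<integral>\<omega>. indicator ?S \<omega> \<partial>PiM J (\<lambda>j. P (z j)))"
    unfolding tensor_semigroup_def by (intro Bochner_Integration.integral_cong refl) (simp add: indicator_def)
  then have "ennreal (tensor_semigroup D P Y J t (indicator A) z) = emeasure (PiM J (\<lambda>j. P (z j))) ?S"
    using S by (simp add: PP.emeasure_eq_measure)
  then show ?thesis
    using emeasure_distr[OF measurable_restrict_absorbed assms(2), where D1 = D and z1 = z] by (simp add: PiM_transition_prob[OF assms(1)])
qed

text \<open>From a point of \<open>D\<close> the process stays in \<open>closure D\<close> only almost surely, so its law is restricted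
  explicitly.\<close>

lemma dual_semigroup_eq_mixture:
  assumes "finite J"
  shows "dual_semigroup D P Y J t \<kappa> = mixture \<kappa> (tuple_space (closure D) J)
    (\<lambda>z. restrict_space (PiM J (\<lambda>j. transition_prob D P Y t (z j))) (J \<rightarrow>\<^sub>E closure D))"
  unfolding dual_semigroup_def mixture_def
proof (intro measure_of_eq nn_integral_cong)
  fix A z assume "A \<in> sigma_sets (space (tuple_space (closure D) J)) (sets (tuple_space (closure D) J))"
  then have A: "A \<in> sets (tuple_space (closure D) J)" by (simp only: sets.sigma_sets_eq)
  then have A': "A \<in> sets (PiM J (\<lambda>_. borel))"
    using sets_tuple_space_mono[OF assms _ _ A, of UNIV] by (simp add: tuple_space_UNIV)
  have "(J \<rightarrow>\<^sub>E closure D) \<in> sets (PiM J (\<lambda>_. borel))"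
    using assms by (intro sets_PiM_I_finite) auto
  then have "(J \<rightarrow>\<^sub>E closure D) \<inter> space (PiM J (\<lambda>j. transition_prob D P Y t (z j))) \<in> sets (PiM J (\<lambda>j. transition_prob D P Y t (z j)))"
    using sets_PiM_cong[of J J "\<lambda>j. transition_prob D P Y t (z j)" "\<lambda>_. borel", OF refl sets_transition_prob] by auto
  then have "emeasure (restrict_space (PiM J (\<lambda>j. transition_prob D P Y t (z j))) (J \<rightarrow>\<^sub>E closure D)) A =
      emeasure (PiM J (\<lambda>j. transition_prob D P Y t (z j))) A"
    using sets.sets_into_space[OF A] by (intro emeasure_restrict_space) auto
  then show "ennreal (tensor_semigroup D P Y J t (indicator A) z) =
      emeasure (restrict_space (PiM J (\<lambda>j. transition_prob D P Y t (z j))) (J \<rightarrow>\<^sub>E closure D)) A"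
    using tensor_semigroup_indicator[OF assms A'] by simp
qed (rule sets.space_closed)

section \<open>Reservoir intensity, absorption functional and dual semigroup\<close>

context
  fixes D :: "(real^'d) set" and lam :: "real^'d \<Rightarrow> real"
  assumes lam: "lam \<in> borel_measurable (restrict_space borel (frontier D))"
    and lam0: "\<And>y. y \<in> frontier D \<Longrightarrow> 0 \<le> lam y"
begin

lemma measurable_boundary_value: "(\<lambda>y. indicator (frontier D) y * lam y) \<in> borel_measurable borel"
  using lam by (subst (asm) borel_measurable_restrict_space_iff) auto

lemma boundary_mean_absorbed:
  "boundary_mean D P Y lam t z =
    (\<integral>\<^sup>+\<omega>. ennreal (indicator (frontier D) (absorbed D Y t \<omega>) * lam (absorbed D Y t \<omega>)) \<partial>P z)"
  unfolding boundary_mean_def transition_prob_def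
  using measurable_compose[OF measurable_boundary_value measurable_ennreal]
  by (intro nn_integral_distr[OF measurable_absorbed_P]) simp_all

text \<open>On the event of absorption by time \<open>t\<close> the position at the hitting time
  equals the position at time \<open>t\<close>, and this event is that of being on the frontier at
  time \<open>t\<close>. Hence the exit law is the frontier part of the transition law.\<close>

lemma nn_integral_exit_law:
  "(\<integral>\<^sup>+y. ennreal (lam y) \<partial>exit_law D P Y t z) = boundary_mean D P Y lam t z"
proof -
  let ?E = "{\<omega>\<in>space (P z). hitting_time D Y \<omega> \<le> ereal t}"
  let ?g = "\<lambda>\<omega>. absorbed D Y (real_of_ereal (hitting_time D Y \<omega>)) \<omega>"
  have "hitting_time D Y \<in> borel_measurable (P z)"
    using measurable_hitting_time measurable_cong_sets[OF sets_P[of z] refl] by blast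
  then have E: "?E \<in> sets (P z)" by measurable
  have g: "?g \<omega> = absorbed D Y t \<omega>" if "\<omega> \<in> ?E" for \<omega>
    using that absorbed_hitting_time by (simp add: space_P)
  have iff: "absorbed D Y t \<omega> \<in> frontier D \<longleftrightarrow> \<omega> \<in> ?E" if "\<omega> \<in> space (P z)" for \<omega>
    using that absorbed_in_frontier_iff[OF _ t] by (simp add: space_P)
  have "absorbed D Y t \<in> restrict_space (P z) ?E \<rightarrow>\<^sub>M restrict_space borel (frontier D)"
    using iff by (intro measurable_restrict_space2 measurable_restrict_space1 measurable_absorbed_P)
      (auto simp: space_restrict_space)
  then have mg: "?g \<in> restrict_space (P z) ?E \<rightarrow>\<^sub>M restrict_space borel (frontier D)"
    by (rule measurable_cong[THEN iffD1, rotated]) (use g in \<open>simp add: space_restrict_space\<close>)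
  have "(\<integral>\<^sup>+y. ennreal (lam y) \<partial>exit_law D P Y t z) = (\<integral>\<^sup>+\<omega>. ennreal (lam (?g \<omega>)) \<partial>restrict_space (P z) ?E)"
    unfolding exit_law_def using lam by (intro nn_integral_distr[OF mg]) simp
  also have "\<dots> = (\<integral>\<^sup>+\<omega>. ennreal (lam (?g \<omega>)) * indicator ?E \<omega> \<partial>P z)"
    using E by (intro nn_integral_restrict_space) auto
  also have "\<dots> = boundary_mean D P Y lam t z"
    unfolding boundary_mean_absorbed
  proof (rule nn_integral_cong)
    fix \<omega> assume "\<omega> \<in> space (P z)"
    then show "ennreal (lam (?g \<omega>)) * indicator ?E \<omega> =
        ennreal (indicator (frontier D) (absorbed D Y t \<omega>) * lam (absorbed D Y t \<omega>))"
      using g[of \<omega>] iff[of \<omega>] by (cases "\<omega> \<in> ?E") auto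
  qed
  finally show ?thesis .
qed

lemma measurable_boundary_mean: "boundary_mean D P Y lam t \<in> borel_measurable borel"
proof -
  have "(\<lambda>M. \<integral>\<^sup>+y. ennreal (indicator (frontier D) y * lam y) \<partial>M) \<in> borel_measurable (subprob_algebra borel)"
    using measurable_boundary_value by (intro nn_integral_measurable_subprob_algebra) simp
  from measurable_compose[OF measurable_prob_algebraD[OF measurable_transition_prob] this]
  show ?thesis by (simp add: boundary_mean_def[abs_def])
qed

lemma boundary_mean_le:
  assumes "\<And>y. y \<in> frontier D \<Longrightarrow> lam y \<le> C"
  shows "boundary_mean D P Y lam t z \<le> ennreal \<bar>C\<bar>"
proof -
  \<comment> \<open>The absolute value keeps the bound valid off the frontier, where the integrand
    is 0, even for a negative \<open>C\<close>, which an empty frontier would admit.\<close>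
  have "boundary_mean D P Y lam t z \<le> (\<integral>\<^sup>+y. ennreal \<bar>C\<bar> \<partial>transition_prob D P Y t z)"
    unfolding boundary_mean_def using assms
    by (intro nn_integral_mono ennreal_leI) (force simp: indicator_def)
  then show ?thesis
    using prob_space.emeasure_space_1[OF prob_space_transition_prob] by simp
qed

lemma reservoir_intensity_eq_density:
  "reservoir_intensity D P Y lam \<mu> t = density \<mu> (boundary_mean D P Y lam t)"
  by (simp add: reservoir_intensity_def nn_integral_exit_law)

lemma finite_measure_reservoir_intensity:
  assumes "\<And>y. y \<in> frontier D \<Longrightarrow> lam y \<le> C" "finite_measure \<mu>" "sets \<mu> = sets (restrict_space borel S)"
  shows "finite_measure (reservoir_intensity D P Y lam \<mu> t)"
proof (rule finite_measureI)
  have m: "boundary_mean D P Y lam t \<in> borel_measurable \<mu>"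
    using measurable_restrict_space1[OF measurable_boundary_mean, of S] measurable_cong_sets[OF assms(3) refl] by blast
  have "emeasure (reservoir_intensity D P Y lam \<mu> t) (space \<mu>) = (\<integral>\<^sup>+z. boundary_mean D P Y lam t z * indicator (space \<mu>) z \<partial>\<mu>)"
    unfolding reservoir_intensity_eq_density using m by (intro emeasure_density) auto
  also have "\<dots> \<le> (\<integral>\<^sup>+z. ennreal \<bar>C\<bar> \<partial>\<mu>)"
    using boundary_mean_le[OF assms(1)] by (intro nn_integral_mono) (auto simp: indicator_def)
  also have "\<dots> < \<infinity>"
    using finite_measure.emeasure_finite[OF assms(2), of "space \<mu>"] by (simp add: ennreal_mult_less_top less_top)
  finally show "emeasure (reservoir_intensity D P Y lam \<mu> t) (space (reservoir_intensity D P Y lam \<mu> t)) \<noteq> \<infinity>"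
    by (simp add: reservoir_intensity_def)
qed

text \<open>The functional asks all particles to be absorbed and multiplies \<open>lam\<close> over
  their end points, so Fubini splits it into the densities of the reservoir intensity. The identity
  covers an infinite product of means as well, where both sides are 0.\<close>

lemma absorbed_functional_eq:
  assumes "finite I"
  shows "absorbed_functional D P Y lam I t z = enn2real (\<Prod>j\<in>I. boundary_mean D P Y lam t (z j))"
proof -
  interpret product_sigma_finite "\<lambda>j. P (z j)"
    using prob_space_P by (simp add: product_sigma_finite_def prob_space_imp_sigma_finite)
  let ?h = "\<lambda>\<omega>. indicator (frontier D) (absorbed D Y t \<omega>) * lam (absorbed D Y t \<omega>)"
  have h: "?h \<in> borel_measurable (P v)" for v
    using measurable_compose[OF measurable_absorbed_P measurable_boundary_value] .
  have h0: "0 \<le> ?h \<omega>" for \<omega> using lam0 by (simp add: indicator_def)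
  have "absorbed_functional D P Y lam I t z = (\<integral>\<omega>. (\<Prod>j\<in>I. ?h (\<omega> j)) \<partial>PiM I (\<lambda>j. P (z j)))"
    using assms by (simp only: absorbed_functional_def particles_def prod_mset_filter_point_sum)
  also have "\<dots> = enn2real (\<integral>\<^sup>+\<omega>. ennreal (\<Prod>j\<in>I. ?h (\<omega> j)) \<partial>PiM I (\<lambda>j. P (z j)))"
  proof (rule integral_eq_nn_integral)
    show "(\<lambda>\<omega>. \<Prod>j\<in>I. ?h (\<omega> j)) \<in> borel_measurable (PiM I (\<lambda>j. P (z j)))"
    proof (rule borel_measurable_prod)
      fix j assume "j \<in> I"
      then have "(\<lambda>\<omega>. \<omega> j) \<in> PiM I (\<lambda>j. P (z j)) \<rightarrow>\<^sub>M P (z j)" by (rule measurable_component_singleton)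
      then show "(\<lambda>\<omega>. ?h (\<omega> j)) \<in> borel_measurable (PiM I (\<lambda>j. P (z j)))"
        by (rule measurable_compose) (rule h)
    qed
  qed (use h0 in \<open>auto intro!: prod_nonneg\<close>)
  also have "(\<integral>\<^sup>+\<omega>. ennreal (\<Prod>j\<in>I. ?h (\<omega> j)) \<partial>PiM I (\<lambda>j. P (z j))) =
      (\<integral>\<^sup>+\<omega>. (\<Prod>j\<in>I. ennreal (?h (\<omega> j))) \<partial>PiM I (\<lambda>j. P (z j)))"
    using h0 by (simp add: prod_ennreal)
  also have "\<dots> = (\<Prod>j\<in>I. \<integral>\<^sup>+\<omega>. ennreal (?h \<omega>) \<partial>P (z j))"
    using assms h by (intro product_nn_integral_prod) simp_all
  finally show ?thesis by (simp add: boundary_mean_absorbed)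
qed

text \<open>Integrating against the factorial measure sums over injective choices of initial points,
  and from each choice the particles move independently. This is the expansion that the merged
  measure in (a) is built on.\<close>

lemma emeasure_dual_semigroup:
  fixes N :: nat
  assumes K: "finite K" and x: "\<And>l. l \<in> {1..N} \<Longrightarrow> x l \<in> D"
    and A: "A \<in> sets (tuple_space (closure D) K)"
  shows "emeasure (dual_semigroup D P Y K t (factorial_measure D K (\<Sum>l=1..N. {#x l#}))) A =
    (\<Sum>i | i \<in> K \<rightarrow>\<^sub>E {1..N} \<and> inj_on i K. emeasure (PiM K (\<lambda>j. transition_prob D P Y t (x (i j)))) A)"
proof -
  let ?I = "{i \<in> K \<rightarrow>\<^sub>E {1..N}. inj_on i K}"
  let ?T = "\<lambda>z. PiM K (\<lambda>j. transition_prob D P Y t (z j))"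
  let ?R = "\<lambda>z. restrict_space (?T z) (K \<rightarrow>\<^sub>E closure D)"
  have sets_T: "sets (?T z) = sets (tuple_space UNIV K)" for z
    using sets_transition_prob by (auto simp: tuple_space_UNIV intro!: sets_PiM_cong)
  have sp_T: "space (?T z) = K \<rightarrow>\<^sub>E UNIV" for z
    using sets_eq_imp_space_eq[OF sets_T] by simp
  have sets_R: "sets (?R z) = sets (tuple_space (closure D) K)" for z
    using sets_restrict_space_tuple_space[of "closure D" UNIV K]
    by (simp add: sets_restrict_space sets_T)
  have mem: "(K \<rightarrow>\<^sub>E closure D) \<inter> space (?T z) \<in> sets (?T z)" for z
    unfolding sets_T sp_T using K by (intro sets.Int PiE_in_sets_tuple_space) auto
  have R: "emeasure (?R z) B = emeasure (?T z) B" if "B \<in> sets (tuple_space (closure D) K)" for B z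
    using sets.sets_into_space[OF that] mem by (intro emeasure_restrict_space) auto
  \<comment> \<open>Without measurability in the starting points the \<open>measure_of\<close>
    behind the dual semigroup could not be evaluated.\<close>
  have meas: "(\<lambda>z. emeasure (?R z) B) \<in> borel_measurable (tuple_space D K)"
    if B: "B \<in> sets (tuple_space (closure D) K)" for B
  proof -
    have "transition_prob D P Y t \<in> restrict_space borel D \<rightarrow>\<^sub>M prob_algebra borel"
      by (rule measurable_restrict_space1[OF measurable_transition_prob])
    from measurable_PiM_prob_algebra[OF K this]
    have "?T \<in> tuple_space D K \<rightarrow>\<^sub>M subprob_algebra (PiM K (\<lambda>_. borel))"
      unfolding tuple_space_def by (rule measurable_prob_algebraD)
    moreover have "B \<in> sets (PiM K (\<lambda>_. borel))"
      using sets_tuple_space_mono[OF K _ _ B, of UNIV] by (simp add: tuple_space_UNIV)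
    ultimately have "(\<lambda>z. emeasure (?T z) B) \<in> borel_measurable (tuple_space D K)"
      by (rule measurable_emeasure_kernel)
    then show ?thesis by (simp add: R[OF B])
  qed
  have meas': "(\<lambda>i. \<lambda>j\<in>K. x (i j)) \<in> count_space ?I \<rightarrow>\<^sub>M tuple_space D K"
  proof (rule measurable_count_space_eq1[THEN iffD2], rule funcsetI)
    fix i assume i: "i \<in> ?I"
    then have "x (i j) \<in> D" if "j \<in> K" for j using that by (intro x) (auto simp: PiE_iff)
    then show "(\<lambda>j\<in>K. x (i j)) \<in> space (tuple_space D K)" by auto
  qed
  have "emeasure (dual_semigroup D P Y K t (factorial_measure D K (\<Sum>l=1..N. {#x l#}))) A =
      (\<integral>\<^sup>+z. emeasure (?R z) A \<partial>factorial_measure D K (\<Sum>l=1..N. {#x l#}))"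
    unfolding dual_semigroup_eq_mixture[OF K] using meas A sets_R
    by (intro emeasure_mixture) (auto simp: measurable_cong_sets[OF sets_factorial_measure refl])
  also have "\<dots> = (\<integral>\<^sup>+i. emeasure (?R (\<lambda>j\<in>K. x (i j))) A \<partial>count_space ?I)"
    by (subst factorial_measure_enumeration[of N x D K, OF x], assumption, rule nn_integral_distr[OF meas'])
      (use meas[OF A] in simp)
  also have "\<dots> = (\<Sum>i\<in>?I. emeasure (?R (\<lambda>j\<in>K. x (i j))) A)"
    using finite_inj_on_PiE[OF K, of "{1..N}"] by (intro nn_integral_count_space_finite) simp
  \<comment> \<open>The product only looks at coordinates in \<open>K\<close>, so the
    \<open>restrict\<close> on the starting tuple disappears.\<close>
  also have "\<dots> = (\<Sum>i\<in>?I. emeasure (?T (\<lambda>j. x (i j))) A)"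
    using R[OF A] by (intro sum.cong refl) (auto intro!: arg_cong2[where f = emeasure] PiM_cong)
  finally show ?thesis by simp
qed

end

end

end

section \<open>The boundary driven gas\<close>

theorem theorem4p2:
  fixes D :: "(real^'d) set"
    and a :: "real^'d \<Rightarrow> real^'d^'d" and b :: "real^'d \<Rightarrow> real^'d"
    and M :: "'w measure" and P :: "real^'d \<Rightarrow> 'w measure" and Y :: "real \<Rightarrow> 'w \<Rightarrow> real^'d"
    and lam :: "real^'d \<Rightarrow> real" and \<mu> :: "(real^'d) measure"
    and N :: nat and x :: "nat \<Rightarrow> real^'d" and \<eta> :: "(real^'d) multiset"
    and Q :: "'v measure" and H :: "real \<Rightarrow> 'v \<Rightarrow> (real^'d) multiset"
    and n :: nat
  assumes "regular_domain D"
    and "admissible_coefficients D a b"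
    and "diffusion M P Y"
    and "has_generator a b P Y"
    and "\<forall>z\<in>D. AE \<omega> in P z. hitting_time D Y \<omega> < \<infinity>"
    and "lam \<in> borel_measurable (restrict_space borel (frontier D))"
    and "\<exists>C. \<forall>y\<in>frontier D. 0 \<le> lam y \<and> lam y \<le> C"
    and "finite_measure \<mu>" and "sets \<mu> = sets (restrict_space borel D)"
    and "\<forall>i\<in>{1..N}. x i \<in> D"
    and "\<eta> = (\<Sum>i=1..N. {#x i#})"
    and "boundary_driven_gas D P Y lam \<mu> N x Q H"
  shows
    "(\<forall>t\<ge>0. \<forall>f\<in>borel_measurable (tuple_space D {1..n}).
        (\<exists>C. \<forall>z\<in>{1..n} \<rightarrow>\<^sub>E D. \<bar>f z\<bar> \<le> C) \<and>
        (\<forall>\<pi>. \<pi> permutes {1..n} \<longrightarrow> (\<forall>z\<in>{1..n} \<rightarrow>\<^sub>E D. f (z \<circ> \<pi>) = f z)) \<longrightarrow>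
        integrable Q (\<lambda>\<omega>. \<integral>z. f z \<partial>factorial_measure D {1..n} (H t \<omega>)) \<and>
        (\<integral>\<omega>. (\<integral>z. f z \<partial>factorial_measure D {1..n} (H t \<omega>)) \<partial>Q) =
        (\<Sum>k=0..n. real (n choose k) *
           (LINT z : {1..n} \<rightarrow>\<^sub>E D |
              distr (PiM {1..k} (\<lambda>_. reservoir_intensity D P Y lam \<mu> t) \<Otimes>\<^sub>M
                     dual_semigroup D P Y ({1..n} - {1..k}) t (factorial_measure D ({1..n} - {1..k}) \<eta>))
                (tuple_space (closure D) {1..n}) (merge {1..k} ({1..n} - {1..k})).
              f z)))
     \<and>
     (\<forall>m \<pp>. symmetric_transition_density D P Y m \<pp> \<and> \<mu> = m \<longrightarrow>
        (\<forall>t>0.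
           let \<rho> = (\<lambda>z. \<Sum>I\<in>Pow {1..n}. absorbed_functional D P Y lam I t (restrict z I) *
                     (\<integral>y. (\<Prod>j\<in>{1..n} - I. \<pp> t (z j) (y j))
                       \<partial>factorial_measure D ({1..n} - I) \<eta>))
           in \<rho> \<in> borel_measurable (PiM {1..n} (\<lambda>_. m)) \<and>
              expected_factorial_measure Q D {1..n} (H t) =
                density (PiM {1..n} (\<lambda>_. m)) (\<lambda>z. ennreal (\<rho> z))))"
proof -
  have D: "open D" "D \<in> sets borel" using assms(1) by (auto simp: regular_domain_def)
  have P: "P \<in> borel \<rightarrow>\<^sub>M prob_algebra M" and Y: "\<And>s. 0 \<le> s \<Longrightarrow> Y s \<in> M \<rightarrow>\<^sub>M borel"
    and cont: "\<And>\<omega>. \<omega> \<in> space M \<Longrightarrow> continuous_on {0..} (\<lambda>s. Y s \<omega>)"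
    using assms(3) by (auto simp: diffusion_def)
  obtain C where C: "\<And>y. y \<in> frontier D \<Longrightarrow> 0 \<le> lam y" "\<And>y. y \<in> frontier D \<Longrightarrow> lam y \<le> C"
    using assms(7) by blast
  note lam = assms(6) and \<mu> = assms(8,9)
  have x: "x l \<in> D" if "l \<in> {1..N}" for l using assms(10) that by blast
  note \<eta> = assms(11)
  define p where "p t l = transition_prob D P Y t (x l)" for t l
  define \<nu> where "\<nu> t = reservoir_intensity D P Y lam \<mu> t" for t
  obtain \<xi> \<Theta> where Q: "prob_space Q" and \<xi>: "\<And>s. 0 \<le> s \<Longrightarrow> \<xi> s \<in> Q \<rightarrow>\<^sub>M config_space"
    and law: "distr Q (PiM {0..} (\<lambda>_. config_space)) (\<lambda>\<omega>. \<lambda>s\<in>{0..}. \<xi> s \<omega>) =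
          distr (PiM {1..N} (\<lambda>i. P (x i))) (PiM {0..} (\<lambda>_. config_space))
            (\<lambda>\<omega>. \<lambda>s\<in>{0..}. particles D Y {1..N} s \<omega>)"
    and \<Theta>: "\<And>t. 0 \<le> t \<Longrightarrow> poisson_point_process Q (\<nu> t) (\<Theta> t)"
    and indep: "\<And>t. 0 \<le> t \<Longrightarrow> prob_space.indep_var Q config_space (\<xi> t) config_space (\<Theta> t)"
    and H: "\<And>t \<omega>. 0 \<le> t \<Longrightarrow> \<omega> \<in> space Q \<Longrightarrow> H t \<omega> = filter_mset (\<lambda>y. y \<in> D) (\<xi> t \<omega>) + \<Theta> t \<omega>"
    using assms(12) unfolding boundary_driven_gas_def \<nu>_def by blast
  have p: "prob_space (p t l)" "sets (p t l) = sets borel" if "0 \<le> t" for t l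
    unfolding p_def using prob_space_transition_prob[OF Y cont P that] sets_transition_prob[OF Y cont P that] by auto
  have sets_\<nu>: "sets (\<nu> t) = sets (restrict_space borel D)" for t
    using \<mu>(2) by (simp add: \<nu>_def reservoir_intensity_def)
  have fin_\<nu>: "finite_measure (\<nu> t)" if "0 \<le> t" for t
    unfolding \<nu>_def by (rule finite_measure_reservoir_intensity[OF Y cont P that lam C(1) C(2) \<mu>])
  \<comment> \<open>The hypothesis compares laws of whole configuration-valued processes. Evaluation
    at \<open>t\<close> extracts the one-time law, which then factors through the tuple of particle
    positions.\<close>
  have law_t: "distr Q config_space (\<xi> t) = distr (PiM {1..N} (p t)) config_space (\<lambda>y. \<Sum>l=1..N. {#y l#})"
    if t: "0 \<le> t" for t
  proof -
    have part: "particles D Y {1..N} s \<in> PiM {1..N} (\<lambda>i. P (x i)) \<rightarrow>\<^sub>M config_space" if "0 \<le> s" for s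
      unfolding particles_def
    proof (rule measurable_point_sum)
      fix l assume "l \<in> {1..N}"
      then have "(\<lambda>\<omega>. \<omega> l) \<in> PiM {1..N} (\<lambda>i. P (x i)) \<rightarrow>\<^sub>M P (x l)" by (rule measurable_component_singleton)
      then show "(\<lambda>\<omega>. absorbed D Y s (\<omega> l)) \<in> PiM {1..N} (\<lambda>i. P (x i)) \<rightarrow>\<^sub>M borel"
        by (rule measurable_compose) (rule measurable_absorbed_P[OF Y cont P that])
    qed simp
    have at_t: "(\<lambda>f. f t) \<in> PiM {0..} (\<lambda>_. config_space) \<rightarrow>\<^sub>M config_space"
      using t by (intro measurable_component_singleton) simp
    have "distr Q config_space (\<xi> t) =
        distr (distr Q (PiM {0..} (\<lambda>_. config_space)) (\<lambda>\<omega>. \<lambda>s\<in>{0..}. \<xi> s \<omega>)) config_space (\<lambda>f. f t)"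
      using t \<xi> by (subst distr_distr[OF at_t]) (auto intro!: measurable_restrict simp: comp_def)
    also have "\<dots> = distr (PiM {1..N} (\<lambda>i. P (x i))) config_space (particles D Y {1..N} t)"
      unfolding law using t part by (subst distr_distr[OF at_t]) (auto intro!: measurable_restrict simp: comp_def)
    also have "\<dots> = distr (distr (PiM {1..N} (\<lambda>i. P (x i))) (PiM {1..N} (\<lambda>_. borel))
        (\<lambda>\<omega>. \<lambda>l\<in>{1..N}. absorbed D Y t (\<omega> l))) config_space (\<lambda>y. \<Sum>l=1..N. {#y l#})"
    proof (subst distr_distr)
      show "(\<lambda>y. \<Sum>l=1..N. {#y l#}) \<in> PiM {1..N} (\<lambda>_. borel) \<rightarrow>\<^sub>M config_space"
        by (intro measurable_point_sum measurable_component_singleton) auto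
      show "(\<lambda>\<omega>. \<lambda>l\<in>{1..N}. absorbed D Y t (\<omega> l)) \<in> PiM {1..N} (\<lambda>i. P (x i)) \<rightarrow>\<^sub>M PiM {1..N} (\<lambda>_. borel)"
        by (rule measurable_restrict_absorbed[OF Y cont P t])
      show "distr (PiM {1..N} (\<lambda>i. P (x i))) config_space (particles D Y {1..N} t) =
          distr (PiM {1..N} (\<lambda>i. P (x i))) config_space
            ((\<lambda>y. \<Sum>l=1..N. {#y l#}) \<circ> (\<lambda>\<omega>. \<lambda>l\<in>{1..N}. absorbed D Y t (\<omega> l)))"
        by (intro distr_cong refl) (simp add: particles_def)
    qed
    also have "distr (PiM {1..N} (\<lambda>i. P (x i))) (PiM {1..N} (\<lambda>_. borel)) (\<lambda>\<omega>. \<lambda>l\<in>{1..N}. absorbed D Y t (\<omega> l)) =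
        PiM {1..N} (p t)"
      using PiM_transition_prob[OF Y cont P t, of "{1..N}" D x] by (simp add: p_def[abs_def])
    finally show ?thesis .
  qed
  let ?J = "{1..n}"
  let ?X = "\<lambda>t. mixture (count_space (gas_index ?J N)) (tuple_space D ?J) (\<lambda>(I, i). gas_product (\<nu> t) (p t) D ?J I i)"
  have gas: "expected_factorial_measure Q D ?J (H t) = ?X t" if t: "0 \<le> t" for t
    by (rule expected_factorial_measure_gas[OF D(2) sets_\<nu> fin_\<nu>[OF t] p[OF t] Q \<Theta>[OF t] law_t[OF t] indep[OF t] H[OF t]]) simp_all

  \<comment> \<open>Symmetric test functions and the binomial formula\<close>
  have a: "integrable Q (\<lambda>\<omega>. \<integral>z. f z \<partial>factorial_measure D ?J (H t \<omega>)) \<and>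
      (\<integral>\<omega>. (\<integral>z. f z \<partial>factorial_measure D ?J (H t \<omega>)) \<partial>Q) =
      (\<Sum>k=0..n. real (n choose k) *
         (LINT z : ?J \<rightarrow>\<^sub>E D |
            distr (PiM {1..k} (\<lambda>_. reservoir_intensity D P Y lam \<mu> t) \<Otimes>\<^sub>M
                   dual_semigroup D P Y (?J - {1..k}) t (factorial_measure D (?J - {1..k}) \<eta>))
              (tuple_space (closure D) ?J) (merge {1..k} (?J - {1..k})).
            f z))"
    if t: "0 \<le> t" and f: "f \<in> borel_measurable (tuple_space D ?J)" "\<And>z. z \<in> ?J \<rightarrow>\<^sub>E D \<Longrightarrow> \<bar>f z\<bar> \<le> B"
      "\<And>z \<pi>. \<pi> permutes ?J \<Longrightarrow> z \<in> ?J \<rightarrow>\<^sub>E D \<Longrightarrow> f (z \<circ> \<pi>) = f z"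
    for t f B
  proof
    note g = D(2) sets_\<nu> fin_\<nu>[OF t] p[OF t] Q \<Theta>[OF t] law_t[OF t] indep[OF t] H[OF t]
    have meas: "(\<lambda>\<omega>. emeasure (factorial_measure D ?J (H t \<omega>)) A) \<in> borel_measurable Q"
      if "A \<in> sets (tuple_space D ?J)" for A
      by (rule measurable_emeasure_factorial_measure_gas[OF g _ that]) simp_all
    have fin: "finite_measure (factorial_measure D ?J (H t \<omega>))" if "\<omega> \<in> space Q" for \<omega>
      by (rule finite_measure_factorial_measure[OF _ set_mset_gas[OF g that]]) simp_all
    have EM: "mixture Q (tuple_space D ?J) (\<lambda>\<omega>. factorial_measure D ?J (H t \<omega>)) = ?X t"
      using gas[OF t] by (simp only: expected_factorial_measure_def mixture_def)
    \<comment> \<open>The explicit mixture bounds the expected number of \<open>n\<close>-tuples,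
      which is what makes the integral of a bounded \<open>f\<close> integrable.\<close>
    have fin_EM: "finite_measure (mixture Q (tuple_space D ?J) (\<lambda>\<omega>. factorial_measure D ?J (H t \<omega>)))"
      unfolding EM by (rule finite_measure_gas_mixture[OF D(2) sets_\<nu> fin_\<nu>[OF t] p[OF t]]) simp
    show "integrable Q (\<lambda>\<omega>. \<integral>z. f z \<partial>factorial_measure D ?J (H t \<omega>))"
      by (rule integrable_mixture[where T = "tuple_space D ?J" and C = B]) (use meas fin fin_EM f in simp_all)
    have "(\<integral>\<omega>. (\<integral>z. f z \<partial>factorial_measure D ?J (H t \<omega>)) \<partial>Q) = (\<integral>z. f z \<partial>?X t)"
      unfolding EM[symmetric]
      by (rule integral_mixture[symmetric, where C = B]) (use meas fin fin_EM f in simp_all)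
    also have "\<dots> = (\<Sum>(I, i)\<in>gas_index ?J N. \<integral>z. f z \<partial>gas_product (\<nu> t) (p t) D ?J I i)"
      by (rule integral_gas_mixture[OF D(2) sets_\<nu> fin_\<nu>[OF t] p[OF t] _ f(1,2)]) simp_all
    also have "\<dots> = (\<Sum>k=0..n. real (n choose k) *
        (\<Sum>i | i \<in> ?J - {1..k} \<rightarrow>\<^sub>E {1..N} \<and> inj_on i (?J - {1..k}). \<integral>z. f z \<partial>gas_product (\<nu> t) (p t) D ?J {1..k} i))"
      by (rule sum_integral_gas_product_binomial[OF D(2) sets_\<nu> fin_\<nu>[OF t] p[OF t] f(1,3)]) simp_all
    also have "\<dots> = (\<Sum>k=0..n. real (n choose k) *
         (LINT z : ?J \<rightarrow>\<^sub>E D |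
            distr (PiM {1..k} (\<lambda>_. reservoir_intensity D P Y lam \<mu> t) \<Otimes>\<^sub>M
                   dual_semigroup D P Y (?J - {1..k}) t (factorial_measure D (?J - {1..k}) \<eta>))
              (tuple_space (closure D) ?J) (merge {1..k} (?J - {1..k})).
            f z))"
    proof (rule sum.cong[OF refl])
      fix k assume k: "k \<in> {0..n}"
      let ?\<delta> = "dual_semigroup D P Y (?J - {1..k}) t (factorial_measure D (?J - {1..k}) \<eta>)"
      have "(LINT z : ?J \<rightarrow>\<^sub>E D | distr (PiM {1..k} (\<lambda>_. \<nu> t) \<Otimes>\<^sub>M ?\<delta>) (tuple_space (closure D) ?J) (merge {1..k} (?J - {1..k})). f z) =
          (\<Sum>i | i \<in> ?J - {1..k} \<rightarrow>\<^sub>E {1..N} \<and> inj_on i (?J - {1..k}). \<integral>z. f z \<partial>gas_product (\<nu> t) (p t) D ?J {1..k} i)"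
      \<comment> \<open>The larger set \<open>C\<close> is the closure of \<open>D\<close>, on whose
        tuples the dual semigroup is defined.\<close>
      proof (rule integral_restrict_merge[OF D(2) sets_\<nu> fin_\<nu>[OF t] p[OF t] _ _ _ _ _ _ f(1,2)])
        show "emeasure ?\<delta> A = (\<Sum>i | i \<in> ?J - {1..k} \<rightarrow>\<^sub>E {1..N} \<and> inj_on i (?J - {1..k}).
            emeasure (PiM (?J - {1..k}) (\<lambda>j. p t (i j))) A)"
          if "A \<in> sets (tuple_space (closure D) (?J - {1..k}))" for A
          unfolding \<eta> p_def by (rule emeasure_dual_semigroup[OF Y cont P t lam C(1) _ x that]) simp_all
        show "sets ?\<delta> = sets (tuple_space (closure D) (?J - {1..k}))"
          unfolding dual_semigroup_def by (rule sets.sets_measure_of_eq)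
      qed (use k closure_subset in \<open>auto simp: borel_closed\<close>)
      then show "real (n choose k) * (\<Sum>i | i \<in> ?J - {1..k} \<rightarrow>\<^sub>E {1..N} \<and> inj_on i (?J - {1..k}).
            \<integral>z. f z \<partial>gas_product (\<nu> t) (p t) D ?J {1..k} i) =
          real (n choose k) * (LINT z : ?J \<rightarrow>\<^sub>E D |
            distr (PiM {1..k} (\<lambda>_. reservoir_intensity D P Y lam \<mu> t) \<Otimes>\<^sub>M ?\<delta>)
              (tuple_space (closure D) ?J) (merge {1..k} (?J - {1..k})). f z)"
        unfolding \<nu>_def by simp
    qed
    finally show "(\<integral>\<omega>. (\<integral>z. f z \<partial>factorial_measure D ?J (H t \<omega>)) \<partial>Q) = \<dots>" .
  qed

  \<comment> \<open>The density for a symmetric transition density\<close>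
  have b: "\<rho> \<in> borel_measurable (PiM ?J (\<lambda>_. m)) \<and>
      expected_factorial_measure Q D ?J (H t) = density (PiM ?J (\<lambda>_. m)) (\<lambda>z. ennreal (\<rho> z))"
    if m: "symmetric_transition_density D P Y m \<pp>" "\<mu> = m" and t: "0 < t"
      and \<rho>: "\<rho> = (\<lambda>z. \<Sum>I\<in>Pow ?J. absorbed_functional D P Y lam I t (restrict z I) *
                     (\<integral>y. (\<Prod>j\<in>?J - I. \<pp> t (z j) (y j)) \<partial>factorial_measure D (?J - I) \<eta>))"
    for m \<pp> t \<rho>
  proof -
    have t0: "0 \<le> t" using t by simp
    let ?g = "boundary_mean D P Y lam t" and ?q = "\<lambda>l y. ennreal (\<pp> t (x l) y)"
    note bm = measurable_boundary_mean[OF Y cont P t0 lam C(1)] boundary_mean_le[OF Y cont P t0 lam C(1) C(2)]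
      reservoir_intensity_eq_density[OF Y cont P t0 lam C(1)] absorbed_functional_eq[OF Y cont P t0 lam C(1)]
    have sets_m: "sets m = sets (restrict_space borel D)" "finite_measure m" using \<mu> m(2) by auto
    have \<pp>: "0 \<le> \<pp> t u v" "\<pp> t u v = \<pp> t v u" if "u \<in> D" "v \<in> D" for u v
      using m(1) t that by (auto simp: symmetric_transition_density_def)
    have \<pp>_meas: "\<pp> t u \<in> borel_measurable m" if "u \<in> D" for u
      using m(1) t that by (simp add: symmetric_transition_density_def)
    have \<pp>_dens: "restrict_space (transition_prob D P Y t u) D = density m (\<lambda>y. ennreal (\<pp> t u y))" if "u \<in> D" for u
      using m(1) t that by (simp add: symmetric_transition_density_def)
    have g_meas: "?g \<in> borel_measurable m"
      using measurable_restrict_space1[of ?g borel borel D] bm(1) measurable_cong_sets[OF sets_m(1) refl] by auto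
    have space_m: "space (PiM ?J (\<lambda>_. m)) = ?J \<rightarrow>\<^sub>E D"
      using sets_eq_imp_space_eq[OF sets_m(1)] by (simp add: space_PiM space_restrict_space)
    have q_meas: "?q l \<in> borel_measurable m" if "l \<in> {1..N}" for l
      using \<pp>_meas[OF x[OF that]] by simp
    have q_dens: "restrict_space (p t l) D = density m (?q l)" if "l \<in> {1..N}" for l
      unfolding p_def by (rule \<pp>_dens[OF x[OF that]])
    have \<nu>_dens: "\<nu> t = density m ?g"
      by (simp add: \<nu>_def m(2) bm(3))
    note dens = D(2) sets_\<nu> fin_\<nu>[OF t0] p[OF t0] finite_atLeastAtMost[of 1 n] sets_m g_meas \<nu>_dens q_meas q_dens
    have dens_meas: "gas_density ?J N ?g ?q \<in> borel_measurable (PiM ?J (\<lambda>_. m))"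
      by (rule measurable_gas_density[OF dens])
    have X_eq: "?X t = density (PiM ?J (\<lambda>_. m)) (gas_density ?J N ?g ?q)"
      by (rule gas_mixture_eq_density[OF dens])
    \<comment> \<open>Tuples in \<open>D\<close> are the whole space of the product measure, so only
      there is \<open>\<rho>\<close> compared with the density already found. Nonnegativity is
      recorded as well because \<open>ennreal\<close> would hide negative values.\<close>
    have \<rho>_eq: "ennreal (\<rho> z) = gas_density ?J N ?g ?q z" and \<rho>_nonneg: "0 \<le> \<rho> z"
      if z: "z \<in> ?J \<rightarrow>\<^sub>E D" for z
    proof -
      let ?I = "\<lambda>I. {i. i \<in> ?J - I \<rightarrow>\<^sub>E {1..N} \<and> inj_on i (?J - I)}"
      let ?F = "\<lambda>I i. \<Prod>j\<in>?J - I. \<pp> t (x (i j)) (z j)"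
      have zD: "z j \<in> D" if "j \<in> ?J" for j using z that by (rule PiE_mem)
      have xi: "x (i j) \<in> D" if "i \<in> ?I I" "j \<in> ?J - I" for I i j
        using that by (intro x) (auto simp: PiE_iff)
      have F0: "0 \<le> ?F I i" if "i \<in> ?I I" for I i
        using xi[OF that] zD by (intro prod_nonneg ballI \<pp>(1)) auto
      have integral: "(\<integral>y. (\<Prod>j\<in>?J - I. \<pp> t (z j) (y j)) \<partial>factorial_measure D (?J - I) \<eta>) = (\<Sum>i\<in>?I I. ?F I i)" for I
      proof -
        have "(\<lambda>y. \<Prod>j\<in>?J - I. \<pp> t (z j) (y j)) \<in> borel_measurable (tuple_space D (?J - I))"
        proof (rule borel_measurable_prod)
          fix j assume j: "j \<in> ?J - I"
          then have "(\<lambda>y. y j) \<in> tuple_space D (?J - I) \<rightarrow>\<^sub>M restrict_space borel D"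
            unfolding tuple_space_def by (rule measurable_component_singleton)
          moreover have "\<pp> t (z j) \<in> borel_measurable (restrict_space borel D)"
            using \<pp>_meas[OF zD, of j] j measurable_cong_sets[OF sets_m(1) refl] by blast
          ultimately show "(\<lambda>y. \<pp> t (z j) (y j)) \<in> borel_measurable (tuple_space D (?J - I))"
            by (rule measurable_compose)
        qed
        then have "(\<integral>y. (\<Prod>j\<in>?J - I. \<pp> t (z j) (y j)) \<partial>factorial_measure D (?J - I) \<eta>) =
            (\<Sum>i\<in>?I I. \<Prod>j\<in>?J - I. \<pp> t (z j) ((\<lambda>j\<in>?J - I. x (i j)) j))"
          unfolding \<eta> by (intro integral_factorial_measure_point_sum x) simp_all
        also have "\<dots> = (\<Sum>i\<in>?I I. ?F I i)"
        proof (intro sum.cong prod.cong refl)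
          \<comment> \<open>Symmetry reverses time here: the formula runs from \<open>z j\<close> to
            an initial point, whereas the density of the transition law runs from the initial point
            to \<open>z j\<close>.\<close>
          fix i j assume "i \<in> ?I I" "j \<in> ?J - I"
          then show "\<pp> t (z j) ((\<lambda>j\<in>?J - I. x (i j)) j) = \<pp> t (x (i j)) (z j)"
            using \<pp>(2)[OF zD xi, of j i I j] by simp
        qed
        finally show ?thesis .
      qed
      have func: "ennreal (absorbed_functional D P Y lam I t (restrict z I)) = (\<Prod>j\<in>I. ?g (z j))"
        "0 \<le> absorbed_functional D P Y lam I t (restrict z I)" if "I \<in> Pow ?J" for I
      proof -
        have "finite I" using that by (auto intro: finite_subset)
        then have eq: "absorbed_functional D P Y lam I t (restrict z I) = enn2real (\<Prod>j\<in>I. ?g (z j))"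
          by (simp add: bm(4))
        \<comment> \<open>Boundedness of \<open>lam\<close> makes the means finite, so that
          \<open>enn2real\<close> loses nothing.\<close>
        have "?g v < top" for v using bm(2)[of v] by (rule le_less_trans) simp_all
        then have "(\<Prod>j\<in>I. ?g (z j)) < top"
          by (simp add: less_top[symmetric] ennreal_prod_eq_top)
        then show "ennreal (absorbed_functional D P Y lam I t (restrict z I)) = (\<Prod>j\<in>I. ?g (z j))"
          unfolding eq by (rule ennreal_enn2real)
        show "0 \<le> absorbed_functional D P Y lam I t (restrict z I)" unfolding eq by simp
      qed
      have \<rho>_z: "\<rho> z = (\<Sum>I\<in>Pow ?J. absorbed_functional D P Y lam I t (restrict z I) * (\<Sum>i\<in>?I I. ?F I i))"
        unfolding \<rho> integral ..
      have term0: "0 \<le> absorbed_functional D P Y lam I t (restrict z I) * (\<Sum>i\<in>?I I. ?F I i)" if "I \<in> Pow ?J" for I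
        using func(2)[OF that] F0 by (intro mult_nonneg_nonneg sum_nonneg)
      show "0 \<le> \<rho> z" unfolding \<rho>_z using term0 by (rule sum_nonneg)
      have "ennreal (\<rho> z) = (\<Sum>I\<in>Pow ?J. ennreal (absorbed_functional D P Y lam I t (restrict z I) * (\<Sum>i\<in>?I I. ?F I i)))"
        unfolding \<rho>_z using term0 by (rule sum_ennreal[symmetric])
      also have "\<dots> = (\<Sum>I\<in>Pow ?J. \<Sum>i\<in>?I I. (\<Prod>j\<in>I. ?g (z j)) * (\<Prod>j\<in>?J - I. ?q (i j) (z j)))"
      proof (rule sum.cong[OF refl])
        fix I assume I: "I \<in> Pow ?J"
        have "ennreal (\<Sum>i\<in>?I I. ?F I i) = (\<Sum>i\<in>?I I. ennreal (?F I i))"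
          using F0 by (rule sum_ennreal[symmetric])
        also have "\<dots> = (\<Sum>i\<in>?I I. \<Prod>j\<in>?J - I. ?q (i j) (z j))"
        proof (rule sum.cong[OF refl])
          fix i assume i: "i \<in> ?I I"
          show "ennreal (?F I i) = (\<Prod>j\<in>?J - I. ?q (i j) (z j))"
            using xi[OF i] zD by (intro prod_ennreal[symmetric] \<pp>(1)) auto
        qed
        finally have "ennreal (\<Sum>i\<in>?I I. ?F I i) = (\<Sum>i\<in>?I I. \<Prod>j\<in>?J - I. ?q (i j) (z j))" .
        then show "ennreal (absorbed_functional D P Y lam I t (restrict z I) * (\<Sum>i\<in>?I I. ?F I i)) =
            (\<Sum>i\<in>?I I. (\<Prod>j\<in>I. ?g (z j)) * (\<Prod>j\<in>?J - I. ?q (i j) (z j)))"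
          unfolding ennreal_mult'[OF func(2)[OF I]] func(1)[OF I] by (simp only: sum_distrib_left)
      qed
      also have "\<dots> = gas_density ?J N ?g ?q z"
        unfolding gas_density_def by (rule sum_gas_index[symmetric]) simp
      finally show "ennreal (\<rho> z) = gas_density ?J N ?g ?q z" .
    qed
    \<comment> \<open>Measurability is not visible from the integrals that define
      \<open>\<rho>\<close>; it is inherited from the density with which \<open>\<rho>\<close>
      agrees.\<close>
    have "(\<lambda>z. enn2real (gas_density ?J N ?g ?q z)) \<in> borel_measurable (PiM ?J (\<lambda>_. m))"
      using dens_meas by simp
    then have \<rho>_meas: "\<rho> \<in> borel_measurable (PiM ?J (\<lambda>_. m))"
    proof (rule measurable_cong[THEN iffD1, rotated])
      show "enn2real (gas_density ?J N ?g ?q z) = \<rho> z" if "z \<in> space (PiM ?J (\<lambda>_. m))" for z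
        using \<rho>_eq[of z] \<rho>_nonneg[of z] that unfolding space_m by (metis enn2real_ennreal)
    qed
    have "density (PiM ?J (\<lambda>_. m)) (gas_density ?J N ?g ?q) = density (PiM ?J (\<lambda>_. m)) (\<lambda>z. ennreal (\<rho> z))"
    proof (intro density_cong dens_meas AE_I2)
      show "gas_density ?J N ?g ?q z = ennreal (\<rho> z)" if "z \<in> space (PiM ?J (\<lambda>_. m))" for z
        using that unfolding space_m by (rule \<rho>_eq[symmetric])
      show "(\<lambda>z. ennreal (\<rho> z)) \<in> borel_measurable (PiM ?J (\<lambda>_. m))"
        using \<rho>_meas by (rule measurable_compose[OF _ measurable_ennreal])
    qed
    then show ?thesis using \<rho>_meas gas[OF t0] X_eq by simp
  qed
  show ?thesis
  proof (intro conjI allI ballI impI)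
    fix t :: real and f :: "(nat \<Rightarrow> real^'d) \<Rightarrow> real" assume t: "0 \<le> t" and f: "f \<in> borel_measurable (tuple_space D ?J)"
      and *: "(\<exists>C. \<forall>z\<in>?J \<rightarrow>\<^sub>E D. \<bar>f z\<bar> \<le> C) \<and> (\<forall>\<pi>. \<pi> permutes ?J \<longrightarrow> (\<forall>z\<in>?J \<rightarrow>\<^sub>E D. f (z \<circ> \<pi>) = f z))"
    then obtain B where "\<And>z. z \<in> ?J \<rightarrow>\<^sub>E D \<Longrightarrow> \<bar>f z\<bar> \<le> B" by blast
    note a = a[OF t f this]
    show "integrable Q (\<lambda>\<omega>. \<integral>z. f z \<partial>factorial_measure D ?J (H t \<omega>))"
      using a * by blast
    show "(\<integral>\<omega>. (\<integral>z. f z \<partial>factorial_measure D ?J (H t \<omega>)) \<partial>Q) =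
      (\<Sum>k=0..n. real (n choose k) *
         (LINT z : ?J \<rightarrow>\<^sub>E D |
            distr (PiM {1..k} (\<lambda>_. reservoir_intensity D P Y lam \<mu> t) \<Otimes>\<^sub>M
                   dual_semigroup D P Y (?J - {1..k}) t (factorial_measure D (?J - {1..k}) \<eta>))
              (tuple_space (closure D) ?J) (merge {1..k} (?J - {1..k})).
            f z))"
      using a * by blast
  next
    fix m \<pp> and t :: real assume "symmetric_transition_density D P Y m \<pp> \<and> \<mu> = m" "0 < t"
    then show "let \<rho> = (\<lambda>z. \<Sum>I\<in>Pow ?J. absorbed_functional D P Y lam I t (restrict z I) *
                     (\<integral>y. (\<Prod>j\<in>?J - I. \<pp> t (z j) (y j)) \<partial>factorial_measure D (?J - I) \<eta>))
           in \<rho> \<in> borel_measurable (PiM ?J (\<lambda>_. m)) \<and>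
              expected_factorial_measure Q D ?J (H t) = density (PiM ?J (\<lambda>_. m)) (\<lambda>z. ennreal (\<rho> z))"
      unfolding Let_def using b by blast
  qed
qed

end
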